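(* Let $k\ge 3$ be an integer and let $G\in\mathcal{G}_k$ have $n$ vertices. Then the edge set of $G$ can be partitioned into exactly $n/2$ paths.
   Context: All graphs are finite and simple. The girth of a graph is the length of a shortest cycle; the length of a path or cycle is its number of edges. For an integer $k\ge 3$, $\mathcal{G}_k$ denotes the class of all $2k$-regular graphs of girth at least $2k-2$ that admit a pair of disjoint perfect matchings. A decomposition of a graph is a set of subgraphs whose edge sets partition its edge set. *)

theory Defs
  imports Main
begin

definition simple_graph :: "'a set \<Rightarrow> 'a set set \<Rightarrow> bool" where
  "simple_graph V E \<longleftrightarrow> finite V \<and> (\<forall>e\<in>E. \<exists>u v. u \<in> V \<and> v \<in> V \<and> u \<noteq> v \<and> e = {u, v})"

definition degree :: "'a set set \<Rightarrow> 'a \<Rightarrow> nat" where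
  "degree E v = card {e \<in> E. v \<in> e}"

definition regular :: "'a set \<Rightarrow> 'a set set \<Rightarrow> nat \<Rightarrow> bool" where
  "regular V E d \<longleftrightarrow> (\<forall>v\<in>V. degree E v = d)"

definition perfect_matching :: "'a set \<Rightarrow> 'a set set \<Rightarrow> 'a set set \<Rightarrow> bool" where
  "perfect_matching V E M \<longleftrightarrow> M \<subseteq> E \<and> (\<forall>v\<in>V. \<exists>!e. e \<in> M \<and> v \<in> e)"

definition walk_edges :: "'a list \<Rightarrow> 'a set set" where
  "walk_edges p = {{p ! i, p ! Suc i} | i. Suc i < length p}"

definition is_path :: "'a set \<Rightarrow> 'a set set \<Rightarrow> 'a list \<Rightarrow> bool" where
  "is_path V E p \<longleftrightarrow> length p \<ge> 2 \<and> distinct p \<and> set p \<subseteq> V \<and> walk_edges p \<subseteq> E"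

definition is_cycle :: "'a set \<Rightarrow> 'a set set \<Rightarrow> 'a list \<Rightarrow> bool" where
  "is_cycle V E c \<longleftrightarrow> length c \<ge> 3 \<and> distinct c \<and> set c \<subseteq> V \<and>
     walk_edges c \<subseteq> E \<and> {last c, hd c} \<in> E"

(* girth at least g: no cycle of length less than g (acyclic graphs have infinite girth) *)
definition girth_at_least :: "'a set \<Rightarrow> 'a set set \<Rightarrow> nat \<Rightarrow> bool" where
  "girth_at_least V E g \<longleftrightarrow> (\<forall>c. is_cycle V E c \<longrightarrow> length c \<ge> g)"

definition class_G :: "nat \<Rightarrow> 'a set \<Rightarrow> 'a set set \<Rightarrow> bool" where
  "class_G k V E \<longleftrightarrow> simple_graph V E \<and> regular V E (2 * k) \<and>
     girth_at_least V E (2 * k - 2) \<and>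
     (\<exists>M1 M2. perfect_matching V E M1 \<and> perfect_matching V E M2 \<and> M1 \<inter> M2 = {})"

definition path_decomposition :: "'a set \<Rightarrow> 'a set set \<Rightarrow> 'a list list \<Rightarrow> bool" where
  "path_decomposition V E ps \<longleftrightarrow> (\<forall>p\<in>set ps. is_path V E p) \<and>
     (\<forall>i<length ps. \<forall>j<length ps. i \<noteq> j \<longrightarrow> walk_edges (ps ! i) \<inter> walk_edges (ps ! j) = {}) \<and>
     (\<Union>p\<in>set ps. walk_edges p) = E"

end

theory Submission
  imports Defs
begin

text \<open>The matching $M_1$ is a system of $n/2$ paths with one edge each. By Petersen's theorem the graph without
  $M_1$ and $M_2$ splits into $k - 1$ two-factors, each given by a permutation of the vertices. Adding a
  two-factor prolongs every path at both ends, and by the girth the results are again paths as long as they have at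
  most $2k - 2$ vertices. The last two-factor may instead close a path into a cycle. After exchanging and
  reversing arcs of the last two factors, the closed vertices can be two-coloured along their orbits, and opening the
  cycles of one colour at a neighbouring arc gives $n/2$ paths with $2k$ vertices that cover all edges
  outside $M_2$. The edges of $M_2$ join the ends of these paths to chains, along which the paths are
  rearranged into $n/2$ pieces, each a path or a cycle of length $2k$. Finally a cycle and another piece
  that meets it are together the union of two edge-disjoint paths, which removes the cycles one by one.\<close>

section \<open>Walks and cycles\<close>

text \<open>The count leaves no slack: there are kn edges, so n/2 pieces have 2k edges on average.
  Every two-factor adds two vertices to a path that starts with two, which gives exactly 2k vertices
  in the end, and the second matching supplies one more edge per path. The bound 2k - 2 is just too
  weak at two places, and these shape the proof. An arc attached to a path with 2k - 2 vertices can
  hit that path only at its opposite end, and this closes a cycle of length 2k - 2, which the girth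
  permits; hence the work on closed vertices. An edge attached to a path with 2k vertices may hit
  any of its last three vertices. Such a chord cannot be excluded; it is only known that of two
  chords from the same end one goes to the opposite end. A chord of such a cycle exists only for k =
  3, as a long diagonal of a hexagon, so hexagons are the only irregular case when cycles are merged
  away.\<close>

lemma walk_edges_Nil [simp]: "walk_edges [] = {}"
  and walk_edges_single [simp]: "walk_edges [x] = {}"
  by (auto simp: walk_edges_def)

lemma walk_edges_Cons2 [simp]: "walk_edges (x # y # xs) = insert {x, y} (walk_edges (y # xs))"
proof
  show "walk_edges (x # y # xs) \<subseteq> insert {x, y} (walk_edges (y # xs))"
  proof
    fix e assume "e \<in> walk_edges (x # y # xs)"
    then obtain i where i: "Suc i < length (x # y # xs)" "e = {(x # y # xs) ! i, (x # y # xs) ! Suc i}"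
      by (auto simp: walk_edges_def)
    show "e \<in> insert {x, y} (walk_edges (y # xs))"
    proof (cases i)
      case (Suc j)
      then have "Suc j < length (y # xs)" "e = {(y # xs) ! j, (y # xs) ! Suc j}" using i by auto
      then show ?thesis unfolding walk_edges_def by blast
    qed (use i in simp)
  qed
  show "insert {x, y} (walk_edges (y # xs)) \<subseteq> walk_edges (x # y # xs)"
  proof
    fix e assume "e \<in> insert {x, y} (walk_edges (y # xs))"
    then consider "e = {x, y}" | i where "Suc i < length (y # xs)" "e = {(y # xs) ! i, (y # xs) ! Suc i}"
      by (auto simp: walk_edges_def)
    then show "e \<in> walk_edges (x # y # xs)"
    proof cases
      case 1
      then have "Suc 0 < length (x # y # xs)" "e = {(x # y # xs) ! 0, (x # y # xs) ! Suc 0}" by auto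
      then show ?thesis unfolding walk_edges_def by blast
    next
      case 2
      then have "Suc (Suc i) < length (x # y # xs)"
        "e = {(x # y # xs) ! Suc i, (x # y # xs) ! Suc (Suc i)}" by auto
      then show ?thesis unfolding walk_edges_def by blast
    qed
  qed
qed

lemma walk_edges_split: "walk_edges (xs @ a # ys) = walk_edges (xs @ [a]) \<union> walk_edges (a # ys)"
proof (induction xs)
  case (Cons x xs)
  then show ?case by (cases xs) auto
qed simp

lemma walk_edges_snoc2: "walk_edges (xs @ [a, b]) = insert {a, b} (walk_edges (xs @ [a]))"
  by (subst walk_edges_split) auto

lemma walk_edges_append:
  assumes "xs \<noteq> []" "ys \<noteq> []"
  shows "walk_edges (xs @ ys) = insert {last xs, hd ys} (walk_edges xs \<union> walk_edges ys)"
proof -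
  obtain xs' a where xs: "xs = xs' @ [a]" using assms(1) by (metis append_butlast_last_id)
  obtain b ys' where ys: "ys = b # ys'" using assms(2) by (cases ys) auto
  show ?thesis unfolding xs ys using walk_edges_split[of xs' a "b # ys'"] by auto
qed

lemma walk_edges_rev [simp]: "walk_edges (rev xs) = walk_edges xs"
proof (induction xs)
  case (Cons x xs)
  show ?case
  proof (cases xs)
    case (Cons y ys)
    have "walk_edges (rev (x # xs)) = insert {y, x} (walk_edges (rev ys @ [y]))"
      using Cons by (simp add: walk_edges_snoc2)
    then show ?thesis using Cons.IH Cons by (auto simp: insert_commute)
  qed simp
qed simp

lemma walk_edges_subset: "e \<in> walk_edges p \<Longrightarrow> e \<subseteq> set p"
  by (auto simp: walk_edges_def)

lemma finite_walk_edges [simp]: "finite (walk_edges p)"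
proof -
  have "walk_edges p = (\<lambda>i. {p ! i, p ! Suc i}) ` {i. Suc i < length p}"
    by (auto simp: walk_edges_def)
  moreover have "finite {i. Suc i < length p}" by (rule finite_subset[of _ "{..<length p}"]) auto
  ultimately show ?thesis by simp
qed

lemma card_walk_edges: "distinct p \<Longrightarrow> card (walk_edges p) = length p - 1"
proof (induction p)
  case (Cons x xs)
  show ?case
  proof (cases xs)
    case (Cons y ys)
    have "{x, y} \<notin> walk_edges xs" using Cons.prems walk_edges_subset[of "{x, y}" xs] by auto
    then show ?thesis using Cons.IH Cons.prems Cons by simp
  qed simp
qed simp

lemma walk_edges_mid: "{a, b} \<in> walk_edges (u @ a # b # w)"
  by (subst walk_edges_split) simp

definition cycle_edges :: "'a list \<Rightarrow> 'a set set" where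
  "cycle_edges c = insert {last c, hd c} (walk_edges c)"

lemma cycle_edges_rotate: "cycle_edges (xs @ ys) = cycle_edges (ys @ xs)"
proof (cases "xs = [] \<or> ys = []")
  case False
  then show ?thesis by (auto simp: cycle_edges_def walk_edges_append)
qed auto

lemma cycle_edges_rev: "cycle_edges (rev c) = cycle_edges c"
  by (cases "c = []") (auto simp: cycle_edges_def hd_rev last_rev insert_commute)

lemma cycle_edges_subset: "c \<noteq> [] \<Longrightarrow> e \<in> cycle_edges c \<Longrightarrow> e \<subseteq> set c"
  using walk_edges_subset by (fastforce simp: cycle_edges_def)

lemma cycle_edges_Cons_rev: "cycle_edges (v # rev c) = cycle_edges (v # c)"
  using cycle_edges_rotate[of "[v]" "rev c"] cycle_edges_rev[of "v # c"] by simp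

lemma card_cycle_edges:
  assumes "distinct c" "length c \<ge> 3"
  shows "card (cycle_edges c) = length c"
proof -
  obtain x y z w where c: "c = x # y # z # w"
  proof -
    obtain x c1 where 1: "c = x # c1" using assms(2) by (cases c) auto
    obtain y c2 where 2: "c1 = y # c2" using assms(2) 1 by (cases c1) auto
    obtain z w where 3: "c2 = z # w" using assms(2) 1 2 by (cases c2) auto
    show thesis using that 1 2 3 by simp
  qed
  have "{last c, x} \<notin> walk_edges c"
  proof
    assume "{last c, x} \<in> walk_edges c"
    then have "{last c, x} = {x, y} \<or> {last c, x} \<in> walk_edges (y # z # w)" using c by auto
    then show False
    proof
      assume "{last c, x} = {x, y}"
      then have "last (z # w) = y" using c assms(1) by (auto simp: doubleton_eq_iff)
      moreover have "last (z # w) \<in> set (z # w)" by (rule last_in_set) simp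
      ultimately show False using assms(1) c by auto
    next
      assume "{last c, x} \<in> walk_edges (y # z # w)"
      then have "x \<in> set (y # z # w)" using walk_edges_subset by fastforce
      then show False using assms(1) c by auto
    qed
  qed
  then have "card (cycle_edges c) = Suc (card (walk_edges c))" unfolding cycle_edges_def using c by simp
  then show ?thesis using card_walk_edges[OF assms(1)] assms(2) by simp
qed

lemma finite_cycle_edges [simp]: "finite (cycle_edges c)"
  by (simp add: cycle_edges_def)

section \<open>Merging a cycle with a path or a cycle\<close>

definition path_set :: "'a set set \<Rightarrow> bool" where
  "path_set A \<longleftrightarrow> (\<exists>p. length p \<ge> 2 \<and> distinct p \<and> walk_edges p = A)"

definition cycle_set :: "nat \<Rightarrow> 'a set set \<Rightarrow> bool" where
  "cycle_set n A \<longleftrightarrow> (\<exists>c. length c = n \<and> distinct c \<and> cycle_edges c = A)"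

definition two_paths :: "'a set set \<Rightarrow> bool" where
  "two_paths A \<longleftrightarrow> (\<exists>B C. path_set B \<and> path_set C \<and> B \<inter> C = {} \<and> B \<union> C = A)"

lemma path_set_nonempty:
  assumes "path_set A" shows "A \<noteq> {}"
proof -
  obtain p where "length p \<ge> 2" "distinct p" "walk_edges p = A" using assms by (auto simp: path_set_def)
  then have "card A \<ge> 1" using card_walk_edges[of p] by simp
  then show ?thesis by auto
qed

text \<open>Inclusion-exclusion: two paths that cover \<open>A\<close> and have together as many
  edges as \<open>A\<close> has elements share no edge. The rearrangements below therefore only need
  to name two lists and compare unions and lengths.\<close>

lemma two_pathsI:
  assumes "distinct p" "distinct q" "length p \<ge> 2" "length q \<ge> 2" "walk_edges p \<union> walk_edges q = A"
    and "card A + 2 = length p + length q"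
  shows "two_paths A"
proof -
  have "card (walk_edges p \<union> walk_edges q) + card (walk_edges p \<inter> walk_edges q) =
        card (walk_edges p) + card (walk_edges q)"
    by (rule card_Un_Int[symmetric]) auto
  then have "card (walk_edges p \<inter> walk_edges q) = 0"
    unfolding card_walk_edges[OF assms(1)] card_walk_edges[OF assms(2)] assms(5)
    using assms(3,4,6) by linarith
  then have "walk_edges p \<inter> walk_edges q = {}" by simp
  moreover have "path_set (walk_edges p)" "path_set (walk_edges q)" using assms by (auto simp: path_set_def)
  ultimately show ?thesis using assms(5) unfolding two_paths_def by blast
qed

lemma walk_edges_take: "walk_edges (take n p) \<subseteq> walk_edges p"
  by (auto simp: walk_edges_def)

lemma walk_edges_drop: "walk_edges (drop n p) \<subseteq> walk_edges p"
proof
  fix e assume "e \<in> walk_edges (drop n p)"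
  then obtain i where i: "Suc i < length (drop n p)" "e = {drop n p ! i, drop n p ! Suc i}"
    by (auto simp: walk_edges_def)
  then have "Suc (n + i) < length p" "e = {p ! (n + i), p ! Suc (n + i)}" by auto
  then show "e \<in> walk_edges p" unfolding walk_edges_def by blast
qed

lemma walk_edges_Cons_split:
  "walk_edges (x # ys @ z # z' # zs) = walk_edges (x # ys @ [z]) \<union> insert {z, z'} (walk_edges (z' # zs))"
  using walk_edges_split[of "x # ys" z "z' # zs"] by simp

lemma walk_edges_app_split:
  "walk_edges (xs @ z # z' # zs) = walk_edges (xs @ [z]) \<union> insert {z, z'} (walk_edges (z' # zs))"
  using walk_edges_split[of xs z "z' # zs"] by simp

text \<open>The path and the cycle are cut at \<open>v\<close>. The part \<open>r1\<close> continues
  round the cycle the long way to \<open>c1\<close>, and the cycle edge left out becomes the first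
  edge of a path that goes on along \<open>r2\<close>.\<close>

lemma cycle_path_free_neighbour:
  assumes c: "distinct (v # c1 # cs)" "length cs \<ge> 1" and p: "distinct (r1 @ v # r2)"
    and r1: "set r1 \<inter> set (v # c1 # cs) = {}" and dis: "cycle_edges (v # c1 # cs) \<inter> walk_edges (r1 @ v # r2) = {}"
    and c1: "c1 \<notin> set (r1 @ v # r2)"
  shows "two_paths (cycle_edges (v # c1 # cs) \<union> walk_edges (r1 @ v # r2))"
proof (rule two_pathsI)
  show "distinct (r1 @ v # rev (c1 # cs))" "distinct (c1 # v # r2)" using c p r1 c1 by auto
  have *: "cycle_edges (v # c1 # cs) = insert {v, c1} (walk_edges (v # rev (c1 # cs)))"
    using cycle_edges_Cons_rev[of v "c1 # cs"] by (simp add: cycle_edges_def insert_commute)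
  show "walk_edges (r1 @ v # rev (c1 # cs)) \<union> walk_edges (c1 # v # r2) =
      cycle_edges (v # c1 # cs) \<union> walk_edges (r1 @ v # r2)"
    unfolding * walk_edges_split[of r1 v r2] walk_edges_split[of r1 v "rev (c1 # cs)"]
    by (auto simp: insert_commute)
  have "card (cycle_edges (v # c1 # cs) \<union> walk_edges (r1 @ v # r2)) = length (v # c1 # cs) + (length (r1 @ v # r2) - 1)"
    using card_Un_disjoint[OF _ _ dis] card_cycle_edges[OF c(1)] card_walk_edges[OF p] c(2) by simp
  then show "card (cycle_edges (v # c1 # cs) \<union> walk_edges (r1 @ v # r2)) + 2 =
    length (r1 @ v # rev (c1 # cs)) + length (c1 # v # r2)" by simp
qed (use c in auto)

text \<open>Now \<open>c1\<close> is on the path, so the edge from \<open>c1\<close> to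
  \<open>v\<close> cannot simply be put before the rest. Instead the edges from \<open>c1\<close> to
  \<open>v\<close> and to \<open>s\<close> are exchanged: the long way round the cycle leaves
  \<open>c1\<close> towards \<open>s\<close>, and the other path returns from \<open>s\<close> to
  \<open>v\<close> before it steps to \<open>c1\<close>.\<close>

lemma cycle_path_outer_predecessor:
  assumes c: "distinct (v # c1 # cs)" "length cs \<ge> 1" and p: "distinct (r1 @ v # s1 @ s # c1 # s2)"
    and r1: "set r1 \<inter> set (v # c1 # cs) = {}" and s: "s \<notin> set (v # c1 # cs)"
    and dis: "cycle_edges (v # c1 # cs) \<inter> walk_edges (r1 @ v # s1 @ s # c1 # s2) = {}"
  shows "two_paths (cycle_edges (v # c1 # cs) \<union> walk_edges (r1 @ v # s1 @ s # c1 # s2))"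
proof (rule two_pathsI)
  show "distinct (r1 @ v # rev (c1 # cs) @ [s])" "distinct (s # rev s1 @ v # c1 # s2)" using c p r1 s by auto
  have *: "cycle_edges (v # c1 # cs) = insert {v, c1} (walk_edges (v # rev cs @ [c1]))"
    using cycle_edges_Cons_rev[of v "c1 # cs"] by (simp add: cycle_edges_def insert_commute)
  have 1: "walk_edges (r1 @ v # s1 @ s # c1 # s2) =
    walk_edges (r1 @ [v]) \<union> (walk_edges (v # s1 @ [s]) \<union> insert {s, c1} (walk_edges (c1 # s2)))"
    using walk_edges_split[of r1 v "s1 @ s # c1 # s2"] by (simp only: walk_edges_Cons_split)
  have 2: "walk_edges (r1 @ v # rev (c1 # cs) @ [s]) =
    walk_edges (r1 @ [v]) \<union> (walk_edges (v # rev cs @ [c1]) \<union> {{c1, s}})"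
    using walk_edges_split[of r1 v "rev cs @ [c1, s]"] walk_edges_Cons_split[of v "rev cs" c1 s "[]"] by simp
  have 3: "walk_edges (s # rev s1 @ v # c1 # s2) = walk_edges (v # s1 @ [s]) \<union> insert {v, c1} (walk_edges (c1 # s2))"
    using walk_edges_Cons_split[of s "rev s1" v c1 s2] walk_edges_rev[of "v # s1 @ [s]"] by simp
  show "walk_edges (r1 @ v # rev (c1 # cs) @ [s]) \<union> walk_edges (s # rev s1 @ v # c1 # s2) =
      cycle_edges (v # c1 # cs) \<union> walk_edges (r1 @ v # s1 @ s # c1 # s2)"
    unfolding * 1 2 3 by (auto simp: insert_commute)
  have "card (cycle_edges (v # c1 # cs) \<union> walk_edges (r1 @ v # s1 @ s # c1 # s2)) =
      length (v # c1 # cs) + (length (r1 @ v # s1 @ s # c1 # s2) - 1)"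
    using card_Un_disjoint[OF _ _ dis] card_cycle_edges[OF c(1)] card_walk_edges[OF p] c(2) by simp
  then show "card (cycle_edges (v # c1 # cs) \<union> walk_edges (r1 @ v # s1 @ s # c1 # s2)) + 2 =
    length (r1 @ v # rev (c1 # cs) @ [s]) + length (s # rev s1 @ v # c1 # s2)" by simp
qed (use c in auto)

section \<open>Chords under the girth bound\<close>

locale girth_graph =
  fixes V :: "'a set" and E :: "'a set set" and k :: nat
  assumes simple: "simple_graph V E" and k3: "k \<ge> 3" and girth: "girth_at_least V E (2 * k - 2)"
begin

lemma finite_V: "finite V"
  using simple by (auto simp: simple_graph_def)

lemma edge_subset: "e \<in> E \<Longrightarrow> e \<subseteq> V"
  using simple by (fastforce simp: simple_graph_def)

lemma finite_E: "finite E"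
  using edge_subset finite_V by (meson finite_Pow_iff finite_subset Pow_iff subsetI)

lemma no_loop: "{a, a} \<notin> E"
  using simple by (force simp: simple_graph_def)

lemma edge_neq: "{a, b} \<in> E \<Longrightarrow> a \<noteq> b"
  using no_loop by auto

lemma set_subset_V: "walk_edges p \<subseteq> E \<Longrightarrow> length p \<ge> 2 \<Longrightarrow> set p \<subseteq> V"
proof (induction p)
  case (Cons x xs)
  then obtain y ys where xs: "xs = y # ys" by (cases xs) auto
  then have "{x, y} \<in> E" using Cons.prems by auto
  then have "x \<in> V" "y \<in> V" using edge_subset by auto
  then show ?case using Cons xs by (cases ys) auto
qed simp

lemma cycle_length:
  assumes "distinct c" "length c \<ge> 3" "walk_edges c \<subseteq> E" "{last c, hd c} \<in> E"
  shows "length c \<ge> 2 * k - 2"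
  using girth assms set_subset_V[of c] by (auto simp: girth_at_least_def is_cycle_def)

lemma triangle_free: "{a, b} \<in> E \<Longrightarrow> {b, c} \<in> E \<Longrightarrow> {a, c} \<in> E \<Longrightarrow> False"
  using cycle_length[of "[a, b, c]"] k3 edge_neq[of a b] edge_neq[of b c] edge_neq[of a c]
  by (auto simp: insert_commute)

lemma segment:
  assumes "i < j" "j < length q" "distinct q" "walk_edges q \<subseteq> E"
  defines "c \<equiv> take (j - i + 1) (drop i q)"
  shows "distinct c" "length c = j - i + 1" "walk_edges c \<subseteq> E" "hd c = q ! i" "last c = q ! j"
proof -
  show "distinct c" "length c = j - i + 1" using assms by auto
  show "walk_edges c \<subseteq> E" using assms(4) walk_edges_take walk_edges_drop unfolding c_def by blast
  show "hd c = q ! i" "last c = q ! j" using assms by (auto simp: hd_drop_conv_nth last_conv_nth)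
qed

lemma chord_distance:
  assumes "i < j" "j < length q" "distinct q" "walk_edges q \<subseteq> E" "{q ! i, q ! j} \<in> E" "j \<noteq> Suc i"
  shows "j - i + 1 \<ge> 2 * k - 2"
  using segment[OF assms(1-4)] cycle_length[of "take (j - i + 1) (drop i q)"] assms(1,5,6)
  by (simp add: insert_commute)

lemma common_neighbour_distance:
  assumes "i < j" "j < length q" "distinct q" "walk_edges q \<subseteq> E" "{x, q ! i} \<in> E" "{x, q ! j} \<in> E"
    "x \<notin> set (drop i q)"
  shows "j - i + 2 \<ge> 2 * k - 2"
proof -
  obtain c where c: "c = take (j - i + 1) (drop i q)" by simp
  note s = segment[OF assms(1-4), folded c]
  obtain c' where c': "c = q ! i # c'" using s(2,4) by (cases c) auto
  have "set c \<subseteq> set (drop i q)" unfolding c by (rule set_take_subset)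
  then have "distinct (x # c)" using s(1) assms(7) by auto
  moreover have "walk_edges (x # c) \<subseteq> E"
    using s(3) assms(5) unfolding c' by simp
  moreover have "{last (x # c), hd (x # c)} \<in> E" using s(5) c' assms(6) by (simp add: insert_commute)
  ultimately show ?thesis using cycle_length[of "x # c"] s(2) assms(1) by simp
qed

text \<open>A chord splits the cycle into two cycles with 2k + 2 edges in total, each of length at
  least 2k - 2. Hence k \<le> 3, and for k = 3 both have length 4, so the chord is a long diagonal
  of a hexagon.\<close>

lemma cycle_chord:
  assumes c: "distinct (v # cs)" "length (v # cs) = 2 * k" "cycle_edges (v # cs) \<subseteq> E"
    and u: "u \<in> set (v # cs)" "{v, u} \<in> E" "{v, u} \<notin> cycle_edges (v # cs)"
  shows "k = 3 \<and> u = (v # cs) ! 3"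
proof -
  let ?c = "v # cs"
  obtain j where j: "j < 2 * k" "u = ?c ! j" using u(1) c(2) by (metis in_set_conv_nth)
  have w: "walk_edges ?c \<subseteq> E" using c(3) by (auto simp: cycle_edges_def)
  have j0: "j \<noteq> 0" using u(2) j(2) edge_neq by (metis nth_Cons_0)
  have j1: "j \<noteq> 1"
  proof
    assume "j = 1"
    then obtain cs' where "cs = u # cs'" using j c(2) k3 by (cases cs) auto
    then show False using u(3) by (simp add: cycle_edges_def)
  qed
  have jl: "j \<noteq> 2 * k - 1"
  proof
    assume "j = 2 * k - 1"
    moreover have "last ?c = ?c ! (length ?c - 1)" by (rule last_conv_nth) simp
    ultimately have "u = last ?c" by (simp only: c(2) j(2))
    then show False using u(3) by (simp add: cycle_edges_def insert_commute)
  qed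
  have "j + 1 \<ge> 2 * k - 2" using chord_distance[of 0 j ?c] j j0 j1 c w u(2) by simp
  moreover have "length (drop j ?c @ [v]) \<ge> 2 * k - 2"
  proof (rule cycle_length)
    have "v \<notin> set (drop j ?c)" using c(1) j0 by (cases j) (auto dest: in_set_dropD)
    then show "distinct (drop j ?c @ [v])" using c(1) by simp
    show "length (drop j ?c @ [v]) \<ge> 3" using j jl c(2) by simp
    have "drop j ?c \<noteq> []" using j c(2) by simp
    moreover have "last (drop j ?c) = last ?c" using j c(2) by (simp add: last_drop)
    moreover have "walk_edges (drop j ?c) \<subseteq> E" using w walk_edges_drop by blast
    ultimately show "walk_edges (drop j ?c @ [v]) \<subseteq> E"
      using c(3) by (simp add: walk_edges_append cycle_edges_def)
    have "hd (drop j ?c @ [v]) = u" using j c(2) by (simp add: hd_append hd_drop_conv_nth)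
    then show "{last (drop j ?c @ [v]), hd (drop j ?c @ [v])} \<in> E" using u(2) by simp
  qed
  ultimately have "j \<le> 3" "j + 3 \<ge> 2 * k" using j c(2) by (auto simp: Suc_diff_le)
  then have "k = 3" "j = 3" using k3 by auto
  then show ?thesis using j by simp
qed

text \<open>\<open>v\<close> is the first vertex of the path that lies on the cycle. The two
  rearrangements above fail only if \<open>c1\<close> is on the path and its predecessor there is on
  the cycle. The edge between these two is then a chord, so k = 3 and the predecessor is opposite to
  \<open>c1\<close> in the hexagon, which is the vertex with index 4.\<close>

lemma cycle_path_first:
  assumes c: "distinct (v # c1 # cs)" "length (v # c1 # cs) = 2 * k" "cycle_edges (v # c1 # cs) \<subseteq> E"
    and p: "distinct (r1 @ v # r2)" "walk_edges (r1 @ v # r2) \<subseteq> E"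
    and r1: "set r1 \<inter> set (v # c1 # cs) = {}" and dis: "cycle_edges (v # c1 # cs) \<inter> walk_edges (r1 @ v # r2) = {}"
  shows "two_paths (cycle_edges (v # c1 # cs) \<union> walk_edges (r1 @ v # r2)) \<or>
    (k = 3 \<and> (\<exists>s1 s2. r2 = s1 @ ((v # c1 # cs) ! 4) # c1 # s2))"
proof (cases "c1 \<in> set (r1 @ v # r2)")
  case False
  then show ?thesis using cycle_path_free_neighbour[OF c(1) _ p(1) r1 dis] c(2) k3 by auto
next
  case True
  then have "c1 \<in> set r2" using r1 c(1) by auto
  then obtain t s2 where r2: "r2 = t @ c1 # s2" by (auto dest: split_list)
  have vc1: "{v, c1} \<in> cycle_edges (v # c1 # cs)" by (simp add: cycle_edges_def)
  have "t \<noteq> []"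
  proof
    assume "t = []"
    then have "{v, c1} \<in> walk_edges (r1 @ v # r2)" unfolding r2 by (simp add: walk_edges_mid)
    then show False using dis vc1 by auto
  qed
  then obtain s1 s where t: "t = s1 @ [s]" by (metis append_butlast_last_id)
  show ?thesis
  proof (cases "s \<in> set (v # c1 # cs)")
    case False
    have "two_paths (cycle_edges (v # c1 # cs) \<union> walk_edges (r1 @ v # s1 @ s # c1 # s2))"
      by (rule cycle_path_outer_predecessor) (use c p r1 dis r2 t k3 False in auto)
    then show ?thesis using r2 t by simp
  next
    case True
    have eq: "cycle_edges (c1 # cs @ [v]) = cycle_edges (v # c1 # cs)"
      using cycle_edges_rotate[of "[v]" "c1 # cs"] by simp
    have sc: "{s, c1} \<in> walk_edges (r1 @ v # r2)"
      using walk_edges_mid[of s c1 "r1 @ v # s1" s2] r2 t by simp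
    have "k = 3 \<and> s = (c1 # cs @ [v]) ! 3"
      by (rule cycle_chord) (use c p True eq sc dis in \<open>auto simp: insert_commute\<close>)
    moreover have "(c1 # cs @ [v]) ! 3 = (v # c1 # cs) ! 4" if "k = 3"
      using that c(2) by (simp add: nth_append)
    ultimately show ?thesis using r2 t by auto
  qed
qed

end

lemma append_Cons_eqD:
  "xs @ x # xs' = ys @ x # ys' \<Longrightarrow> x \<notin> set xs \<Longrightarrow> x \<notin> set ys \<Longrightarrow> xs = ys \<and> xs' = ys'"
proof (induction xs arbitrary: ys)
  case (Cons a xs)
  then show ?case by (cases ys) auto
qed (auto simp: Cons_eq_append_conv)

section \<open>Hexagons, the exceptional case k = 3\<close>

context girth_graph
begin

text \<open>Each new path visits all six hexagon vertices and takes three hexagon edges and one of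
  the two diagonals \<open>c4 c1\<close> and \<open>c2 c5\<close>. The stretches \<open>al\<close>
  and \<open>ga\<close> go to the first path, \<open>be\<close> to the second.\<close>

lemma hexagon_late:
  assumes c: "distinct [v, c1, c2, c3, c4, c5]" and C: "cycle_edges [v, c1, c2, c3, c4, c5] = C"
    and p: "p = r1 @ v # a # al @ c4 # c1 # be @ c2 # c5 # ga @ c3 # r2"
    and dp: "distinct p" and r1: "set r1 \<inter> {v, c1, c2, c3, c4, c5} = {}"
    and dis: "C \<inter> walk_edges p = {}"
  shows "two_paths (C \<union> walk_edges p)"
proof (rule two_pathsI)
  let ?q = "r1 @ v # c5 # ga @ c3 # c2 # c1 # c4 # rev al @ [a]"
  let ?r = "a # v # c1 # be @ c2 # c5 # c4 # c3 # r2"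
  show "distinct ?q" "distinct ?r" using c dp p r1 by auto
  have e1: "walk_edges (c4 # rev al @ [a]) = walk_edges (a # al @ [c4])"
    using walk_edges_rev[of "a # al @ [c4]"] by simp
  have e2: "walk_edges (c5 # ga @ c3 # r2) = walk_edges (c5 # ga @ [c3]) \<union> walk_edges (c3 # r2)"
    using walk_edges_split[of "c5 # ga" c3 r2] by simp
  have C': "C = {{v,c1},{c1,c2},{c2,c3},{c3,c4},{c4,c5},{c5,v}}"
    unfolding C[symmetric] by (auto simp: cycle_edges_def)
  show "walk_edges ?q \<union> walk_edges ?r = C \<union> walk_edges p"
    unfolding C' p by (simp only: walk_edges_app_split walk_edges_Cons_split walk_edges_Cons2 e1 e2)
      (auto simp: insert_commute)
  have "card C = 6" using card_cycle_edges[OF c] C by simp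
  then have "card (C \<union> walk_edges p) = 6 + (length p - 1)"
    using card_Un_disjoint[OF _ _ dis] card_walk_edges[OF dp] C by fastforce
  then show "card (C \<union> walk_edges p) + 2 = length ?q + length ?r" using p by simp
qed auto

text \<open>All three long diagonals lie on the path. The first new path takes one of them with four
  hexagon edges, the second the other two diagonals with the remaining two hexagon edges.\<close>

lemma hexagon_early:
  assumes c: "distinct [v, c1, c2, c3, c4, c5]" and C: "cycle_edges [v, c1, c2, c3, c4, c5] = C"
    and p: "p = r1 @ v # c3 # a # al @ c4 # c1 # be @ c2 # c5 # r2"
    and dp: "distinct p" and r1: "set (r1 @ r2) \<inter> {v, c1, c2, c3, c4, c5} = {}"
    and dis: "C \<inter> walk_edges p = {}"
  shows "two_paths (C \<union> walk_edges p)"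
proof (rule two_pathsI)
  let ?q = "r1 @ [v, c5, c4, c1, c2, c3, a]"
  let ?r = "a # al @ c4 # c3 # v # c1 # be @ c2 # c5 # r2"
  show "distinct ?q" "distinct ?r" using c dp p r1 by auto
  have C': "C = {{v,c1},{c1,c2},{c2,c3},{c3,c4},{c4,c5},{c5,v}}"
    unfolding C[symmetric] by (auto simp: cycle_edges_def)
  show "walk_edges ?q \<union> walk_edges ?r = C \<union> walk_edges p"
    unfolding C' p by (simp only: walk_edges_app_split walk_edges_Cons_split walk_edges_Cons2)
      (auto simp: insert_commute)
  have "card C = 6" using card_cycle_edges[OF c] C by simp
  then have "card (C \<union> walk_edges p) = 6 + (length p - 1)"
    using card_Un_disjoint[OF _ _ dis] card_walk_edges[OF dp] C by fastforce
  then show "card (C \<union> walk_edges p) + 2 = length ?q + length ?r" using p by simp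
qed auto

text \<open>If \<open>c3\<close> does not come after \<open>c5\<close>, then \<open>c5\<close> is
  the last hexagon vertex of the path, so \<open>cycle_path_first\<close> can be used again from the
  other end. Its exceptional outcome says that \<open>c3\<close> is the successor of
  \<open>v\<close>, which is the situation of \<open>hexagon_early\<close>.\<close>

lemma hexagon_path:
  assumes k: "k = 3"
    and c: "distinct [v, c1, c2, c3, c4, c5]" and CE: "cycle_edges [v, c1, c2, c3, c4, c5] \<subseteq> E"
    and p: "p = r1 @ v # al @ c4 # c1 # be @ c2 # c5 # r2"
    and dp: "distinct p" and pE: "walk_edges p \<subseteq> E" and r1: "set r1 \<inter> {v, c1, c2, c3, c4, c5} = {}"
    and dis: "cycle_edges [v, c1, c2, c3, c4, c5] \<inter> walk_edges p = {}"
  shows "two_paths (cycle_edges [v, c1, c2, c3, c4, c5] \<union> walk_edges p)"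
proof -
  let ?C = "cycle_edges [v, c1, c2, c3, c4, c5]"
  have C': "?C = {{v,c1},{c1,c2},{c2,c3},{c3,c4},{c4,c5},{c5,v}}"
    by (auto simp: cycle_edges_def)
  have "al \<noteq> []"
  proof
    assume "al = []"
    then have "{v, c4} \<in> E" using pE walk_edges_mid[of v c4 r1] p by auto
    moreover have "{c4, c5} \<in> E" "{v, c5} \<in> E" using CE C' by (auto simp: insert_commute)
    ultimately show False using triangle_free[of v c4 c5] by blast
  qed
  then obtain a al' where al: "al = a # al'" by (cases al) auto
  show ?thesis
  proof (cases "c3 \<in> set r2")
    case True
    then obtain ga r3 where "r2 = ga @ c3 # r3" by (auto dest: split_list)
    then show ?thesis using hexagon_late[OF c refl _ dp r1 dis] p al by auto
  next
    case False
    have r2: "set r2 \<inter> {v, c1, c2, c3, c4, c5} = {}" using False dp p by auto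
    define q where "q = c2 # rev be @ c1 # c4 # rev al @ v # rev r1"
    have rp: "rev p = rev r2 @ c5 # q" unfolding p q_def by simp
    have rot: "cycle_edges (c5 # v # [c1, c2, c3, c4]) = ?C"
      using cycle_edges_rotate[of "[c5]" "[v, c1, c2, c3, c4]"] by simp
    have "two_paths (cycle_edges (c5 # v # [c1, c2, c3, c4]) \<union> walk_edges (rev r2 @ c5 # q)) \<or>
      (k = 3 \<and> (\<exists>s1 s2. q = s1 @ ((c5 # v # [c1, c2, c3, c4]) ! 4) # v # s2))"
    proof (rule cycle_path_first)
      show "distinct (c5 # v # [c1, c2, c3, c4])" "length (c5 # v # [c1, c2, c3, c4]) = 2 * k" using c k by auto
      show "cycle_edges (c5 # v # [c1, c2, c3, c4]) \<subseteq> E" using rot CE by simp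
      show "distinct (rev r2 @ c5 # q)" using dp rp by (metis distinct_rev)
      show "walk_edges (rev r2 @ c5 # q) \<subseteq> E" using pE rp walk_edges_rev[of p] by simp
      show "set (rev r2) \<inter> set (c5 # v # [c1, c2, c3, c4]) = {}" using r2 by auto
      show "cycle_edges (c5 # v # [c1, c2, c3, c4]) \<inter> walk_edges (rev r2 @ c5 # q) = {}"
        using dis rot rp walk_edges_rev[of p] by simp
    qed
    then consider "two_paths (?C \<union> walk_edges p)" | s1 s2 where "q = s1 @ c3 # v # s2"
      using rot rp walk_edges_rev[of p] by auto
    then show ?thesis
    proof cases
      case 2
      have "(c2 # rev be @ c1 # c4 # rev al) @ v # rev r1 = (s1 @ [c3]) @ v # s2"
        using 2 unfolding q_def by simp
      moreover have "v \<notin> set (c2 # rev be @ c1 # c4 # rev al)" using dp c unfolding p by auto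
      moreover have "v \<notin> set (s1 @ [c3])"
      proof -
        have "distinct (rev p)" using dp by simp
        then show ?thesis unfolding rp 2 by auto
      qed
      ultimately have "c2 # rev be @ c1 # c4 # rev al = s1 @ [c3] \<and> rev r1 = s2" by (rule append_Cons_eqD)
      then have "last (c2 # rev be @ c1 # c4 # rev al) = c3" by (metis last_snoc)
      then have "a = c3" using al by simp
      have "al' \<noteq> []"
      proof
        assume "al' = []"
        then have "{c3, c4} \<in> walk_edges p" using al p \<open>a = c3\<close> walk_edges_mid[of c3 c4 "r1 @ [v]"] by simp
        then show False using dis C' by auto
      qed
      then obtain b al'' where "al' = b # al''" by (cases al') auto
      then have "p = r1 @ v # c3 # b # al'' @ c4 # c1 # be @ c2 # c5 # r2" using p al \<open>a = c3\<close> by simp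
      then show ?thesis using hexagon_early[OF c refl _ dp _ dis] r1 r2 by auto
    qed
  qed
qed

text \<open>Both directions round the cycle can be tried from \<open>v\<close>. If both fail, the
  path contains the diagonals \<open>c4 c1\<close> and \<open>c2 c5\<close>, each traversed in this
  direction. They may come in either order, and the reflection of the hexagon that fixes
  \<open>v\<close> exchanges the two orders.\<close>

lemma cycle_path_two_paths_at:
  assumes c: "distinct (v # cs)" "length (v # cs) = 2 * k" "cycle_edges (v # cs) \<subseteq> E"
    and p: "distinct (r1 @ v # r2)" "walk_edges (r1 @ v # r2) \<subseteq> E"
    and r1: "set r1 \<inter> set (v # cs) = {}" and dis: "cycle_edges (v # cs) \<inter> walk_edges (r1 @ v # r2) = {}"
  shows "two_paths (cycle_edges (v # cs) \<union> walk_edges (r1 @ v # r2))"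
proof (rule ccontr)
  let ?p = "r1 @ v # r2"
  assume no: "\<not> ?thesis"
  obtain c1 ct where cs: "cs = c1 # ct" using c(2) k3 by (cases cs) auto
  obtain d1 dt where rcs: "rev cs = d1 # dt" using c(2) k3 by (cases "rev cs") auto
  have rev: "cycle_edges (v # d1 # dt) = cycle_edges (v # cs)" "set (v # d1 # dt) = set (v # cs)"
    "distinct (v # d1 # dt)" "length (v # d1 # dt) = 2 * k"
    using cycle_edges_Cons_rev[of v cs] c rcs[symmetric] by (auto simp flip: rcs)
  have A: "k = 3 \<and> (\<exists>s1 s2. r2 = s1 @ ((v # c1 # ct) ! 4) # c1 # s2)"
    using cycle_path_first[of v c1 ct r1 r2] c p r1 dis no unfolding cs by blast
  have B: "k = 3 \<and> (\<exists>s1 s2. r2 = s1 @ ((v # d1 # dt) ! 4) # d1 # s2)"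
  proof -
    have "two_paths (cycle_edges (v # d1 # dt) \<union> walk_edges ?p) \<or>
      (k = 3 \<and> (\<exists>s1 s2. r2 = s1 @ ((v # d1 # dt) ! 4) # d1 # s2))"
      by (rule cycle_path_first, unfold rev(1,2,4)) (rule rev c p r1 dis refl)+
    then show ?thesis using no rev(1) by simp
  qed
  have k: "k = 3" using A by simp
  have "length ct = 4" using c(2) cs k by simp
  then obtain c2 c3 c4 c5 where ct: "ct = [c2, c3, c4, c5]"
    by (auto simp: numeral_eq_Suc length_Suc_conv)
  have d: "d1 = c5" "dt = [c4, c3, c2, c1]" using rcs cs ct by auto
  have cyc: "v # cs = [v, c1, c2, c3, c4, c5]" using cs ct by simp
  obtain s1 s2 where s: "r2 = s1 @ c4 # c1 # s2" using A unfolding ct by auto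
  obtain t1 t2 where t: "r2 = t1 @ c2 # c5 # t2" using B unfolding d by auto
  have dc: "distinct [v, c1, c2, c3, c4, c5]" using c(1) cyc by simp
  have dr: "distinct r2" using p by simp
  have "\<exists>be w. s2 = be @ c2 # c5 # w \<or> s1 = w @ c2 # c5 # be"
  proof -
    have "c2 \<in> set r2" using t by simp
    then have "c2 \<in> set s2 \<or> c2 \<in> set s1" using s dc by auto
    then show ?thesis
    proof
      assume "c2 \<in> set s2"
      then obtain be w where b: "s2 = be @ c2 # w" by (auto dest: split_list)
      then have "(s1 @ c4 # c1 # be) @ c2 # w = t1 @ c2 # c5 # t2" using s t by simp
      moreover have "c2 \<notin> set (s1 @ c4 # c1 # be)" using dr unfolding s b by auto
      moreover have "c2 \<notin> set t1" using dr unfolding t by auto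
      ultimately have "s1 @ c4 # c1 # be = t1 \<and> w = c5 # t2" by (rule append_Cons_eqD)
      then show ?thesis using b by blast
    next
      assume "c2 \<in> set s1"
      then obtain w be where b: "s1 = w @ c2 # be" by (auto dest: split_list)
      then have "w @ c2 # be @ c4 # c1 # s2 = t1 @ c2 # c5 # t2" using s t by simp
      moreover have "c2 \<notin> set w" using dr unfolding s b by auto
      moreover have "c2 \<notin> set t1" using dr unfolding t by auto
      ultimately have "w = t1 \<and> be @ c4 # c1 # s2 = c5 # t2" by (rule append_Cons_eqD)
      then have "\<exists>be'. be = c5 # be'" using dc by (cases be) auto
      then show ?thesis using b by blast
    qed
  qed
  then obtain be w where "s2 = be @ c2 # c5 # w \<or> s1 = w @ c2 # c5 # be" by blast
  then show False
  proof
    assume "s2 = be @ c2 # c5 # w"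
    then have P: "?p = r1 @ v # s1 @ c4 # c1 # be @ c2 # c5 # w" using s by simp
    have "two_paths (cycle_edges [v, c1, c2, c3, c4, c5] \<union> walk_edges ?p)"
      by (rule hexagon_path[OF k dc _ P p]) (use c(3) r1 dis cyc in auto)
    then show False using no cyc by simp
  next
    assume "s1 = w @ c2 # c5 # be"
    then have P: "?p = r1 @ v # w @ c2 # c5 # be @ c4 # c1 # s2" using s by simp
    have rc: "cycle_edges [v, c5, c4, c3, c2, c1] = cycle_edges (v # cs)" using rev(1) d by simp
    have "two_paths (cycle_edges [v, c5, c4, c3, c2, c1] \<union> walk_edges ?p)"
      by (rule hexagon_path[OF k _ _ P p]) (use c(3) r1 dis cyc dc rc in auto)
    then show False using no rc by simp
  qed
qed

lemma cycle_path_two_paths: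
  assumes C: "cycle_set (2 * k) C" "C \<subseteq> E" and P: "path_set P" "P \<subseteq> E" and dis: "C \<inter> P = {}"
    and meet: "\<Union>C \<inter> \<Union>P \<noteq> {}"
  shows "two_paths (C \<union> P)"
proof -
  obtain c where c: "length c = 2 * k" "distinct c" "cycle_edges c = C" using C by (auto simp: cycle_set_def)
  obtain p where p: "length p \<ge> 2" "distinct p" "walk_edges p = P" using P by (auto simp: path_set_def)
  have "c \<noteq> []" using c k3 by auto
  have "\<exists>x\<in>set p. x \<in> set c"
    using meet c(3) p(3) cycle_edges_subset[OF \<open>c \<noteq> []\<close>] walk_edges_subset by fast
  then obtain r1 v r2 where r: "p = r1 @ v # r2" "v \<in> set c" "\<forall>y\<in>set r1. y \<notin> set c"
    using split_list_first_prop[of p "\<lambda>x. x \<in> set c"] by blast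
  obtain d1 d2 where d: "c = d1 @ v # d2" using r(2) by (auto dest: split_list)
  have eq: "cycle_edges (v # d2 @ d1) = C" using cycle_edges_rotate[of d1 "v # d2"] c(3) d by simp
  have "two_paths (cycle_edges (v # d2 @ d1) \<union> walk_edges (r1 @ v # r2))"
    by (rule cycle_path_two_paths_at) (use c p r d eq C P dis in auto)
  then show ?thesis using eq r p by simp
qed

text \<open>If both neighbours of \<open>v\<close> on one cycle were on the other, both would be
  ends of chords of the other cycle at \<open>v\<close>. By \<open>cycle_chord\<close> both would
  then be the vertex opposite to \<open>v\<close>, hence equal.\<close>

lemma cycle_free_neighbour:
  assumes c: "distinct (v # cs)" "length (v # cs) = 2 * k" "cycle_edges (v # cs) \<subseteq> E"
    and d: "distinct (v # ds)" "length (v # ds) = 2 * k" "cycle_edges (v # ds) \<subseteq> E"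
    and dis: "cycle_edges (v # cs) \<inter> cycle_edges (v # ds) = {}"
  obtains x xs where "distinct (v # x # xs)" "length (v # x # xs) = 2 * k" "set (v # x # xs) = set (v # cs)"
    "cycle_edges (v # x # xs) = cycle_edges (v # cs)" "x \<notin> set (v # ds)"
proof -
  obtain c1 ct where cs: "cs = c1 # ct" using c(2) k3 by (cases cs) auto
  obtain d1 dt where rcs: "rev cs = d1 # dt" using c(2) k3 by (cases "rev cs") auto
  have rev: "cycle_edges (v # d1 # dt) = cycle_edges (v # cs)" "set (v # d1 # dt) = set (v # cs)"
    "distinct (v # d1 # dt)" "length (v # d1 # dt) = 2 * k"
    using cycle_edges_Cons_rev[of v cs] c rcs[symmetric] by (auto simp flip: rcs)
  have "c1 \<notin> set (v # ds) \<or> d1 \<notin> set (v # ds)"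
  proof (rule ccontr)
    assume "\<not> ?thesis"
    then have in12: "c1 \<in> set (v # ds)" "d1 \<in> set (v # ds)" by auto
    have "{v, c1} \<in> cycle_edges (v # cs)" using cs by (simp add: cycle_edges_def)
    moreover have "{v, d1} \<in> cycle_edges (v # cs)" unfolding rev(1)[symmetric] by (simp add: cycle_edges_def)
    ultimately have "c1 = (v # ds) ! 3" "d1 = (v # ds) ! 3"
      using cycle_chord[OF d in12(1)] cycle_chord[OF d in12(2)] c(3) dis by auto
    then have "c1 = d1" by simp
    moreover have "d1 = last cs" using rcs by (metis list.sel(1) last_rev rev_rev_ident list.distinct(1))
    ultimately show False using c(1,2) cs k3 last_in_set[of ct] by (cases ct) auto
  qed
  then show thesis using that[of c1 ct] that[of d1 dt] c cs rev by auto
qed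

text \<open>Both cycles are opened at \<open>v\<close>, the first at an edge to a vertex off the
  second and conversely, and the two removed edges are exchanged: each opened cycle is prolonged at
  \<open>v\<close> by the edge taken from the other.\<close>

lemma cycle_cycle_two_paths:
  assumes C: "cycle_set (2 * k) C" "C \<subseteq> E" and D: "cycle_set (2 * k) D" "D \<subseteq> E" and dis: "C \<inter> D = {}"
    and meet: "\<Union>C \<inter> \<Union>D \<noteq> {}"
  shows "two_paths (C \<union> D)"
proof -
  obtain c where c: "length c = 2 * k" "distinct c" "cycle_edges c = C" using C by (auto simp: cycle_set_def)
  obtain d where d: "length d = 2 * k" "distinct d" "cycle_edges d = D" using D by (auto simp: cycle_set_def)
  have "c \<noteq> []" "d \<noteq> []" using c d k3 by auto
  then obtain v where v: "v \<in> set c" "v \<in> set d"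
    using meet c(3) d(3) cycle_edges_subset by fast
  obtain c1 c2 where cc: "c = c1 @ v # c2" using v by (auto dest: split_list)
  obtain d1 d2 where dd: "d = d1 @ v # d2" using v by (auto dest: split_list)
  have ce: "cycle_edges (v # c2 @ c1) = C" using cycle_edges_rotate[of c1 "v # c2"] c(3) cc by simp
  have de: "cycle_edges (v # d2 @ d1) = D" using cycle_edges_rotate[of d1 "v # d2"] d(3) dd by simp
  have c': "distinct (v # c2 @ c1)" "length (v # c2 @ c1) = 2 * k" "cycle_edges (v # c2 @ c1) \<subseteq> E"
    using c cc ce C by auto
  have d': "distinct (v # d2 @ d1)" "length (v # d2 @ d1) = 2 * k" "cycle_edges (v # d2 @ d1) \<subseteq> E"
    using d dd de D by auto
  obtain x xs where x: "distinct (v # x # xs)" "length (v # x # xs) = 2 * k" "set (v # x # xs) = set (v # c2 @ c1)"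
    "cycle_edges (v # x # xs) = C" "x \<notin> set (v # d2 @ d1)"
    using cycle_free_neighbour[OF c' d'] dis ce de by auto
  obtain y ys where y: "distinct (v # y # ys)" "length (v # y # ys) = 2 * k" "set (v # y # ys) = set (v # d2 @ d1)"
    "cycle_edges (v # y # ys) = D" "y \<notin> set (v # c2 @ c1)"
    using cycle_free_neighbour[OF d' c'] dis ce de by auto
  have rw: "cycle_edges (v # z # zs) = insert {v, z} (walk_edges (v # rev (z # zs)))" for z and zs :: "'a list"
    using cycle_edges_Cons_rev[of v "z # zs"] by (simp add: cycle_edges_def insert_commute)
  show ?thesis
  proof (rule two_pathsI)
    show "distinct (y # v # rev (x # xs))" using x y by auto
    show "distinct (x # v # rev (y # ys))" using x y by auto
    show "walk_edges (y # v # rev (x # xs)) \<union> walk_edges (x # v # rev (y # ys)) = C \<union> D"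
      unfolding x(4)[symmetric] y(4)[symmetric] rw by (auto simp: insert_commute)
    have "card C = 2 * k" "card D = 2 * k"
      using card_cycle_edges[OF x(1)] card_cycle_edges[OF y(1)] x(2,4) y(2,4) k3 by auto
    then have "card (C \<union> D) = 4 * k"
      using card_Un_disjoint[of C D] dis x(4) y(4) by auto
    then show "card (C \<union> D) + 2 = length (y # v # rev (x # xs)) + length (x # v # rev (y # ys))"
      using x y by simp
  qed auto
qed

end

text \<open>The pairs of \<open>f\<close> and the pairs of \<open>g\<close> are two perfect
  matchings, whose union consists of even cycles. The induction avoids these cycles: it deletes one
  pair of \<open>f\<close> and makes the partners of its elements under \<open>g\<close> a new
  pair.\<close>

lemma two_colouring:
  assumes "finite X" "\<And>v. v \<in> X \<Longrightarrow> f v \<in> X \<and> f v \<noteq> v \<and> f (f v) = v"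
    and "\<And>v. v \<in> X \<Longrightarrow> g v \<in> X \<and> g v \<noteq> v \<and> g (g v) = v"
  shows "\<exists>L\<subseteq>X. \<forall>v\<in>X. (f v \<in> L \<longleftrightarrow> v \<notin> L) \<and> (g v \<in> L \<longleftrightarrow> v \<notin> L)"
  using assms
proof (induction "card X" arbitrary: X g rule: less_induct)
  case less
  note f = less.prems(2) and g = less.prems(3)
  show ?case
  proof (cases "X = {}")
    case False
    then obtain v where v: "v \<in> X" by auto
    let ?w = "f v"
    let ?X = "X - {v, ?w}"
    have w: "?w \<in> X" "?w \<noteq> v" "f ?w = v" using f[OF v] by auto
    have card: "card ?X < card X" using v less.prems(1) by (intro psubset_card_mono) auto
    have fX: "f u \<in> ?X \<and> f u \<noteq> u \<and> f (f u) = u" if "u \<in> ?X" for u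
      using f[of u] that w by auto
    have fv: "f v \<noteq> v" using w by simp
    show ?thesis
    proof (cases "g v = ?w")
      case True
      then have gw: "g ?w = v" using g[OF v] by metis
      have gX: "g u \<in> ?X \<and> g u \<noteq> u \<and> g (g u) = u" if "u \<in> ?X" for u
        using g[of u] that True gw by auto
      obtain L where L: "L \<subseteq> ?X" "\<forall>u\<in>?X. (f u \<in> L \<longleftrightarrow> u \<notin> L) \<and> (g u \<in> L \<longleftrightarrow> u \<notin> L)"
        using less.hyps[OF card _ fX gX] less.prems(1) by auto
      show ?thesis
      proof (intro exI conjI ballI)
        show "insert v L \<subseteq> X" using L v by auto
        fix u assume u: "u \<in> X"
        show "(f u \<in> insert v L) = (u \<notin> insert v L)" "(g u \<in> insert v L) = (u \<notin> insert v L)"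
          using L u fX[of u] gX[of u] w True gw by (cases "u = v"; cases "u = ?w"; auto)+
      qed
    next
      case False
      let ?p = "g v" and ?q = "g ?w"
      have p: "?p \<in> ?X" "g ?p = v" using g[OF v] False by auto
      have gw: "?q \<noteq> v" using g[OF w(1)] False by metis
      have q: "?q \<in> ?X" "g ?q = ?w" using g[OF w(1)] gw by auto
      have pq: "?p \<noteq> ?q" using p q w by metis
      \<comment> \<open>As \<open>?p\<close> and \<open>?q\<close> become partners, the colouring of
        the smaller set separates them, and the colours that they force upon \<open>v\<close> and
        \<open>?w\<close> differ as well.\<close>
      define g' where "g' = g(?p := ?q, ?q := ?p)"
      have other: "g u \<in> ?X - {?p, ?q}" if "u \<in> ?X - {?p, ?q}" for u
      proof -
        have "g u \<in> X" "g (g u) = u" using g[of u] that by auto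
        then show ?thesis using that p q by auto
      qed
      have gX: "g' u \<in> ?X \<and> g' u \<noteq> u \<and> g' (g' u) = u" if "u \<in> ?X" for u
      proof (cases "u = ?p \<or> u = ?q")
        case True
        then show ?thesis using p q pq by (auto simp: g'_def)
      next
        case False
        then show ?thesis using other[of u] g[of u] that by (auto simp: g'_def)
      qed
      obtain L where L: "L \<subseteq> ?X" "\<forall>u\<in>?X. (f u \<in> L \<longleftrightarrow> u \<notin> L) \<and> (g' u \<in> L \<longleftrightarrow> u \<notin> L)"
        using less.hyps[OF card _ fX gX] less.prems(1) by auto
      have Lp: "?q \<in> L \<longleftrightarrow> ?p \<notin> L" using L(2) p by (auto simp: g'_def split: if_splits)
      define M where "M = (if ?p \<in> L then insert ?w L else insert v L)"
      have vL: "v \<notin> L" "?w \<notin> L" using L(1) by auto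
      show ?thesis
      proof (intro exI conjI ballI)
        show "M \<subseteq> X" using L v w by (auto simp: M_def)
        fix u assume u: "u \<in> X"
        have Mu: "x \<in> M \<longleftrightarrow> x \<in> L" if "x \<noteq> v" "x \<noteq> ?w" for x using that by (auto simp: M_def)
        have Mv: "v \<in> M \<longleftrightarrow> ?p \<notin> L" "?w \<in> M \<longleftrightarrow> ?p \<in> L" using vL fv by (auto simp: M_def)
        consider "u = v" | "u = ?w" | "u \<in> ?X" using u by auto
        then show "(f u \<in> M) = (u \<notin> M)"
          using Mv Mu fX[of u] L(2) w by cases auto
        consider "u = v" | "u = ?w" | "u = ?p" | "u = ?q" | "u \<in> ?X - {?p, ?q}" using u by auto
        then show "(g u \<in> M) = (u \<notin> M)"
        proof cases
          case 5
          then have "g u \<in> ?X" "g' u = g u" using other[of u] by (auto simp: g'_def)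
          moreover have "g' u \<in> L \<longleftrightarrow> u \<notin> L" using L(2) 5 by blast
          ultimately show ?thesis using Mu[of "g u"] Mu[of u] 5 by auto
        qed (use Mv Mu[of ?p] Mu[of ?q] p q Lp in auto)
      qed
    qed
  qed auto
qed

section \<open>Decompositions into paths and long cycles\<close>

context girth_graph
begin

definition piece :: "'a set set \<Rightarrow> bool" where
  "piece B \<longleftrightarrow> path_set B \<or> cycle_set (2 * k) B"

definition decomp :: "'a set set \<Rightarrow> nat \<Rightarrow> bool" where
  "decomp A m \<longleftrightarrow> (\<exists>F. finite F \<and> card F = m \<and> pairwise disjnt F \<and> \<Union>F = A \<and> (\<forall>B\<in>F. piece B))"

text \<open>This serves the count: a disjoint piece enlarges the family in \<open>decomp\<close>
  only because it is nonempty and so cannot already belong to it.\<close>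

lemma piece_nonempty: assumes "piece B" shows "B \<noteq> {}"
proof (cases "path_set B")
  case False
  then obtain c where "length c = 2 * k" "distinct c" "cycle_edges c = B"
    using assms by (auto simp: piece_def cycle_set_def)
  then show ?thesis by (auto simp: cycle_edges_def)
qed (use path_set_nonempty in auto)

lemma piece_path: "distinct p \<Longrightarrow> length p \<ge> 2 \<Longrightarrow> piece (walk_edges p)"
  by (auto simp: piece_def path_set_def)

lemma decomp_empty: "decomp {} 0"
  unfolding decomp_def by (rule exI[of _ "{}"]) auto

lemma decomp_insert:
  assumes "decomp A m" "piece B" "B \<inter> A = {}"
  shows "decomp (B \<union> A) (Suc m)"
proof -
  obtain F where F: "finite F" "card F = m" "pairwise disjnt F" "\<Union>F = A" "\<forall>B\<in>F. piece B"
    using assms(1) by (auto simp: decomp_def)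
  have "B \<notin> F" using assms(3) F(4) piece_nonempty[OF assms(2)] by auto
  moreover have "disjnt B C" "disjnt C B" if "C \<in> F" for C using assms(3) F(4) that by (auto simp: disjnt_def)
  ultimately show ?thesis unfolding decomp_def using F assms(2)
    by (intro exI[of _ "insert B F"]) (auto simp: pairwise_insert)
qed

lemma decomp_family:
  assumes "finite I" "\<And>i. i \<in> I \<Longrightarrow> piece (B i)"
    "\<And>i j. i \<in> I \<Longrightarrow> j \<in> I \<Longrightarrow> i \<noteq> j \<Longrightarrow> B i \<inter> B j = {}"
  shows "decomp (\<Union>i\<in>I. B i) (card I)"
  using assms
proof (induction I rule: finite_induct)
  case (insert i I)
  have "decomp (B i \<union> (\<Union>i\<in>I. B i)) (Suc (card I))"
  proof (rule decomp_insert)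
    show "decomp (\<Union> (B ` I)) (card I)" by (rule insert.IH) (use insert.prems in auto)
    show "piece (B i)" using insert.prems by auto
    have "B i \<inter> B j = {}" if "j \<in> I" for j by (rule insert.prems(2)) (use that insert.hyps in auto)
    then show "B i \<inter> \<Union> (B ` I) = {}" by auto
  qed
  then show ?case using insert.hyps by simp
qed (simp add: decomp_empty)

lemma cycle_vertex_degree:
  assumes "distinct c" "length c \<ge> 2" "v \<in> set c"
  shows "card {e \<in> cycle_edges c. v \<in> e} \<le> 2"
proof -
  obtain d1 d2 where d: "c = d1 @ v # d2" using assms(3) by (auto dest: split_list)
  define cs where "cs = d2 @ d1"
  have eq: "cycle_edges c = cycle_edges (v # cs)" using cycle_edges_rotate[of d1 "v # d2"] d cs_def by simp
  have "cs \<noteq> []" using assms(2) d cs_def by auto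
  then obtain x xs where x: "cs = x # xs" by (meson list.exhaust)
  have "v \<notin> set cs" using assms(1) d cs_def by auto
  then have "{e \<in> cycle_edges c. v \<in> e} \<subseteq> {{last cs, v}, {v, x}}"
    unfolding eq using walk_edges_subset[of _ cs] x by (auto simp: cycle_edges_def)
  then have "card {e \<in> cycle_edges c. v \<in> e} \<le> card {{last cs, v}, {v, x}}" by (rule card_mono[rotated]) simp
  also have "\<dots> \<le> 2" by (simp add: card_insert_if)
  finally show ?thesis .
qed

text \<open>A cycle uses at most two edges at each of its vertices, so degree 3 provides an edge of
  another piece there. Replacing the cycle and that piece by two paths keeps the number of pieces
  and lowers the number of those that are not paths.\<close>

lemma all_paths:
  assumes deg: "\<And>v. v \<in> V \<Longrightarrow> degree E v \<ge> 3"
    and "finite F" "card F = m" "pairwise disjnt F" "\<Union>F = E" "\<forall>B\<in>F. piece B"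
  shows "\<exists>F. finite F \<and> card F = m \<and> pairwise disjnt F \<and> \<Union>F = E \<and> (\<forall>B\<in>F. path_set B)"
  using assms(2-)
proof (induction "card {B \<in> F. \<not> path_set B}" arbitrary: F rule: less_induct)
  case less
  note F = less.prems
  show ?case
  proof (cases "\<forall>B\<in>F. path_set B")
    case False
    then obtain C where C: "C \<in> F" "\<not> path_set C" by auto
    then have cs: "cycle_set (2 * k) C" using F(5) by (auto simp: piece_def)
    then obtain c where c: "length c = 2 * k" "distinct c" "cycle_edges c = C" by (auto simp: cycle_set_def)
    have CE: "C \<subseteq> E" using C F(4) by auto
    have "c \<noteq> []" using c k3 by auto
    then have v: "hd c \<in> set c" by simp
    have hc: "{last c, hd c} \<in> C" using c(3) by (auto simp: cycle_edges_def)
    then have "hd c \<in> V" using CE edge_subset by blast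
    then have "card {e \<in> E. hd c \<in> e} \<ge> 3" using deg by (simp add: degree_def)
    moreover have "card {e \<in> C. hd c \<in> e} \<le> 2" using cycle_vertex_degree[OF c(2) _ v] c k3 by auto
    ultimately have "\<not> {e \<in> E. hd c \<in> e} \<subseteq> {e \<in> C. hd c \<in> e}"
      using card_mono[of "{e \<in> C. hd c \<in> e}" "{e \<in> E. hd c \<in> e}"] finite_subset[OF CE finite_E] by auto
    then obtain e where e: "e \<in> E" "hd c \<in> e" "e \<notin> C" by auto
    then obtain B where B: "B \<in> F" "e \<in> B" using F(4) by auto
    have BC: "B \<noteq> C" using e B by auto
    then have dis: "C \<inter> B = {}" using F(3) B C by (auto simp: pairwise_def disjnt_def)
    have BE: "B \<subseteq> E" using B F(4) by auto
    have meet: "\<Union>C \<inter> \<Union>B \<noteq> {}" using hc e B by auto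
    have "two_paths (C \<union> B)"
    proof (cases "path_set B")
      case True
      then show ?thesis using cycle_path_two_paths[OF cs CE _ BE dis meet] by simp
    next
      case False
      then have "cycle_set (2 * k) B" using F(5) B by (auto simp: piece_def)
      then show ?thesis using cycle_cycle_two_paths[OF cs CE _ BE dis meet] by simp
    qed
    then obtain Q R where QR: "path_set Q" "path_set R" "Q \<inter> R = {}" "Q \<union> R = C \<union> B"
      by (auto simp: two_paths_def)
    let ?G = "F - {C, B}"
    let ?F = "insert Q (insert R ?G)"
    have out: "disjnt Q D" "disjnt R D" "disjnt D Q" "disjnt D R" if "D \<in> ?G" for D
    proof -
      have "x \<inter> y = {}" if "x \<in> F" "y \<in> F" "x \<noteq> y" for x y
        using F(3) that unfolding pairwise_def disjnt_def by blast
      then have "D \<inter> C = {}" "D \<inter> B = {}" using that B(1) C(1) by auto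
      then show "disjnt Q D" "disjnt R D" "disjnt D Q" "disjnt D R" using QR(4) by (auto simp: disjnt_def)
    qed
    have ne: "Q \<noteq> {}" "R \<noteq> {}" using QR path_set_nonempty by auto
    have notin: "Q \<notin> ?G" "R \<notin> ?G" "Q \<noteq> R" using out[of Q] out[of R] ne QR(3) by (auto simp: disjnt_def)
    have "card ?G + 2 = card F"
    proof -
      have "card F \<ge> card {C, B}" by (rule card_mono) (use F B C in auto)
      then show ?thesis using card_Diff_subset[of "{C, B}" F] B C BC by simp
    qed
    then have cardF: "card ?F = m" using F(1,2) notin by simp
    have "{D \<in> ?F. \<not> path_set D} \<subset> {D \<in> F. \<not> path_set D}" using QR C by auto
    then have less_card: "card {D \<in> ?F. \<not> path_set D} < card {D \<in> F. \<not> path_set D}"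
      by (rule psubset_card_mono[rotated]) (use F in auto)
    have pw: "pairwise disjnt ?G" using F(3) by (rule pairwise_subset) auto
    show ?thesis
    proof (rule less.hyps[OF less_card])
      show "pairwise disjnt ?F" using pw out QR(3) by (auto simp: pairwise_insert disjnt_def)
      show "\<Union>?F = E" using F(4) QR(4) B C by auto
      show "\<forall>B\<in>?F. piece B" using F(5) QR by (auto simp: piece_def)
    qed (use F cardF in auto)
  qed (use F in blast)
qed

lemma decomp_path_decomposition:
  assumes "\<And>v. v \<in> V \<Longrightarrow> degree E v \<ge> 3" "decomp E m"
  shows "\<exists>ps. path_decomposition V E ps \<and> length ps = m"
proof -
  obtain F where F: "finite F" "card F = m" "pairwise disjnt F" "\<Union>F = E" "\<forall>B\<in>F. path_set B"
    using all_paths[OF assms(1)] assms(2) unfolding decomp_def by metis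
  obtain Fs where Fs: "set Fs = F" "distinct Fs" using finite_distinct_list[OF F(1)] by auto
  obtain f where f: "\<And>B. B \<in> F \<Longrightarrow> length (f B) \<ge> 2 \<and> distinct (f B) \<and> walk_edges (f B) = B"
    using F(5) unfolding path_set_def by metis
  have ps: "is_path V E (f B)" if "B \<in> F" for B
    using f[OF that] F(4) that set_subset_V[of "f B"] by (auto simp: is_path_def)
  have "path_decomposition V E (map f Fs)"
    unfolding path_decomposition_def
  proof (intro conjI ballI allI impI)
    show "is_path V E p" if "p \<in> set (map f Fs)" for p using that ps Fs by auto
    show "walk_edges (map f Fs ! i) \<inter> walk_edges (map f Fs ! j) = {}"
      if "i < length (map f Fs)" "j < length (map f Fs)" "i \<noteq> j" for i j
    proof -
      have "Fs ! i \<in> F" "Fs ! j \<in> F" "Fs ! i \<noteq> Fs ! j"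
        using that Fs nth_eq_iff_index_eq[OF Fs(2)] by auto
      then show ?thesis using f F(3) that by (auto simp: pairwise_def disjnt_def)
    qed
    show "(\<Union>p\<in>set (map f Fs). walk_edges p) = E" using f Fs F(4) by auto
  qed
  moreover have "length (map f Fs) = m" using Fs F(2) distinct_card[OF Fs(2)] by simp
  ultimately show ?thesis by blast
qed

end

section \<open>Attaching the second matching\<close>

text \<open>A rotation in the sense of Posa: the edge from the last vertex \<open>a\<close> to the
  inner vertex \<open>b\<close> replaces \<open>{b, z}\<close>, and \<open>z\<close> becomes the
  last vertex. \<open>W\<close> is the part common to both edge sets.\<close>

lemma rotate_path:
  assumes "distinct (u @ b # z # w)"
  defines "W \<equiv> walk_edges (u @ [b]) \<union> walk_edges (z # w)" and "a \<equiv> last (z # w)"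
  shows "walk_edges (u @ b # z # w) = insert {b, z} W" "walk_edges (u @ b # rev (z # w)) = insert {a, b} W"
    "{b, z} \<notin> W" "distinct (u @ b # rev (z # w))" "last (u @ b # rev (z # w)) = z"
    "set (u @ b # rev (z # w)) = set (u @ b # z # w)" "u \<noteq> [] \<Longrightarrow> hd (u @ b # rev (z # w)) = hd (u @ b # z # w)"
proof -
  show "walk_edges (u @ b # z # w) = insert {b, z} W"
    unfolding W_def by (simp only: walk_edges_app_split) auto
  have "walk_edges (b # rev (z # w)) = insert {b, a} (walk_edges (rev (z # w)))"
    using walk_edges_append[of "[b]" "rev (z # w)"] unfolding a_def by (simp add: hd_append hd_rev)
  then have "walk_edges (b # rev (z # w)) = insert {a, b} (walk_edges (z # w))"
    using walk_edges_rev[of "z # w"] by (simp only: insert_commute)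
  then show "walk_edges (u @ b # rev (z # w)) = insert {a, b} W"
    unfolding W_def walk_edges_split[of u b "rev (z # w)"] by auto
  show "{b, z} \<notin> W"
    using assms(1) walk_edges_subset[of "{b, z}" "u @ [b]"] walk_edges_subset[of "{b, z}" "z # w"]
    by (auto simp: W_def)
qed (use assms(1) in \<open>auto simp: hd_append\<close>)

context girth_graph
begin

text \<open>Every path is stored twice, once from each of its ends: the entry of $v$ is the path that starts at $v$.
  So $X$ is the set of all ends, and there are half as many paths as elements of $X$.\<close>

definition slots :: "'a set \<Rightarrow> ('a \<Rightarrow> 'a list) \<Rightarrow> bool" where
  "slots X P \<longleftrightarrow> finite X \<and>
    (\<forall>v\<in>X. distinct (P v) \<and> length (P v) = 2 * k \<and> hd (P v) = v \<and> last (P v) \<in> X \<and>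
      P (last (P v)) = rev (P v) \<and> walk_edges (P v) \<subseteq> E) \<and>
    (\<forall>u\<in>X. \<forall>v\<in>X. u \<noteq> v \<longrightarrow> u \<noteq> last (P v) \<longrightarrow> walk_edges (P u) \<inter> walk_edges (P v) = {})"

text \<open>The matching edges are coded by an involution without fixed points. \<open>Y\<close> is
  kept apart from the set \<open>X\<close> of all ends because a chain that has been cut open has
  two ends without a link.\<close>

definition links :: "'a set \<Rightarrow> ('a \<Rightarrow> 'a) \<Rightarrow> ('a \<Rightarrow> 'a list) \<Rightarrow> 'a set \<Rightarrow> bool" where
  "links Y \<mu> P X \<longleftrightarrow> (\<forall>v\<in>Y. \<mu> v \<in> Y \<and> \<mu> v \<noteq> v \<and> \<mu> (\<mu> v) = v \<and> {v, \<mu> v} \<in> E \<and>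
    (\<forall>u\<in>X. {v, \<mu> v} \<notin> walk_edges (P u)))"

definition link_edges :: "'a set \<Rightarrow> ('a \<Rightarrow> 'a) \<Rightarrow> 'a set set" where
  "link_edges Y \<mu> = (\<lambda>v. {v, \<mu> v}) ` Y"

definition path_edges :: "'a set \<Rightarrow> ('a \<Rightarrow> 'a list) \<Rightarrow> 'a set set" where
  "path_edges X P = (\<Union>v\<in>X. walk_edges (P v))"

lemma slotsD:
  assumes "slots X P" "v \<in> X"
  shows "distinct (P v)" "length (P v) = 2 * k" "hd (P v) = v" "last (P v) \<in> X" "P (last (P v)) = rev (P v)"
    "walk_edges (P v) \<subseteq> E" "P v \<noteq> []" "last (P (last (P v))) = v" "last (P v) \<noteq> v" "v \<in> set (P v)"
proof -
  show *: "distinct (P v)" "length (P v) = 2 * k" "hd (P v) = v" "last (P v) \<in> X" "P (last (P v)) = rev (P v)"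
    "walk_edges (P v) \<subseteq> E" using assms by (auto simp: slots_def)
  show ne: "P v \<noteq> []" using *(2) k3 by auto
  then show "last (P (last (P v))) = v" using * by (auto simp: last_rev)
  show "v \<in> set (P v)" using hd_in_set[OF ne] *(3) by simp
  obtain x xs where x: "P v = x # xs" using ne by (cases "P v") auto
  then have "xs \<noteq> []" using *(2) k3 by auto
  then have "last (P v) \<in> set xs" using x by simp
  then show "last (P v) \<noteq> v" using x *(1,3) by auto
qed

lemma slots_disjoint:
  "slots X P \<Longrightarrow> u \<in> X \<Longrightarrow> v \<in> X \<Longrightarrow> u \<noteq> v \<Longrightarrow> u \<noteq> last (P v) \<Longrightarrow> walk_edges (P u) \<inter> walk_edges (P v) = {}"
  by (simp add: slots_def)

lemma slots_remove:
  assumes S: "slots X P" and l: "l \<in> X"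
  defines "X' \<equiv> X - {l, last (P l)}"
  shows "slots X' P" "path_edges X P = walk_edges (P l) \<union> path_edges X' P"
    "walk_edges (P l) \<inter> path_edges X' P = {}" "card X = card X' + 2"
proof -
  note L = slotsD[OF S l]
  have "last (P v) \<in> X'" if "v \<in> X'" for v
    using slotsD[OF S, of v] that L(8) unfolding X'_def by (metis DiffD1 DiffD2 DiffI insert_iff empty_iff)
  then show "slots X' P" using S unfolding slots_def X'_def by auto
  have "walk_edges (P (last (P l))) = walk_edges (P l)" using L(5) by simp
  then show "path_edges X P = walk_edges (P l) \<union> path_edges X' P"
    using l L(4) by (auto simp: path_edges_def X'_def)
  show "walk_edges (P l) \<inter> path_edges X' P = {}"
  proof -
    have "walk_edges (P l) \<inter> walk_edges (P v) = {}" if "v \<in> X'" for v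
      using slots_disjoint[OF S, of v l] that l unfolding X'_def by auto
    then show ?thesis by (auto simp: path_edges_def)
  qed
  have fin: "finite X" using S by (simp add: slots_def)
  have "card X' = card X - card {l, last (P l)}" unfolding X'_def
    by (rule card_Diff_subset) (use l L in auto)
  moreover have "card {l, last (P l)} \<le> card X" by (rule card_mono) (use fin l L in auto)
  ultimately show "card X = card X' + 2" using L(9) by (simp add: card_insert_if split: if_splits)
qed

lemma links_mono: "links Y \<mu> P X \<Longrightarrow> X' \<subseteq> X \<Longrightarrow> links Y \<mu> P X'"
  by (auto simp: links_def)

lemma links_remove:
  assumes "links Y \<mu> P X" "v \<in> Y"
  shows "links (Y - {v, \<mu> v}) \<mu> P X" "link_edges Y \<mu> = insert {v, \<mu> v} (link_edges (Y - {v, \<mu> v}) \<mu>)"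
    "{v, \<mu> v} \<notin> link_edges (Y - {v, \<mu> v}) \<mu>"
proof -
  have L: "\<mu> v \<in> Y" "\<mu> v \<noteq> v" "\<mu> (\<mu> v) = v" using assms by (auto simp: links_def)
  have "\<mu> u \<in> Y - {v, \<mu> v}" if "u \<in> Y - {v, \<mu> v}" for u
  proof -
    have "\<mu> u \<in> Y" "\<mu> (\<mu> u) = u" using assms that by (auto simp: links_def)
    then show ?thesis using that L by auto
  qed
  then show "links (Y - {v, \<mu> v}) \<mu> P X" using assms by (auto simp: links_def)
  show "link_edges Y \<mu> = insert {v, \<mu> v} (link_edges (Y - {v, \<mu> v}) \<mu>)"
  proof -
    have Y: "Y = insert v (insert (\<mu> v) (Y - {v, \<mu> v}))" using assms(2) L(1) by blast
    have "link_edges (insert v (insert (\<mu> v) Z)) \<mu> = insert {v, \<mu> v} (link_edges Z \<mu>)" for Z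
      using L(3) by (simp add: link_edges_def insert_commute)
    then show ?thesis by (rule trans[OF arg_cong[OF Y, of "\<lambda>A. link_edges A \<mu>"]])
  qed
  show "{v, \<mu> v} \<notin> link_edges (Y - {v, \<mu> v}) \<mu>"
    by (auto simp: link_edges_def doubleton_eq_iff)
qed

lemma links_disjoint: "links Y \<mu> P X \<Longrightarrow> Y' \<subseteq> Y \<Longrightarrow> u \<in> X \<Longrightarrow> walk_edges (P u) \<inter> link_edges Y' \<mu> = {}"
  by (auto simp: links_def link_edges_def)

text \<open>This is where the bound on the girth is used against the exact length of the paths.\<close>

lemma two_chords_from_end:
  assumes q: "distinct q" "length q = 2 * k" "walk_edges q \<subseteq> E" and b: "hd q = b"
    and c: "c \<in> set q" "{b, c} \<in> E" "{b, c} \<notin> walk_edges q"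
    and d: "d \<in> set q" "{b, d} \<in> E" "{b, d} \<notin> walk_edges q" and cd: "c \<noteq> d"
  shows "c = last q \<or> d = last q"
proof -
  have q0: "q \<noteq> []" "q ! 0 = b" using q(2) b k3 by (cases q; auto)+
  \<comment> \<open>The girth rules out chords from the first vertex to the early positions; only
    the indices 2k - 3, 2k - 2 and 2k - 1 remain.\<close>
  have far: "\<exists>i. i < length q \<and> q ! i = x \<and> i + 3 \<ge> 2 * k \<and> i \<noteq> 0"
    if x: "x \<in> set q" "{b, x} \<in> E" "{b, x} \<notin> walk_edges q" for x
  proof -
    obtain i where i: "i < length q" "q ! i = x" using x(1) by (auto simp: in_set_conv_nth)
    have "i \<noteq> 0" using edge_neq[OF x(2)] i q0 by metis
    have "i \<noteq> 1"
    proof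
      assume "i = 1"
      then have "{b, x} \<in> walk_edges q" using i q0 unfolding walk_edges_def by auto
      then show False using x by simp
    qed
    then have "i + 1 \<ge> 2 * k - 2" using chord_distance[of 0 i q] \<open>i \<noteq> 0\<close> i q0 q x by simp
    then show ?thesis using i \<open>i \<noteq> 0\<close> by auto
  qed
  obtain i where i: "i < length q" "q ! i = c" "i + 3 \<ge> 2 * k" "i \<noteq> 0" using far[OF c] by blast
  obtain j where j: "j < length q" "q ! j = d" "j + 3 \<ge> 2 * k" "j \<noteq> 0" using far[OF d] by blast
  have b_notin: "b \<notin> set (drop n q)" if "n \<noteq> 0" for n
    using q(1) q0 that by (cases q; cases n) (auto dest: in_set_dropD)
  have last: "q ! n = last q" if "n < length q" "n + 1 \<ge> length q" for n
  proof -
    have "n = length q - 1" using that by simp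
    then show ?thesis using last_conv_nth[OF q0(1)] by simp
  qed
  show ?thesis
  proof (cases "i < j")
    case True
    then have "j - i + 2 \<ge> 2 * k - 2"
      using common_neighbour_distance[of i j q b] i j q c d b_notin[of i] by simp
    \<comment> \<open>j \<ge> i + 2k - 4 \<ge> 4k - 7, and 4k - 7 \<ge> 2k - 1 holds because k \<ge>
      3.\<close>
    then have "j + 1 \<ge> length q" using i q k3 True by linarith
    then show ?thesis using last[of j] j by simp
  next
    case False
    then have "j < i" using i j cd by (metis nat_neq_iff)
    then have "i - j + 2 \<ge> 2 * k - 2"
      using common_neighbour_distance[of j i q b] i j q c d b_notin[of j] by simp
    then have "i + 1 \<ge> length q" using j q k3 \<open>j < i\<close> by linarith
    then show ?thesis using last[of i] i by simp
  qed
qed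

text \<open>\<open>a\<close> is an end of \<open>P l\<close>, and a vertex is an end of only one
  path. So \<open>a\<close> is not the far end of \<open>P b\<close>, and it must be the other chord
  that goes there.\<close>

lemma slots_two_chords:
  assumes S: "slots X P" and b: "b \<in> X" and l: "l \<in> X" "b \<noteq> l" "b \<noteq> last (P l)" and a: "a = l \<or> a = last (P l)"
    and ab: "a \<in> set (P b)" "{b, a} \<in> E" "{b, a} \<notin> walk_edges (P b)"
    and x: "x \<in> set (P b)" "{b, x} \<in> E" "{b, x} \<notin> walk_edges (P b)" "x \<noteq> a"
  shows "x = last (P b)"
proof -
  note B = slotsD[OF S b] and L = slotsD[OF S l(1)]
  have "a \<noteq> last (P b)" using a B(8) L(8) l by auto
  then show ?thesis
    using two_chords_from_end[OF B(1,2,6,3) ab x(1-3)] x(4) by auto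
qed

text \<open>At \<open>b\<close> the path \<open>P b\<close> has two chords: the link to
  \<open>a\<close>, and the edge to \<open>z\<close> that belongs to \<open>P l\<close>. By
  \<open>slots_two_chords\<close> the vertex \<open>z\<close> is the far end of \<open>P b\<close>,
  so the edge \<open>{b, z}\<close> closes \<open>P b\<close> to a cycle of length 2k, which is
  split off. Rotated with the link in place of this edge, \<open>P l\<close> is still a path from
  \<open>l\<close> on the same vertices, but ends at \<open>z\<close>; thus \<open>a\<close> and
  \<open>b\<close> cease to be ends.\<close>

lemma absorb_link:
  assumes S: "slots X P" and l: "l \<in> X" and p: "P l = u @ b # z # w" and b: "b \<in> X" "b \<noteq> l"
    and ab: "a = last (P l)" "b \<noteq> a" "{a, b} \<in> E" "\<forall>u\<in>X. {a, b} \<notin> walk_edges (P u)"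
    and bad: "a \<in> set (P b)" "z \<in> set (P b)"
  defines "X' \<equiv> X - {a, b}" and "C \<equiv> cycle_edges (P b)"
  shows "\<exists>P'. slots X' P' \<and> set (P' l) = set (P l) \<and> path_edges X P \<union> {{a, b}} = path_edges X' P' \<union> C \<and>
     path_edges X' P' \<inter> C = {}"
    and "piece C" "l \<in> X'" "card X = card X' + 2"
proof -
  note L = slotsD[OF S l] and B = slotsD[OF S b(1)]
  have aX: "a \<in> X" "a \<noteq> l" using L ab by auto
  then show lX: "l \<in> X'" using l b by (auto simp: X'_def)
  have fin: "finite X" using S by (simp add: slots_def)
  have "card {a, b} \<le> card X" by (rule card_mono) (use fin aX b in auto)
  moreover have "card X' = card X - card {a, b}" unfolding X'_def by (rule card_Diff_subset) (use aX b in auto)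
  ultimately show "card X = card X' + 2" using ab(2) by (simp add: card_insert_if)
  have dp: "distinct (u @ b # z # w)" using L(1) p by simp
  have a_zw: "a = last (z # w)" using ab(1) p by simp
  note R = rotate_path[OF dp, folded a_zw]
  let ?W = "walk_edges (u @ [b]) \<union> walk_edges (z # w)"
  let ?r = "u @ b # rev (z # w)"
  have bz: "{b, z} \<in> walk_edges (P l)" using p R(1) by auto
  have za: "z \<noteq> a"
  proof
    assume "z = a"
    then have "{a, b} \<in> walk_edges (P l)" using bz by (simp add: insert_commute)
    then show False using ab(4) l by auto
  qed
  have la: "last (P b) \<noteq> l" using B(8) ab by auto
  have Pbl: "walk_edges (P b) \<inter> walk_edges (P l) = {}" using slots_disjoint[OF S b(1) l b(2)] ab by auto
  have zlast: "z = last (P b)"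
  proof (rule slots_two_chords[OF S b(1) l b(2)])
    show "b \<noteq> last (P l)" "a = l \<or> a = last (P l)" using ab by auto
    show "{b, a} \<in> E" "{b, a} \<notin> walk_edges (P b)" using ab b by (auto simp: insert_commute)
    show "{b, z} \<in> E" "{b, z} \<notin> walk_edges (P b)" using bz L(6) Pbl by auto
  qed (use bad za in auto)
  have zX: "z \<in> X'" "z \<noteq> l" "z \<noteq> b" using zlast B za la by (auto simp: X'_def)
  have une: "u \<noteq> []" using p L(3) b(2) by (cases u) auto
  have C: "C = insert {z, b} (walk_edges (P b))" by (simp add: C_def cycle_edges_def zlast B(3))
  show "piece C" unfolding piece_def C_def cycle_set_def using B by blast
  define P' where "P' = P(l := ?r, z := rev ?r)"
  have P'l: "P' l = ?r" and P'z: "P' z = rev ?r" using zX by (auto simp: P'_def)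
  have P'o: "P' v = P v" if "v \<noteq> l" "v \<noteq> z" for v using that by (simp add: P'_def)
  have hr: "hd ?r = l" using R(7)[OF une] p L(3) by simp
  have lenr: "length ?r = 2 * k" using L(2) p by simp
  have rE: "walk_edges ?r \<subseteq> E" using R(1,2) L(6) p ab(3) by auto
  have good: "distinct (P' v) \<and> length (P' v) = 2 * k \<and> hd (P' v) = v \<and> last (P' v) \<in> X' \<and>
      P' (last (P' v)) = rev (P' v) \<and> walk_edges (P' v) \<subseteq> E" if v: "v \<in> X'" for v
  proof -
    consider "v = l" | "v = z" | "v \<noteq> l" "v \<noteq> z" by blast
    then show ?thesis
    proof cases
      case 1
      have "last ?r \<in> X'" "P' (last ?r) = rev ?r" unfolding R(5) using zX P'z by auto
      then show ?thesis unfolding 1 P'l using R(4) lenr hr rE by blast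
    next
      case 2
      have "last (rev ?r) = l" "hd (rev ?r) = z" using hr R(5) by (auto simp: last_rev hd_rev)
      moreover have "distinct (rev ?r)" "length (rev ?r) = 2 * k" "walk_edges (rev ?r) \<subseteq> E"
        using R(4) lenr rE walk_edges_rev[of ?r] by (auto simp only: distinct_rev length_rev)
      ultimately show ?thesis unfolding 2 P'z using lX P'l by simp
    next
      case 3
      have vX: "v \<in> X" "v \<noteq> a" "v \<noteq> b" using v by (auto simp: X'_def)
      note VV = slotsD[OF S vX(1)]
      have "last (P v) \<noteq> l" "last (P v) \<noteq> z" "last (P v) \<noteq> a" "last (P v) \<noteq> b"
        using VV(8) L(8) B(8) ab(1) zlast vX 3 by auto
      then show ?thesis using P'o[OF 3] P'o[of "last (P v)"] VV by (auto simp: X'_def)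
    qed
  qed
  have wr: "walk_edges ?r \<subseteq> insert {a, b} (walk_edges (P l))" using R(1,2) p by auto
  have disr: "walk_edges (P v) \<inter> walk_edges ?r = {}" if "v \<in> X'" "v \<noteq> l" "v \<noteq> z" for v
  proof -
    have "v \<in> X" "v \<noteq> a" using that by (auto simp: X'_def)
    then have "walk_edges (P v) \<inter> walk_edges (P l) = {}" using slots_disjoint[OF S _ l] that ab(1) by auto
    then show ?thesis using wr ab(4) \<open>v \<in> X\<close> by auto
  qed
  have dis: "walk_edges (P' x) \<inter> walk_edges (P' y) = {}"
    if "x \<in> X'" "y \<in> X'" "x \<noteq> y" "x \<noteq> last (P' y)" for x y
  proof -
    have we: "walk_edges (P' v) = (if v = l \<or> v = z then walk_edges ?r else walk_edges (P v))" for v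
      using P'l P'z P'o walk_edges_rev[of ?r] by metis
    have "last (P' l) = z" "last (P' z) = l" using P'l P'z R(5) hr by (auto simp: last_rev)
    then have nb: "\<not> ((x = l \<or> x = z) \<and> (y = l \<or> y = z))" using that by auto
    show ?thesis
    proof (cases "x = l \<or> x = z")
      case True
      then show ?thesis using nb we disr[of y] that by auto
    next
      case False
      show ?thesis
      proof (cases "y = l \<or> y = z")
        case True
        then show ?thesis using False we disr[of x] that by auto
      next
        case F: False
        then show ?thesis using False we that slots_disjoint[OF S, of x y] P'o[of y] by (auto simp: X'_def)
      qed
    qed
  qed
  have "slots X' P'" unfolding slots_def using good dis fin by (auto simp: X'_def)
  moreover have "set (P' l) = set (P l)" using P'l R(6) p by simp
  moreover have pe': "path_edges X' P' = walk_edges ?r \<union> path_edges (X' - {l, z}) P"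
  proof -
    have "path_edges X' P' = walk_edges (P' l) \<union> walk_edges (P' z) \<union> path_edges (X' - {l, z}) P'"
      using lX zX by (auto simp: path_edges_def)
    moreover have "path_edges (X' - {l, z}) P' = path_edges (X' - {l, z}) P"
      using P'o by (auto simp: path_edges_def)
    moreover have "walk_edges (P' z) = walk_edges ?r" using P'z walk_edges_rev[of ?r] by metis
    ultimately show ?thesis using P'l by auto
  qed
  moreover have pe: "path_edges X P = walk_edges (P l) \<union> walk_edges (P b) \<union> path_edges (X' - {l, z}) P"
  proof -
    have "X = {l, a} \<union> {b, z} \<union> (X' - {l, z})" using l aX b zX by (auto simp: X'_def)
    then have "path_edges X P = path_edges ({l, a} \<union> {b, z} \<union> (X' - {l, z})) P"
      by (rule arg_cong[where f = "\<lambda>A. path_edges A P"])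
    also have "\<dots> = walk_edges (P l) \<union> walk_edges (P a) \<union> (walk_edges (P b) \<union> walk_edges (P z)) \<union>
        path_edges (X' - {l, z}) P"
      unfolding path_edges_def UN_Un by simp
    finally have "path_edges X P = walk_edges (P l) \<union> walk_edges (P a) \<union> (walk_edges (P b) \<union> walk_edges (P z)) \<union>
        path_edges (X' - {l, z}) P" .
    moreover have "walk_edges (P a) = walk_edges (P l)" "walk_edges (P z) = walk_edges (P b)"
      using L(5) B(5) ab(1) zlast by auto
    ultimately show ?thesis by auto
  qed
  have "path_edges X P \<union> {{a, b}} = path_edges X' P' \<union> C"
    unfolding pe pe' C using p R(1,2) by (auto simp: insert_commute)
  moreover have "path_edges X' P' \<inter> C = {}"
  proof -
    have "walk_edges ?r \<inter> C = {}"
    proof -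
      have "{z, b} \<notin> walk_edges ?r" unfolding R(2) using R(3) za by (auto simp: insert_commute doubleton_eq_iff)
      moreover have "walk_edges ?r \<inter> walk_edges (P b) = {}" using wr Pbl ab(4) b by auto
      ultimately show ?thesis unfolding C by auto
    qed
    moreover have "walk_edges (P v) \<inter> C = {}" if "v \<in> X' - {l, z}" for v
    proof -
      have v: "v \<in> X" "v \<noteq> a" "v \<noteq> b" "v \<noteq> l" "v \<noteq> z" using that by (auto simp: X'_def)
      have "walk_edges (P v) \<inter> walk_edges (P b) = {}" using slots_disjoint[OF S v(1) b(1)] v zlast by auto
      moreover have "walk_edges (P v) \<inter> walk_edges (P l) = {}" using slots_disjoint[OF S v(1) l] v ab(1) by auto
      ultimately show ?thesis unfolding C using bz by (auto simp: insert_commute)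
    qed
    ultimately show ?thesis unfolding pe' by (auto simp: path_edges_def)
  qed
  ultimately show "\<exists>P'. slots X' P' \<and> set (P' l) = set (P l) \<and> path_edges X P \<union> {{a, b}} = path_edges X' P' \<union> C \<and>
     path_edges X' P' \<inter> C = {}" by blast
qed

text \<open>The colouring \<open>L\<close> directs all chains: it contains one end of each path, and
  the link at the far end leads to the chosen end of the next path. Every path is rotated with the
  link at its far end. This releases an edge at the start of the next path, where it is attached;
  \<open>noabs\<close> says that its other vertex is not on that path. All paths do this at once, so
  no chain has to be cut.\<close>

lemma all_links_bad:
  assumes S: "slots X P" and K: "links X \<mu> P X"
    and noloop: "\<And>a. a \<in> X \<Longrightarrow> \<mu> a \<noteq> last (P a)"
    and bad: "\<And>a. a \<in> X \<Longrightarrow> a \<in> set (P (\<mu> a))"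
    and noabs: "\<And>a u z w. a \<in> X \<Longrightarrow> P (last (P a)) = u @ \<mu> a # z # w \<Longrightarrow> z \<notin> set (P (\<mu> a))"
  shows "decomp (path_edges X P \<union> link_edges X \<mu>) (card X div 2)"
proof -
  have fin: "finite X" using S by (simp add: slots_def)
  have mu: "\<mu> v \<in> X" "\<mu> v \<noteq> v" "\<mu> (\<mu> v) = v" "{v, \<mu> v} \<in> E" if "v \<in> X" for v
    using K that by (auto simp: links_def)
  have muP: "{v, \<mu> v} \<notin> walk_edges (P u)" if "v \<in> X" "u \<in> X" for u v using K that by (auto simp: links_def)
  obtain L where L: "L \<subseteq> X" "\<And>v. v \<in> X \<Longrightarrow> last (P v) \<in> L \<longleftrightarrow> v \<notin> L" "\<And>v. v \<in> X \<Longrightarrow> \<mu> v \<in> L \<longleftrightarrow> v \<notin> L"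
  proof -
    have "\<exists>L\<subseteq>X. \<forall>v\<in>X. (last (P v) \<in> L \<longleftrightarrow> v \<notin> L) \<and> (\<mu> v \<in> L \<longleftrightarrow> v \<notin> L)"
      by (rule two_colouring[OF fin]) (simp_all add: slotsD(4,8,9)[OF S] mu(1-3))
    then show thesis using that by blast
  qed
  define nx where "nx l = \<mu> (last (P l))" for l
  define prev where "prev l = last (P (\<mu> l))" for l
  have LX: "l \<in> X" if "l \<in> L" for l using that L by auto
  have nxL: "nx l \<in> L" if "l \<in> L" for l using L slotsD(4)[OF S] LX[OF that] that unfolding nx_def by blast
  have prL: "prev l \<in> L" if "l \<in> L" for l using L mu(1) LX[OF that] that unfolding prev_def by blast
  have nxpr: "nx (prev l) = l" if "l \<in> L" for l
    unfolding nx_def prev_def using slotsD(8)[OF S mu(1)] mu(3) LX[OF that] by simp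
  have prnx: "prev (nx l) = l" if "l \<in> L" for l
    unfolding nx_def prev_def using slotsD(8)[OF S] slotsD(4)[OF S] mu(3) LX[OF that] by simp
  have "\<exists>u z w. P l = u @ nx l # z # w" if l: "l \<in> L" for l
  proof -
    note D = slotsD[OF S LX[OF l]]
    let ?b = "\<mu> (last (P l))"
    have "?b \<in> set (P (\<mu> ?b))" using bad mu(1) D(4) by blast
    then have "?b \<in> set (P l)" using mu(3)[OF D(4)] D(5) by simp
    then obtain u w where w: "P l = u @ ?b # w" by (auto dest: split_list)
    have "w \<noteq> []" using arg_cong[OF w, of last] mu(2)[OF D(4)] by auto
    then show ?thesis using w unfolding nx_def by (cases w) auto
  qed
  then obtain U Z W where UZW: "\<And>l. l \<in> L \<Longrightarrow> P l = U l @ nx l # Z l # W l" by metis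
  \<comment> \<open>\<open>x l\<close> is the edge that the path of \<open>l\<close> hands on,
    \<open>y l\<close> the link that it receives, and \<open>W' l\<close> the part that it
    keeps.\<close>
  define x where "x l = {nx l, Z l}" for l
  define y where "y l = {last (P l), nx l}" for l
  define W' where "W' l = walk_edges (U l @ [nx l]) \<union> walk_edges (Z l # W l)" for l
  define Q where "Q l = Z (prev l) # U l @ nx l # rev (Z l # W l)" for l
  have props: "walk_edges (P l) = insert (x l) (W' l)" "x l \<notin> W' l" "distinct (Q l)" "length (Q l) \<ge> 2"
    "walk_edges (Q l) = insert (x (prev l)) (insert (y l) (W' l))" if l: "l \<in> L" for l
  proof -
    note D = slotsD[OF S LX[OF l]]
    have d: "distinct (U l @ nx l # Z l # W l)" using D(1) UZW[OF l] by simp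
    note R = rotate_path[OF d]
    have a: "last (Z l # W l) = last (P l)" using UZW[OF l] by simp
    show "walk_edges (P l) = insert (x l) (W' l)" "x l \<notin> W' l"
      unfolding UZW[OF l] x_def W'_def using R(1,3) by simp_all
    \<comment> \<open>A rotation keeps the start of the path unless it is made at the start itself,
      which \<open>noloop\<close> excludes.\<close>
    have nxl: "nx l \<noteq> l" unfolding nx_def using noloop[OF D(4)] D(8) by simp
    have "U l \<noteq> []" using UZW[OF l] D(3) nxl by (cases "U l") auto
    then have h: "hd (U l @ nx l # rev (Z l # W l)) = l" using R(7) UZW[OF l] D(3) by simp
    have "P (last (P (last (P (prev l))))) = U (prev l) @ \<mu> (last (P (prev l))) # Z (prev l) # W (prev l)"
      using UZW[OF prL[OF l]] slotsD(8)[OF S LX[OF prL[OF l]]] nx_def by simp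
    then have "Z (prev l) \<notin> set (P (\<mu> (last (P (prev l)))))"
      by (rule noabs[rotated]) (use slotsD(4)[OF S LX[OF prL[OF l]]] in simp)
    then have "Z (prev l) \<notin> set (P l)" using nxpr[OF l] nx_def by simp
    then show "distinct (Q l)" unfolding Q_def using R(4,6) UZW[OF l] by simp
    show "length (Q l) \<ge> 2" by (simp add: Q_def)
    have "walk_edges (Q l) = insert {Z (prev l), l} (walk_edges (U l @ nx l # rev (Z l # W l)))"
      unfolding Q_def using walk_edges_append[of "[Z (prev l)]" "U l @ nx l # rev (Z l # W l)"] h by simp
    then show "walk_edges (Q l) = insert (x (prev l)) (insert (y l) (W' l))"
      unfolding R(2) a x_def y_def W'_def nxpr[OF l] by (simp add: insert_commute)
  qed
  have dP: "walk_edges (P l) \<inter> walk_edges (P l') = {}" if "l \<in> L" "l' \<in> L" "l \<noteq> l'" for l l'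
    using slots_disjoint[OF S LX[OF that(1)] LX[OF that(2)]] that L(2)[OF LX[OF that(2)]] by auto
  have yP: "y l \<notin> walk_edges (P u)" if "l \<in> L" "u \<in> X" for l u
    unfolding y_def nx_def using muP slotsD(4)[OF S LX[OF that(1)]] that(2) by simp
  have yy: "l = l'" if "l \<in> L" "l' \<in> L" "y l = y l'" for l l'
  proof -
    have "last (P l) \<notin> L" "last (P l') \<notin> L" using L(2) LX that by auto
    moreover have "nx l \<in> L" "nx l' \<in> L" using nxL that by auto
    ultimately have "nx l = nx l'" using that(3) unfolding y_def by (auto simp: doubleton_eq_iff)
    then show ?thesis using prnx that by metis
  qed
  have dis: "walk_edges (Q l) \<inter> walk_edges (Q l') = {}" if l: "l \<in> L" "l' \<in> L" and ne: "l \<noteq> l'" for l l'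
  proof -
    have xW: "x (prev m) \<notin> W' m'" if "m \<in> L" "m' \<in> L" for m m'
    proof (cases "prev m = m'")
      case False
      then have "walk_edges (P (prev m)) \<inter> walk_edges (P m') = {}" using dP prL that by auto
      then show ?thesis using props(1)[OF prL[OF that(1)]] props(1)[OF that(2)] by auto
    qed (use props(2) that in auto)
    have "prev l \<noteq> prev l'" using nxpr l ne by metis
    then have xx: "x (prev l) \<noteq> x (prev l')"
      using dP[OF prL[OF l(1)] prL[OF l(2)]] props(1)[OF prL[OF l(1)]] props(1)[OF prL[OF l(2)]] by auto
    have xy: "x (prev m) \<noteq> y m'" if "m \<in> L" "m' \<in> L" for m m'
      using props(1)[OF prL[OF that(1)]] yP[OF that(2) LX[OF prL[OF that(1)]]] by auto
    have yW: "y m \<notin> W' m'" if "m \<in> L" "m' \<in> L" for m m'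
      using props(1)[OF that(2)] yP[OF that(1) LX[OF that(2)]] by auto
    have "W' l \<inter> W' l' = {}" using dP[OF l ne] props(1) l by auto
    then show ?thesis unfolding props(5)[OF l(1)] props(5)[OF l(2)]
      using xW[OF l] xW[OF l(2,1)] xx xy[OF l] xy[OF l(2,1)] yW[OF l] yW[OF l(2,1)] yy[OF l] ne by auto
  qed
  have "finite L" using fin L(1) by (rule finite_subset[rotated])
  then have dec: "decomp (\<Union>l\<in>L. walk_edges (Q l)) (card L)"
  proof (rule decomp_family)
    show "piece (walk_edges (Q l))" if "l \<in> L" for l by (rule piece_path[OF props(3,4)[OF that]])
  qed (rule dis)
  have img: "(\<lambda>v. last (P v)) ` L = X - L"
  proof
    show "(\<lambda>v. last (P v)) ` L \<subseteq> X - L" using L(2) LX slotsD(4)[OF S] by auto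
    show "X - L \<subseteq> (\<lambda>v. last (P v)) ` L"
    proof
      fix v assume "v \<in> X - L"
      then have "last (P v) \<in> L" "v = last (P (last (P v)))" using L(2) slotsD(8)[OF S] by auto
      then show "v \<in> (\<lambda>v. last (P v)) ` L" by blast
    qed
  qed
  have "inj_on (\<lambda>v. last (P v)) L" by (rule inj_onI) (metis slotsD(8)[OF S] LX)
  then have "card (X - L) = card L" using card_image img by metis
  then have "card X = card L * 2"
    using card_Diff_subset[OF \<open>finite L\<close> L(1)] card_mono[OF fin L(1)] by simp
  moreover have "(\<Union>l\<in>L. walk_edges (Q l)) = path_edges X P \<union> link_edges X \<mu>"
  proof -
    have "path_edges X P = (\<Union>l\<in>L. walk_edges (P l))"
    proof -
      have "walk_edges (P v) \<subseteq> (\<Union>l\<in>L. walk_edges (P l))" if v: "v \<in> X" for v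
      proof (cases "v \<in> L")
        case False
        then have "last (P v) \<in> L" using L(2) v by auto
        moreover have "walk_edges (P (last (P v))) = walk_edges (P v)" using slotsD(5)[OF S v] by simp
        ultimately show ?thesis by blast
      qed auto
      then show ?thesis using L(1) by (auto simp: path_edges_def)
    qed
    also have "\<dots> = (\<Union>l\<in>L. insert (x l) (W' l))" using props(1) by auto
    finally have pe: "path_edges X P = x ` L \<union> (\<Union>l\<in>L. W' l)" by auto
    have le: "link_edges X \<mu> = y ` L"
    proof
      show "y ` L \<subseteq> link_edges X \<mu>"
        using slotsD(4)[OF S] LX unfolding y_def nx_def link_edges_def by auto
      have yl: "{v, \<mu> v} \<in> y ` L" if v: "v \<in> X" "v \<notin> L" for v
      proof -
        have "last (P v) \<in> L" using L(2) v by auto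
        moreover have "y (last (P v)) = {v, \<mu> v}" unfolding y_def nx_def using slotsD(8)[OF S v(1)] by simp
        ultimately show ?thesis by (metis imageI)
      qed
      show "link_edges X \<mu> \<subseteq> y ` L"
      proof
        fix e assume "e \<in> link_edges X \<mu>"
        then obtain v where v: "v \<in> X" "e = {v, \<mu> v}" by (auto simp: link_edges_def)
        show "e \<in> y ` L"
        proof (cases "v \<in> L")
          case True
          then have "{\<mu> v, \<mu> (\<mu> v)} \<in> y ` L" using yl[of "\<mu> v"] mu v L(3) by auto
          then show ?thesis using mu(3) v by (simp add: insert_commute)
        qed (use yl v in auto)
      qed
    qed
    have "x ` L = (\<lambda>l. x (prev l)) ` L"
    proof
      show "x ` L \<subseteq> (\<lambda>l. x (prev l)) ` L"
      proof
        fix e assume "e \<in> x ` L"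
        then obtain l where l: "l \<in> L" "e = x l" by auto
        then have "e = x (prev (nx l))" using prnx by simp
        then show "e \<in> (\<lambda>l. x (prev l)) ` L" using nxL l by blast
      qed
    qed (use prL in auto)
    moreover have "(\<Union>l\<in>L. walk_edges (Q l)) = (\<lambda>l. x (prev l)) ` L \<union> (y ` L \<union> (\<Union>l\<in>L. W' l))"
      using props(5) by auto
    ultimately show ?thesis using pe le by auto
  qed
  ultimately show ?thesis using dec by simp
qed

text \<open>The links form cycles through the paths; here one such cycle has been cut open, with free ends $l$ and $e$.
  The list $xs$ carries at most one edge, handed over by the previous path and still to be attached at $l$.\<close>

lemma open_chain:
  assumes IHc: "\<And>X P. card X < N \<Longrightarrow> slots X P \<Longrightarrow> links X \<mu> P X \<Longrightarrow>
      decomp (path_edges X P \<union> link_edges X \<mu>) (card X div 2)"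
  shows "card X \<le> N \<Longrightarrow> slots X P \<Longrightarrow> l \<in> X \<Longrightarrow> e \<in> X \<Longrightarrow> l \<noteq> e \<Longrightarrow> links (X - {l, e}) \<mu> P X \<Longrightarrow>
    length xs \<le> 1 \<Longrightarrow> set xs \<inter> set (P l) = {} \<Longrightarrow> walk_edges (xs @ [l]) \<subseteq> E \<Longrightarrow>
    walk_edges (xs @ [l]) \<inter> (path_edges X P \<union> link_edges (X - {l, e}) \<mu>) = {} \<Longrightarrow>
    decomp (path_edges X P \<union> link_edges (X - {l, e}) \<mu> \<union> walk_edges (xs @ [l])) (card X div 2)"
proof (induction "card X" arbitrary: X P l xs rule: less_induct)
  case less
  note S = less.prems(2) and l = less.prems(3) and e = less.prems(4) and le = less.prems(5)
    and K = less.prems(6) and xs = less.prems(7-10)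
  note D = slotsD[OF S l]
  define a where "a = last (P l)"
  define X' where "X' = X - {l, a}"
  note R = slots_remove[OF S l, folded a_def, folded X'_def]
  have dxs: "distinct xs" using xs(1) by (cases xs) auto
  have P1: "P l = l # tl (P l)" using D(3,7) by (metis list.collapse)
  have wxP: "walk_edges (xs @ P l) = walk_edges (xs @ [l]) \<union> walk_edges (P l)"
    using walk_edges_split[of xs l "tl (P l)"] P1 by simp
  show ?case
  proof (cases "a = e")
    case True
    \<comment> \<open>The chain is exhausted. On \<open>X'\<close> every end has a link again, so
      the hypothesis \<open>IHc\<close> about uncut systems applies.\<close>
    have X': "X - {l, e} = X'" using True X'_def by auto
    have "decomp (path_edges X' P \<union> link_edges X' \<mu>) (card X' div 2)"
      by (rule IHc) (use R less.prems(1) K X' links_mono[of X' \<mu> P X X'] in \<open>auto simp: X'_def\<close>)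
    moreover have "piece (walk_edges (xs @ P l))" by (rule piece_path) (use dxs D xs k3 in auto)
    moreover have "walk_edges (P l) \<inter> link_edges X' \<mu> = {}"
      using links_disjoint[OF K _ l, of X'] X' by simp
    then have "walk_edges (xs @ P l) \<inter> (path_edges X' P \<union> link_edges X' \<mu>) = {}"
      unfolding wxP using R(2,3) xs(4) X' by auto
    ultimately have "decomp (walk_edges (xs @ P l) \<union> (path_edges X' P \<union> link_edges X' \<mu>)) (Suc (card X' div 2))"
      by (rule decomp_insert)
    moreover have "walk_edges (xs @ P l) \<union> (path_edges X' P \<union> link_edges X' \<mu>) =
        path_edges X P \<union> link_edges (X - {l, e}) \<mu> \<union> walk_edges (xs @ [l])"
      unfolding wxP R(2) X' by auto
    ultimately show ?thesis using R(4) by simp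
  next
    case False
    define b where "b = \<mu> a"
    have aY: "a \<in> X - {l, e}" using D(4,9) False a_def by auto
    have mu: "b \<in> X - {l, e}" "b \<noteq> a" "\<mu> b = a" "{a, b} \<in> E" using K aY unfolding links_def b_def by auto
    have abP: "\<forall>u\<in>X. {a, b} \<notin> walk_edges (P u)" using K aY unfolding links_def b_def by auto
    note KR = links_remove[OF K aY, folded b_def]
    have Y': "X - {l, e} - {a, b} = X' - {b, e}" by (auto simp: X'_def)
    have bX: "b \<in> X" "b \<noteq> l" "b \<noteq> e" "b \<in> X'" "e \<in> X'" using mu e le False by (auto simp: X'_def)
    define T where "T = path_edges X' P \<union> link_edges (X' - {b, e}) \<mu>"
    define R0 where "R0 = walk_edges (P l) \<union> walk_edges (xs @ [l]) \<union> {{a, b}}"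
    have ST: "R0 \<inter> T = {}"
    proof -
      have "walk_edges (P l) \<inter> link_edges (X' - {b, e}) \<mu> = {}"
        using links_disjoint[OF K _ l, of "X' - {b, e}"] Y' by auto
      moreover have "walk_edges (xs @ [l]) \<inter> T = {}"
        using xs(4) R(2) KR(2) Y' unfolding T_def by auto
      moreover have "{a, b} \<notin> path_edges X' P" using abP by (auto simp: path_edges_def X'_def)
      moreover have "{a, b} \<notin> link_edges (X' - {b, e}) \<mu>" using KR(3) Y' by simp
      ultimately show ?thesis using R(3) unfolding R0_def T_def by auto
    qed
    have total: "path_edges X P \<union> link_edges (X - {l, e}) \<mu> \<union> walk_edges (xs @ [l]) = R0 \<union> T"
      unfolding R(2) KR(2) Y' R0_def T_def by auto
    have R0E: "R0 \<subseteq> E" using D(6) xs(3) mu(4) by (auto simp: R0_def)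
    \<comment> \<open>One step along the chain: from the edges \<open>R0\<close> of the current
      path, its prefix and the link at its far end, the path \<open>q\<close> is split off. At most
      one edge is left, and it becomes the prefix of the next path, which starts at
      \<open>b\<close>.\<close>
    have emit: ?thesis if q: "distinct q" "length q \<ge> 2" "walk_edges q \<union> walk_edges (ys @ [b]) = R0"
      "walk_edges q \<inter> walk_edges (ys @ [b]) = {}" and ys: "length ys \<le> 1" "set ys \<inter> set (P b) = {}" for q ys
    proof -
      have "decomp (path_edges X' P \<union> link_edges (X' - {b, e}) \<mu> \<union> walk_edges (ys @ [b])) (card X' div 2)"
      proof (rule less.hyps)
        show "card X' < card X" "card X' \<le> N" using R(4) less.prems(1) by auto
        show "links (X' - {b, e}) \<mu> P X'"
          using links_mono[OF KR(1), of X'] Y' by (auto simp: X'_def)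
        show "walk_edges (ys @ [b]) \<subseteq> E" using q(3) R0E by auto
        show "walk_edges (ys @ [b]) \<inter> (path_edges X' P \<union> link_edges (X' - {b, e}) \<mu>) = {}"
          using q(3) ST unfolding T_def by auto
      qed (use R bX ys in auto)
      then have "decomp (T \<union> walk_edges (ys @ [b])) (card X' div 2)" by (simp add: T_def)
      moreover have "walk_edges q \<inter> (T \<union> walk_edges (ys @ [b])) = {}" using q(3,4) ST by auto
      ultimately have "decomp (walk_edges q \<union> (T \<union> walk_edges (ys @ [b]))) (Suc (card X' div 2))"
        by (rule decomp_insert[OF _ piece_path[OF q(1,2)]])
      moreover have "walk_edges q \<union> (T \<union> walk_edges (ys @ [b])) = R0 \<union> T" using q(3) by auto
      ultimately show ?thesis unfolding total using R(4) by simp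
    qed
    have lenP: "length (P l) \<ge> 2" using D(2) k3 by auto
    have abR: "{a, b} \<notin> walk_edges (P l)" using abP l by auto
    have PA: "walk_edges (P l @ [b]) = insert {a, b} (walk_edges (P l))"
      using walk_edges_append[of "P l" "[b]"] D(7) by (simp add: a_def)
    have xab: "{a, b} \<notin> walk_edges (xs @ [l])"
      using xs(4) KR(2) by auto
    have xP: "walk_edges (xs @ [l]) \<inter> walk_edges (P l) = {}" using xs(4) R(2) by auto
    \<comment> \<open>The link goes to the next path if that avoids \<open>a\<close>, and otherwise
      to the current path if this avoids \<open>b\<close>. In \<open>clash\<close> the only obstacle
      is that \<open>b\<close> is the vertex handed over; then the link is appended and the edge
      from \<open>b\<close> to \<open>l\<close> is passed on. In \<open>bad\<close> both ends are
      blocked, and a rotation either releases an edge to pass on or leads to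
      \<open>absorb_link\<close>.\<close>
    consider (fwd) "a \<notin> set (P b)" | (bwd) "a \<in> set (P b)" "b \<notin> set (P l)" "b \<notin> set xs"
      | (clash) "a \<in> set (P b)" "b \<notin> set (P l)" "b \<in> set xs" | (bad) "a \<in> set (P b)" "b \<in> set (P l)" by blast
    then show ?thesis
    proof cases
      case fwd
      show ?thesis
      proof (rule emit[of "xs @ P l" "[a]"])
        show "walk_edges (xs @ P l) \<union> walk_edges ([a] @ [b]) = R0" unfolding wxP R0_def by auto
        show "walk_edges (xs @ P l) \<inter> walk_edges ([a] @ [b]) = {}" unfolding wxP using abR xab by auto
      qed (use fwd dxs D lenP xs in auto)
    next
      case bwd
      have w: "walk_edges (xs @ P l @ [b]) = walk_edges (xs @ [l]) \<union> insert {a, b} (walk_edges (P l))"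
        using walk_edges_split[of xs l "tl (P l) @ [b]"] P1 PA by (metis append_Cons)
      show ?thesis
      proof (rule emit[of "xs @ P l @ [b]" "[]"])
        show "walk_edges (xs @ P l @ [b]) \<union> walk_edges ([] @ [b]) = R0" unfolding w R0_def by auto
      qed (use bwd dxs D lenP xs in auto)
    next
      case clash
      then have xsb: "xs = [b]" using xs(1) by (cases xs) auto
      have lb: "{l, b} \<in> E" "{l, b} \<notin> path_edges X P" using xs(3,4) unfolding xsb by (auto simp: insert_commute)
      \<comment> \<open>Otherwise \<open>b\<close> would have chords to both ends of
        \<open>P l\<close>, and one of these would have to be the far end of
        \<open>P b\<close>.\<close>
      have "l \<notin> set (P b)"
      proof
        assume lPb: "l \<in> set (P b)"
        have "l = last (P b)"
        proof (rule slots_two_chords[OF S bX(1) l bX(2)])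
          show "b \<noteq> last (P l)" "a = l \<or> a = last (P l)" using mu a_def by auto
          show "{b, a} \<in> E" "{b, a} \<notin> walk_edges (P b)" using mu abP bX by (auto simp: insert_commute)
          show "{b, l} \<in> E" "{b, l} \<notin> walk_edges (P b)" using lb bX by (auto simp: insert_commute path_edges_def)
        qed (use clash lPb aY in auto)
        then show False using slotsD(8)[OF S bX(1)] a_def mu by auto
      qed
      show ?thesis
      proof (rule emit[of "P l @ [b]" "[l]"])
        show "walk_edges (P l @ [b]) \<union> walk_edges ([l] @ [b]) = R0"
          unfolding PA R0_def xsb by (auto simp: insert_commute)
        show "walk_edges (P l @ [b]) \<inter> walk_edges ([l] @ [b]) = {}"
          unfolding PA using xP xab unfolding xsb by (auto simp: insert_commute)
      qed (use clash D lenP \<open>l \<notin> set (P b)\<close> in auto)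
    next
      case bad
      obtain u w' where uw: "P l = u @ b # w'" using bad by (auto dest: split_list)
      have "w' \<noteq> []" using arg_cong[OF uw, of last] mu(2) a_def by auto
      then obtain z w where P: "P l = u @ b # z # w" using uw by (cases w') auto
      have dP: "distinct (u @ b # z # w)" using D(1) P by simp
      have zw: "last (z # w) = a" using P a_def by simp
      note RP = rotate_path[OF dP, unfolded zw]
      have une: "u \<noteq> []" using P D(3) bX(2) by (cases u) auto
      let ?r = "u @ b # rev (z # w)"
      show ?thesis
      proof (cases "z \<in> set (P b)")
        case False
        have "hd ?r = l" using RP(7)[OF une] P D(3) by simp
        then have r1: "?r = l # tl ?r" by (metis Nil_is_append_conv list.collapse list.distinct(1))
        have w: "walk_edges (xs @ ?r) = walk_edges (xs @ [l]) \<union> walk_edges ?r"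
          using walk_edges_split[of xs l "tl ?r"] r1 by metis
        show ?thesis
        proof (rule emit[of "xs @ ?r" "[z]"])
          show "walk_edges (xs @ ?r) \<union> walk_edges ([z] @ [b]) = R0"
            unfolding w R0_def P RP(1,2) by (auto simp: insert_commute)
          have "{z, b} \<in> walk_edges (P l)" unfolding P RP(1) by (simp add: insert_commute)
          then have "{z, b} \<notin> walk_edges (xs @ [l])" "{z, b} \<noteq> {a, b}" using xP abR by auto
          moreover have "{z, b} \<notin> walk_edges ?r" unfolding RP(2) using RP(3) \<open>{z, b} \<noteq> {a, b}\<close>
            by (auto simp: insert_commute)
          ultimately show "walk_edges (xs @ ?r) \<inter> walk_edges ([z] @ [b]) = {}" unfolding w by simp
          show "distinct (xs @ ?r)" using dxs RP(4,6) xs(2) P by simp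
        qed (use False in auto)
      next
        case True
        \<comment> \<open>Absorption changes neither the start \<open>l\<close> nor the vertex set
          of its path, so the prefix \<open>xs\<close> still fits and the chain has merely become
          shorter.\<close>
        let ?X = "X - {a, b}" and ?C = "cycle_edges (P b)"
        note AB = absorb_link[OF S l P bX(1,2) a_def mu(2,4) abP bad(1) True]
        obtain P' where P': "slots ?X P'" "set (P' l) = set (P l)"
          "path_edges X P \<union> {{a, b}} = path_edges ?X P' \<union> ?C" "path_edges ?X P' \<inter> ?C = {}"
          using AB(1) by blast
        have Y: "X - {l, e} - {a, b} = ?X - {l, e}" by auto
        have sub: "path_edges ?X P' \<subseteq> path_edges X P \<union> {{a, b}}" using P'(3) by auto
        have abY: "{a, b} \<notin> link_edges (?X - {l, e}) \<mu>" using KR(3) Y by simp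
        have leP: "path_edges X P \<inter> link_edges (?X - {l, e}) \<mu> = {}"
          using links_disjoint[OF K, of "?X - {l, e}"] by (auto simp: path_edges_def)
        have dec: "decomp (path_edges ?X P' \<union> link_edges (?X - {l, e}) \<mu> \<union> walk_edges (xs @ [l])) (card ?X div 2)"
        proof (rule less.hyps)
          show "card ?X < card X" "card ?X \<le> N" using AB(4) less.prems(1) by auto
          show "slots ?X P'" "l \<in> ?X" "l \<noteq> e" using P' AB(3) le by auto
          show "e \<in> ?X" using e bX False \<open>a \<noteq> e\<close> by auto
          show "links (?X - {l, e}) \<mu> P' ?X"
          proof -
            have "links (?X - {l, e}) \<mu> P X" using KR(1) Y by simp
            moreover have "{v, \<mu> v} \<notin> walk_edges (P' u)" if "v \<in> ?X - {l, e}" "u \<in> ?X" for u v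
            proof -
              have "{v, \<mu> v} \<in> link_edges (?X - {l, e}) \<mu>" using that by (auto simp: link_edges_def)
              then have "{v, \<mu> v} \<notin> path_edges ?X P'" using sub abY leP by auto
              then show ?thesis using that by (auto simp: path_edges_def)
            qed
            ultimately show ?thesis by (simp add: links_def)
          qed
          show "walk_edges (xs @ [l]) \<inter> (path_edges ?X P' \<union> link_edges (?X - {l, e}) \<mu>) = {}"
            using xs(4) sub xab KR(2) Y by auto
          show "length xs \<le> 1" "set xs \<inter> set (P' l) = {}" "walk_edges (xs @ [l]) \<subseteq> E" using xs P' by auto
        qed
        have "decomp (?C \<union> (path_edges ?X P' \<union> link_edges (?X - {l, e}) \<mu> \<union> walk_edges (xs @ [l]))) (Suc (card ?X div 2))"
        proof (rule decomp_insert[OF dec AB(2)])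
          have "?C \<subseteq> path_edges X P \<union> {{a, b}}" using P'(3) by auto
          then show "?C \<inter> (path_edges ?X P' \<union> link_edges (?X - {l, e}) \<mu> \<union> walk_edges (xs @ [l])) = {}"
            using P'(4) abY leP xs(4) xab by blast
        qed
        moreover have "?C \<union> (path_edges ?X P' \<union> link_edges (?X - {l, e}) \<mu> \<union> walk_edges (xs @ [l])) =
            path_edges X P \<union> link_edges (X - {l, e}) \<mu> \<union> walk_edges (xs @ [l])"
          using P'(3) KR(2) Y by auto
        ultimately show ?thesis using AB(4) by simp
      qed
    qed
  qed
qed

text \<open>A link between the two ends of one path closes it to a cycle of length 2k. If some link
  can be put before the path of its partner, its chain is cut there, with this link as the first
  prefix. If no link can, then either one of them is absorbed or the simultaneous exchange of
  \<open>all_links_bad\<close> is possible.\<close>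

lemma attach_links:
  "slots X P \<Longrightarrow> links X \<mu> P X \<Longrightarrow> decomp (path_edges X P \<union> link_edges X \<mu>) (card X div 2)"
proof (induction "card X" arbitrary: X P rule: less_induct)
  case less
  note S = less.prems(1) and K = less.prems(2)
  have fin: "finite X" using S by (simp add: slots_def)
  have mu: "\<mu> v \<in> X" "\<mu> v \<noteq> v" "\<mu> (\<mu> v) = v" "{v, \<mu> v} \<in> E" if "v \<in> X" for v
    using K that by (auto simp: links_def)
  have muP: "{v, \<mu> v} \<notin> walk_edges (P u)" if "v \<in> X" "u \<in> X" for u v using K that by (auto simp: links_def)
  show ?case
  proof (cases "\<exists>v\<in>X. \<mu> v = last (P v)")
    case True
    then obtain v where v: "v \<in> X" "\<mu> v = last (P v)" by auto
    note D = slotsD[OF S v(1)] and KR = links_remove[OF K v(1)]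
    note R = slots_remove[OF S v(1), folded v(2)]
    let ?X = "X - {v, \<mu> v}" and ?C = "cycle_edges (P v)"
    have C: "?C = insert {v, \<mu> v} (walk_edges (P v))" using v(2) D(3) by (simp add: cycle_edges_def insert_commute)
    have "decomp (path_edges ?X P \<union> link_edges ?X \<mu>) (card ?X div 2)"
      by (rule less.hyps) (use R KR links_mono in auto)
    moreover have "piece ?C" unfolding piece_def cycle_set_def using D by blast
    moreover have "?C \<inter> (path_edges ?X P \<union> link_edges ?X \<mu>) = {}"
    proof -
      have "{v, \<mu> v} \<notin> path_edges ?X P" using muP[OF v(1)] by (simp add: path_edges_def)
      moreover have "walk_edges (P v) \<inter> link_edges ?X \<mu> = {}" by (rule links_disjoint[OF K _ v(1)]) auto
      ultimately show ?thesis unfolding C using R(3) KR(3) by auto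
    qed
    ultimately have "decomp (?C \<union> (path_edges ?X P \<union> link_edges ?X \<mu>)) (Suc (card ?X div 2))"
      by (rule decomp_insert)
    moreover have "?C \<union> (path_edges ?X P \<union> link_edges ?X \<mu>) = path_edges X P \<union> link_edges X \<mu>"
      unfolding C R(2) KR(2) by auto
    ultimately show ?thesis using R(4) by simp
  next
    case noloop: False
    show ?thesis
    proof (cases "\<exists>a\<in>X. a \<notin> set (P (\<mu> a))")
      case True
      then obtain a where a: "a \<in> X" "a \<notin> set (P (\<mu> a))" by auto
      let ?b = "\<mu> a"
      note KR = links_remove[OF K a(1)]
      have Y: "X - {a, ?b} = X - {?b, a}" by auto
      have "decomp (path_edges X P \<union> link_edges (X - {?b, a}) \<mu> \<union> walk_edges ([a] @ [?b])) (card X div 2)"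
      proof (rule open_chain[of "card X" \<mu> X P ?b a "[a]"])
        show "decomp (path_edges X1 P1 \<union> link_edges X1 \<mu>) (card X1 div 2)"
          if "card X1 < card X" "slots X1 P1" "links X1 \<mu> P1 X1" for X1 P1
          using that by (rule less.hyps)
        show "links (X - {?b, a}) \<mu> P X" using KR(1) Y by simp
        have "{a, ?b} \<notin> path_edges X P" using muP[OF a(1)] by (simp add: path_edges_def)
        then show "walk_edges ([a] @ [?b]) \<inter> (path_edges X P \<union> link_edges (X - {?b, a}) \<mu>) = {}"
          using KR(3) Y by simp
      qed (use S a mu[OF a(1)] in auto)
      moreover have "path_edges X P \<union> link_edges (X - {?b, a}) \<mu> \<union> walk_edges ([a] @ [?b]) =
          path_edges X P \<union> link_edges X \<mu>"
        unfolding KR(2) Y by auto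
      ultimately show ?thesis by simp
    next
      case allbad: False
      show ?thesis
      proof (cases "\<exists>a\<in>X. \<exists>u z w. P (last (P a)) = u @ \<mu> a # z # w \<and> z \<in> set (P (\<mu> a))")
        case True
        then obtain a u z w where a: "a \<in> X" and p: "P (last (P a)) = u @ \<mu> a # z # w" and z: "z \<in> set (P (\<mu> a))"
          by blast
        define l where "l = last (P a)"
        define b where "b = \<mu> a"
        have l: "l \<in> X" "a = last (P l)" using slotsD[OF S a] l_def by auto
        have b: "b \<in> X" "b \<noteq> a" "{a, b} \<in> E" "b \<noteq> l" using mu[OF a] noloop a l_def b_def by auto
        have abP: "\<forall>u\<in>X. {a, b} \<notin> walk_edges (P u)" using muP a b_def by auto
        have abad: "a \<in> set (P b)" using allbad a b_def by auto
        note KR = links_remove[OF K a, folded b_def]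
        let ?X = "X - {a, b}" and ?C = "cycle_edges (P b)"
        note AB = absorb_link[OF S l(1) p[folded l_def b_def] b(1,4) l(2) b(2,3) abP abad z[folded b_def]]
        obtain P' where P': "slots ?X P'"
          "path_edges X P \<union> {{a, b}} = path_edges ?X P' \<union> ?C" "path_edges ?X P' \<inter> ?C = {}"
          using AB(1) by blast
        have leP: "path_edges X P \<inter> link_edges ?X \<mu> = {}"
          using links_disjoint[OF K, of ?X] by (auto simp: path_edges_def)
        have disX: "(path_edges X P \<union> {{a, b}}) \<inter> link_edges ?X \<mu> = {}" using leP KR(3) by auto
        have dec: "decomp (path_edges ?X P' \<union> link_edges ?X \<mu>) (card ?X div 2)"
        proof (rule less.hyps)
          show "card ?X < card X" using AB(4) by simp
          show "slots ?X P'" by (rule P')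
          have "{v, \<mu> v} \<notin> walk_edges (P' u)" if "v \<in> ?X" "u \<in> ?X" for u v
          proof -
            have "{v, \<mu> v} \<in> link_edges ?X \<mu>" using that by (auto simp: link_edges_def)
            then have "{v, \<mu> v} \<notin> path_edges ?X P'" using P'(2) disX by blast
            then show ?thesis using that by (auto simp: path_edges_def)
          qed
          then show "links ?X \<mu> P' ?X" using KR(1) by (simp add: links_def)
        qed
        have "decomp (?C \<union> (path_edges ?X P' \<union> link_edges ?X \<mu>)) (Suc (card ?X div 2))"
        proof (rule decomp_insert[OF dec AB(2)])
          have "?C \<inter> link_edges ?X \<mu> = {}" using P'(2) disX by blast
          then show "?C \<inter> (path_edges ?X P' \<union> link_edges ?X \<mu>) = {}" using P'(3) by blast
        qed
        moreover have "?C \<union> (path_edges ?X P' \<union> link_edges ?X \<mu>) = path_edges X P \<union> link_edges X \<mu>"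
          using P'(2) KR(2) by auto
        ultimately show ?thesis using AB(4) by simp
      next
        case False
        then show ?thesis using all_links_bad[OF S K] noloop allbad by blast
      qed
    qed
  qed
qed

end

text \<open>An orbit that leaves \<open>C\<close> is coloured by the parity of the number of steps
  to its exit. An orbit that stays in \<open>C\<close> is a cycle by injectivity and finiteness;
  \<open>only2\<close> leaves just the cycles of length two, which can be alternated.\<close>

lemma alternating_subset:
  assumes fin: "finite C" and CV: "C \<subseteq> V" and \<sigma>: "inj_on \<sigma> V" "\<sigma> ` V \<subseteq> V" and nofix: "\<And>v. v \<in> C \<Longrightarrow> \<sigma> v \<noteq> v"
    and only2: "\<And>S. S \<subseteq> C \<Longrightarrow> \<sigma> ` S = S \<Longrightarrow> (\<And>v. v \<in> S \<Longrightarrow> \<sigma> (\<sigma> v) \<noteq> v) \<Longrightarrow> S = {}"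
  shows "\<exists>R\<subseteq>C. \<forall>v\<in>C. v \<in> R \<longleftrightarrow> \<sigma> v \<notin> R"
proof -
  define D where "D = {v \<in> C. \<exists>n. (\<sigma> ^^ n) v \<notin> C}"
  define d where "d v = (LEAST n. (\<sigma> ^^ n) v \<notin> C)" for v
  define X where "X = C - D"
  have step: "(\<sigma> ^^ Suc n) v = (\<sigma> ^^ n) (\<sigma> v)" for n v by (simp add: funpow_swap1)
  have X\<sigma>: "\<sigma> v \<in> X" if "v \<in> X" for v
  proof -
    have all: "(\<sigma> ^^ n) v \<in> C" for n using that by (auto simp: X_def D_def)
    have "(\<sigma> ^^ n) (\<sigma> v) \<in> C" for n using all[of "Suc n"] step by metis
    moreover have "\<sigma> v \<in> C" using all[of 1] by simp
    ultimately show ?thesis by (auto simp: X_def D_def)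
  qed
  have XV: "X \<subseteq> V" using CV by (auto simp: X_def)
  \<comment> \<open>The points of \<open>X\<close> not fixed by the second iterate form a set that
    is mapped into itself, hence onto itself, as \<open>only2\<close> requires.\<close>
  have two: "\<sigma> (\<sigma> v) = v" if v: "v \<in> X" for v
  proof (rule ccontr)
    assume ne: "\<sigma> (\<sigma> v) \<noteq> v"
    define S where "S = {v \<in> X. \<sigma> (\<sigma> v) \<noteq> v}"
    have sub: "\<sigma> ` S \<subseteq> S"
    proof
      fix w assume "w \<in> \<sigma> ` S"
      then obtain u where u: "u \<in> X" "\<sigma> (\<sigma> u) \<noteq> u" "w = \<sigma> u" by (auto simp: S_def)
      have "\<sigma> (\<sigma> u) \<in> V" "u \<in> V" using X\<sigma> u(1) XV by auto
      then have "\<sigma> (\<sigma> (\<sigma> u)) \<noteq> \<sigma> u" using inj_onD[OF \<sigma>(1)] u(2) by blast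
      then show "w \<in> S" using X\<sigma>[OF u(1)] u(3) by (simp add: S_def)
    qed
    have "inj_on \<sigma> S" using XV by (intro inj_on_subset[OF \<sigma>(1)]) (auto simp: S_def)
    moreover have "finite S" using fin by (rule finite_subset[rotated]) (auto simp: S_def X_def)
    ultimately have "\<sigma> ` S = S" using sub by (intro endo_inj_surj)
    then have "S = {}" by (rule only2[rotated]) (auto simp: S_def X_def)
    then show False using v ne by (auto simp: S_def)
  qed
  have "\<exists>L\<subseteq>X. \<forall>v\<in>X. (\<sigma> v \<in> L \<longleftrightarrow> v \<notin> L) \<and> (\<sigma> v \<in> L \<longleftrightarrow> v \<notin> L)"
    by (rule two_colouring) (use fin X\<sigma> two nofix in \<open>auto simp: X_def\<close>)
  then obtain L where L: "L \<subseteq> X" "\<And>v. v \<in> X \<Longrightarrow> \<sigma> v \<in> L \<longleftrightarrow> v \<notin> L" by blast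
  \<comment> \<open>Points outside \<open>C\<close> have \<open>d\<close> equal to 0, which is even
    and agrees with \<open>R \<subseteq> C\<close>; so the last point before the exit belongs to
    \<open>R\<close>.\<close>
  define R where "R = {v \<in> D. odd (d v)} \<union> L"
  have "v \<in> R \<longleftrightarrow> \<sigma> v \<notin> R" if v: "v \<in> C" for v
  proof (cases "v \<in> D")
    case True
    then obtain n where n: "(\<sigma> ^^ n) v \<notin> C" by (auto simp: D_def)
    have dS: "d v = Suc (d (\<sigma> v))"
      unfolding d_def using Least_Suc[of "\<lambda>n. (\<sigma> ^^ n) v \<notin> C", OF n] v by (simp add: funpow_swap1)
    have vR: "v \<in> R \<longleftrightarrow> odd (d v)" using True L(1) by (auto simp: R_def X_def)
    show ?thesis
    proof (cases "\<sigma> v \<in> C")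
      case True
      obtain m where "n = Suc m" using n v by (cases n) auto
      then have "(\<sigma> ^^ m) (\<sigma> v) \<notin> C" using n step by metis
      then have "\<sigma> v \<in> D" using True by (auto simp: D_def)
      then have "\<sigma> v \<in> R \<longleftrightarrow> odd (d (\<sigma> v))" using L(1) by (auto simp: R_def X_def)
      then show ?thesis using vR dS by simp
    next
      case False
      then have "d (\<sigma> v) = 0" unfolding d_def by (intro Least_eq_0) simp
      moreover have "\<sigma> v \<notin> R" using False L(1) by (auto simp: R_def X_def D_def)
      ultimately show ?thesis using vR dS by simp
    qed
  next
    case False
    then have vX: "v \<in> X" "\<sigma> v \<in> X" using v X\<sigma> by (auto simp: X_def)
    then show ?thesis using L(2)[OF vX(1)] by (auto simp: R_def X_def)
  qed
  moreover have "R \<subseteq> C" using L(1) by (auto simp: R_def X_def D_def)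
  ultimately show ?thesis by blast
qed

section \<open>Path systems and two-factors\<close>

context girth_graph
begin

definition arcs :: "('a \<Rightarrow> 'a) \<Rightarrow> 'a set set" where
  "arcs f = (\<lambda>v. {v, f v}) ` V"

text \<open>A two-factor with a direction on each of its cycles. Injectivity on arcs forbids
  \<open>f (f v) = v\<close>, where a cycle would degenerate to a single edge, and makes the number
  of arcs equal to \<open>card V\<close>.\<close>

definition factor :: "('a \<Rightarrow> 'a) \<Rightarrow> bool" where
  "factor f \<longleftrightarrow> bij_betw f V V \<and> inj_on (\<lambda>v. {v, f v}) V \<and> arcs f \<subseteq> E"

text \<open>Paths are again stored from both ends. The number of edges in $A$ forces distinct paths to be edge-disjoint.\<close>

definition psys :: "'a set set \<Rightarrow> nat \<Rightarrow> ('a \<Rightarrow> 'a list) \<Rightarrow> bool" where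
  "psys A m P \<longleftrightarrow> (\<forall>v\<in>V. length (P v) = m \<and> distinct (P v) \<and> hd (P v) = v \<and> last (P v) \<in> V \<and>
      P (last (P v)) = rev (P v) \<and> walk_edges (P v) \<subseteq> A) \<and>
    A \<subseteq> (\<Union>v\<in>V. walk_edges (P v)) \<and> 2 * card A = (m - 1) * card V"

lemma psysD:
  assumes "psys A m P" "v \<in> V" "m \<ge> 2"
  shows "length (P v) = m" "distinct (P v)" "hd (P v) = v" "last (P v) \<in> V" "P (last (P v)) = rev (P v)"
    "walk_edges (P v) \<subseteq> A" "P v \<noteq> []" "last (P (last (P v))) = v" "last (P v) \<noteq> v"
proof -
  show *: "length (P v) = m" "distinct (P v)" "hd (P v) = v" "last (P v) \<in> V" "P (last (P v)) = rev (P v)"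
    "walk_edges (P v) \<subseteq> A" using assms by (auto simp: psys_def)
  show ne: "P v \<noteq> []" using * assms(3) by auto
  then show "last (P (last (P v))) = v" using * by (simp add: last_rev)
  obtain x xs where x: "P v = x # xs" using ne by (meson list.exhaust)
  then have "xs \<noteq> []" using * assms(3) by auto
  then have "last (P v) \<in> set xs" using x by simp
  then show "last (P v) \<noteq> v" using x * by auto
qed

text \<open>Double counting of pairs of an edge and a stored path containing it. Every edge of
  \<open>A\<close> occurs at least twice, on a path and on its reverse, and by the equation for
  \<open>card A\<close> the average is exactly two.\<close>

lemma psys_disjoint:
  assumes P: "psys A m P" "m \<ge> 2" "A \<subseteq> E" and uv: "u \<in> V" "v \<in> V"
    and e: "e \<in> walk_edges (P u)" "e \<in> walk_edges (P v)"
  shows "u = v \<or> u = last (P v)"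
proof -
  define N where "N e = {v \<in> V. e \<in> walk_edges (P v)}" for e
  have finA: "finite A" using P(3) finite_E finite_subset by auto
  have fN: "finite (N e)" for e using finite_V by (simp add: N_def)
  have two: "{v, last (P v)} \<subseteq> N e" "card {v, last (P v)} = 2" if "v \<in> V" "e \<in> walk_edges (P v)" for e v
  proof -
    note D = psysD[OF P(1) that(1) P(2)]
    have "e \<in> walk_edges (P (last (P v)))" using that(2) D(5) by simp
    then show "{v, last (P v)} \<subseteq> N e" using that D(4) by (auto simp: N_def)
    show "card {v, last (P v)} = 2" using D(9) by auto
  qed
  have ge: "card (N e) \<ge> 2" if eA: "e \<in> A" for e
  proof -
    have "A \<subseteq> (\<Union>v\<in>V. walk_edges (P v))" using P(1) by (simp add: psys_def)
    then obtain v where "v \<in> V" "e \<in> walk_edges (P v)" using eA by blast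
    then show ?thesis using two[of v e] card_mono[OF fN] by metis
  qed
  have "(\<Sum>e\<in>A. card (N e)) = (\<Sum>e\<in>A. \<Sum>v\<in>V. if e \<in> walk_edges (P v) then 1 else 0)"
    unfolding N_def card_eq_sum sum.inter_filter[OF finite_V] ..
  also have "\<dots> = (\<Sum>v\<in>V. \<Sum>e\<in>A. if e \<in> walk_edges (P v) then 1 else 0)" by (rule sum.swap)
  also have "\<dots> = (\<Sum>v\<in>V. m - 1)"
  proof (rule sum.cong[OF refl])
    fix v assume v: "v \<in> V"
    note D = psysD[OF P(1) v P(2)]
    have "{e \<in> A. e \<in> walk_edges (P v)} = walk_edges (P v)" using D(6) by blast
    then have "(\<Sum>e\<in>A. if e \<in> walk_edges (P v) then 1 else 0::nat) = card (walk_edges (P v))"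
      using sum.inter_filter[OF finA, of "\<lambda>_. 1::nat" "\<lambda>e. e \<in> walk_edges (P v)"] by simp
    then show "(\<Sum>e\<in>A. if e \<in> walk_edges (P v) then 1 else 0) = m - 1"
      using card_walk_edges[OF D(2)] D(1) by simp
  qed
  also have "\<dots> = (\<Sum>e\<in>A. 2)" using P(1) by (simp add: psys_def mult.commute)
  finally have sums: "(\<Sum>e\<in>A. card (N e)) = (\<Sum>e\<in>A. 2)" .
  have "e \<in> A" using e psysD(6)[OF P(1) uv(1) P(2)] by auto
  have "card (N e) = 2"
  proof (rule ccontr)
    assume "card (N e) \<noteq> 2"
    then have "2 < card (N e)" using ge[OF \<open>e \<in> A\<close>] by simp
    then have "(\<Sum>e\<in>A. 2) < (\<Sum>e\<in>A. card (N e))"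
      using finA ge \<open>e \<in> A\<close> by (intro sum_strict_mono_ex1) auto
    then show False using sums by simp
  qed
  then have "N e = {v, last (P v)}" using two[OF uv(2) e(2)] card_subset_eq[OF fN] by metis
  then show ?thesis using uv(1) e(1) by (auto simp: N_def)
qed

lemma psys_slots:
  assumes P: "psys A (2 * k) P" "A \<subseteq> E"
  shows "slots V P" "path_edges V P = A"
proof -
  have k2: "2 * k \<ge> 2" using k3 by simp
  show "slots V P"
    unfolding slots_def using psysD[OF P(1) _ k2] P(2) psys_disjoint[OF P(1) k2 P(2)] finite_V by fast
  show "path_edges V P = A" using P(1) by (auto simp: psys_def path_edges_def)
qed

text \<open>An edge from the first vertex back to the path, other than the first edge of the path,
  closes a cycle. Unless it goes to the last vertex, this cycle misses that vertex and has length at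
  most 2k - 3.\<close>

lemma end_not_in_path:
  assumes q: "distinct q" "2 \<le> length q" "length q \<le> 2 * k - 2" "walk_edges q \<subseteq> E"
    and x: "{x, hd q} \<in> E" "{x, hd q} \<notin> walk_edges q" "x \<noteq> last q"
  shows "x \<notin> set q"
proof
  assume "x \<in> set q"
  then obtain j where j: "j < length q" "x = q ! j" by (auto simp: in_set_conv_nth)
  have ne: "q \<noteq> []" using q(2) by auto
  have h: "hd q = q ! 0" using ne by (simp add: hd_conv_nth)
  have "j \<noteq> 0" using edge_neq[OF x(1)] j h by metis
  have "j \<noteq> 1"
  proof
    assume "j = 1"
    then have "Suc 0 < length q" "{x, hd q} = {q ! 0, q ! Suc 0}" using j h q(2) by (auto simp: insert_commute)
    then have "{x, hd q} \<in> walk_edges q" unfolding walk_edges_def by blast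
    then show False using x(2) by simp
  qed
  have "j \<noteq> length q - 1" using x(3) j ne by (auto simp: last_conv_nth)
  then have "j + 1 \<ge> 2 * k - 2"
    using chord_distance[of 0 j q] \<open>j \<noteq> 0\<close> \<open>j \<noteq> 1\<close> j q x(1) h by (simp add: insert_commute)
  then show False using j \<open>j \<noteq> length q - 1\<close> q(3) by linarith
qed

lemma extended_path_distinct:
  assumes q: "distinct q" "2 \<le> length q" "length q \<le> 2 * k - 2" "walk_edges q \<subseteq> E"
    and x: "{x, hd q} \<in> E" "{x, hd q} \<notin> walk_edges q" "x \<noteq> last q"
    and y: "{y, last q} \<in> E" "{y, last q} \<notin> walk_edges q" "y \<noteq> hd q" and xy: "x \<noteq> y"
  shows "distinct (x # q @ [y])"
proof -
  have ne: "q \<noteq> []" using q(2) by auto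
  have "x \<notin> set q" by (rule end_not_in_path[OF q x])
  moreover have "y \<notin> set (rev q)"
    by (rule end_not_in_path) (use q y ne in \<open>auto simp: hd_rev last_rev\<close>)
  ultimately show ?thesis using q(1) xy by simp
qed

lemma arcs_card: "factor f \<Longrightarrow> card (arcs f) = card V"
  unfolding factor_def arcs_def by (simp add: card_image)

lemma walk_edges_both_ends:
  assumes "q \<noteq> []"
  shows "walk_edges (x # q @ [y]) = insert {x, hd q} (insert {y, last q} (walk_edges q))"
proof -
  have "walk_edges (q @ [y]) = insert {last q, y} (walk_edges q)" using walk_edges_append[of q "[y]"] assms by simp
  moreover have "walk_edges (x # q @ [y]) = insert {x, hd q} (walk_edges (q @ [y]))"
    using walk_edges_append[of "[x]" "q @ [y]"] assms by simp
  ultimately show ?thesis by (simp add: insert_commute)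
qed

text \<open>Both ends are prolonged by the arcs that leave them. As each vertex is an end of exactly
  one path, each arc is used once, and the heads of the arcs are again all vertices. Hence the entry
  of \<open>v\<close> comes from the path that started at its preimage.\<close>

definition extend :: "('a \<Rightarrow> 'a) \<Rightarrow> ('a \<Rightarrow> 'a list) \<Rightarrow> 'a \<Rightarrow> 'a list" where
  "extend f P v = v # P (inv_into V f v) @ [f (last (P (inv_into V f v)))]"

lemma factorD:
  assumes "factor f"
  shows "v \<in> V \<Longrightarrow> f v \<in> V" "v \<in> V \<Longrightarrow> inv_into V f (f v) = v" "v \<in> V \<Longrightarrow> f (inv_into V f v) = v"
    "v \<in> V \<Longrightarrow> inv_into V f v \<in> V" "u \<in> V \<Longrightarrow> v \<in> V \<Longrightarrow> f u = f v \<longleftrightarrow> u = v"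
    "u \<in> V \<Longrightarrow> v \<in> V \<Longrightarrow> {u, f u} = {v, f v} \<longleftrightarrow> u = v" "v \<in> V \<Longrightarrow> {v, f v} \<in> E" "v \<in> V \<Longrightarrow> f v \<noteq> v"
    "v \<in> V \<Longrightarrow> f (f v) \<noteq> v"
proof -
  have b: "bij_betw f V V" and i: "inj_on (\<lambda>v. {v, f v}) V" and a: "arcs f \<subseteq> E" using assms by (auto simp: factor_def)
  show fV: "v \<in> V \<Longrightarrow> f v \<in> V" for v using b bij_betwE by blast
  show "v \<in> V \<Longrightarrow> inv_into V f (f v) = v" using bij_betw_inv_into_left[OF b] by simp
  show "v \<in> V \<Longrightarrow> f (inv_into V f v) = v" using bij_betw_inv_into_right[OF b] by simp
  show "v \<in> V \<Longrightarrow> inv_into V f v \<in> V" using bij_betw_inv_into[OF b] bij_betwE by blast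
  show "u \<in> V \<Longrightarrow> v \<in> V \<Longrightarrow> f u = f v \<longleftrightarrow> u = v" using b by (auto simp: bij_betw_def inj_on_def)
  show e: "u \<in> V \<Longrightarrow> v \<in> V \<Longrightarrow> {u, f u} = {v, f v} \<longleftrightarrow> u = v" for u v
    by (rule inj_on_eq_iff[OF i])
  show E: "v \<in> V \<Longrightarrow> {v, f v} \<in> E" for v using a by (auto simp: arcs_def)
  show "v \<in> V \<Longrightarrow> f v \<noteq> v" using E edge_neq by metis
  show "f (f v) \<noteq> v" if "v \<in> V"
  proof
    assume "f (f v) = v"
    then have "{v, f v} = {f v, f (f v)}" by (simp add: insert_commute)
    then show False using e[OF that fV[OF that]] edge_neq[OF E[OF that]] by simp
  qed
qed

lemma psys_extend:
  assumes P: "psys A m P" "m \<ge> 2" "m + 2 \<le> 2 * k - 2" "A \<subseteq> E" and f: "factor f" "arcs f \<inter> A = {}"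
  shows "psys (A \<union> arcs f) (m + 2) (extend f P)"
proof -
  note F = factorD[OF f(1)]
  let ?i = "inv_into V f"
  have finA: "finite A" using P(4) finite_E finite_subset by auto
  have arc: "{v, f v} \<in> arcs f" if "v \<in> V" for v using that by (simp add: arcs_def)
  have main: "length (extend f P v) = m + 2 \<and> distinct (extend f P v) \<and> hd (extend f P v) = v \<and>
      last (extend f P v) \<in> V \<and> extend f P (last (extend f P v)) = rev (extend f P v) \<and>
      walk_edges (extend f P v) = insert {?i v, f (?i v)} (insert {last (P (?i v)), f (last (P (?i v)))} (walk_edges (P (?i v))))"
    if v: "v \<in> V" for v
  proof -
    define y where "y = ?i v"
    have y: "y \<in> V" "f y = v" using F(3,4) v by (auto simp: y_def)
    note D = psysD[OF P(1) y(1) P(2)]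
    let ?t = "last (P y)"
    have e: "extend f P v = v # P y @ [f ?t]" by (simp add: extend_def y_def)
    have qE: "walk_edges (P y) \<subseteq> E" using D(6) P(4) by auto
    have notin: "{u, f u} \<notin> walk_edges (P y)" if "u \<in> V" for u using arc[OF that] f(2) D(6) by auto
    \<comment> \<open>An arc between the two ends would close a cycle with at most 2k - 4 vertices;
      for m = 2 it would be the edge of the path itself, which lies in \<open>A\<close>.\<close>
    have noend: "f u \<noteq> w" if "u = y \<and> w = ?t \<or> u = ?t \<and> w = y" for u w
    proof
      assume fu: "f u = w"
      have u: "u \<in> V" using that y D(4) by auto
      have edge: "{?t, y} \<in> E" "{?t, y} \<notin> walk_edges (P y)" using F(7)[OF u] notin[OF u] fu that by (auto simp: insert_commute)
      obtain q1 q2 where q: "P y = q1 # q2" using D(7) by (meson list.exhaust)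
      show False
      proof (cases "length (P y) \<ge> 3")
        case True
        then show False using cycle_length[OF D(2) True qE] edge D(1,3) P(3) by simp
      next
        case False
        then have "length (P y) = 2" using D(1) P(2) by simp
        then obtain a b where "P y = [a, b]" by (auto simp: numeral_2_eq_2 length_Suc_conv)
        then show False using edge D(3) by (auto simp: insert_commute)
      qed
    qed
    have "distinct (v # P y @ [f ?t])"
    proof (rule extended_path_distinct)
      show "{v, hd (P y)} \<in> E" "{v, hd (P y)} \<notin> walk_edges (P y)"
        using F(7)[OF y(1)] notin[OF y(1)] y(2) D(3) by (auto simp: insert_commute)
      show "{f ?t, last (P y)} \<in> E" "{f ?t, last (P y)} \<notin> walk_edges (P y)"
        using F(7)[OF D(4)] notin[OF D(4)] by (auto simp: insert_commute)
      show "v \<noteq> last (P y)" "f ?t \<noteq> hd (P y)" using noend y(2) D(3) by auto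
      show "v \<noteq> f ?t" using F(5)[OF y(1) D(4)] y(2) D(9) by auto
    qed (use D qE P in auto)
    moreover have "last (extend f P v) = f ?t" unfolding e by simp
    moreover have "f ?t \<in> V" using F(1) D(4) by auto
    moreover have "extend f P (f ?t) = rev (extend f P v)"
      unfolding e using D(4,5,8) y F(2) by (simp add: extend_def)
    moreover have "walk_edges (extend f P v) = insert {y, f y} (insert {?t, f ?t} (walk_edges (P y)))"
      unfolding e walk_edges_both_ends[OF D(7)] D(3) y(2) by (simp add: insert_commute)
    ultimately show ?thesis unfolding y_def[symmetric] using e D(1) by simp
  qed
  have sub: "walk_edges (extend f P v) \<subseteq> A \<union> arcs f" if v: "v \<in> V" for v
    using main[OF v] psysD[OF P(1) F(4)[OF v] P(2)] arc[of "?i v"] arc[of "last (P (?i v))"] F(4)[OF v] by auto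
  have cov: "A \<union> arcs f \<subseteq> (\<Union>v\<in>V. walk_edges (extend f P v))"
  proof
    fix e assume "e \<in> A \<union> arcs f"
    then have "\<exists>y\<in>V. e \<in> walk_edges (P y) \<or> e = {y, f y}" using P(1) by (auto simp: psys_def arcs_def)
    then obtain y where y: "y \<in> V" "e \<in> walk_edges (P y) \<or> e = {y, f y}" by blast
    then have "e \<in> walk_edges (extend f P (f y))" using main[OF F(1)[OF y(1)]] F(2)[OF y(1)] by auto
    then show "e \<in> (\<Union>v\<in>V. walk_edges (extend f P v))" using F(1) y(1) by blast
  qed
  have "card (A \<union> arcs f) = card A + card V"
    using card_Un_disjoint[of A "arcs f"] finA f arcs_card finite_V by (auto simp: arcs_def)
  moreover have "2 * card A = (m - 1) * card V" using P(1) by (simp add: psys_def)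
  ultimately have "2 * card (A \<union> arcs f) = (m + 2 - 1) * card V"
    using P(2) by (cases m) (auto simp: algebra_simps)
  then show ?thesis unfolding psys_def using main sub cov by blast
qed

lemma psys_extend_list:
  "psys A m P \<Longrightarrow> m \<ge> 2 \<Longrightarrow> m + 2 * length fs \<le> 2 * k - 2 \<Longrightarrow> A \<subseteq> E \<Longrightarrow> \<forall>f\<in>set fs. factor f \<and> arcs f \<inter> A = {} \<Longrightarrow>
   sorted_wrt (\<lambda>f g. arcs f \<inter> arcs g = {}) fs \<Longrightarrow> \<exists>P. psys (A \<union> \<Union>(arcs ` set fs)) (m + 2 * length fs) P"
proof (induction fs arbitrary: A m P)
  case (Cons f fs)
  have "psys (A \<union> arcs f) (m + 2) (extend f P)" by (rule psys_extend) (use Cons.prems in auto)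
  then have "\<exists>P. psys ((A \<union> arcs f) \<union> \<Union>(arcs ` set fs)) ((m + 2) + 2 * length fs) P"
    by (rule Cons.IH) (use Cons.prems in \<open>auto simp: factor_def\<close>)
  then show ?case by (simp add: Un_assoc)
qed auto

end

section \<open>The last two factors\<close>

text \<open>\<open>J\<close> holds the paths before the last two two-factors are added,
  \<open>A\<close> their edges, and \<open>B\<close> the edges of these two factors. Fixing only
  \<open>B\<close> leaves its division into factors, and the directions of their cycles, free to
  vary.\<close>

locale last_factors = girth_graph +
  fixes A B :: "'a set set" and J :: "'a \<Rightarrow> 'a list"
  assumes J: "psys A (2 * k - 4) J" and AE: "A \<subseteq> E" and AB: "A \<inter> B = {}"
begin

definition config :: "('a \<Rightarrow> 'a) \<Rightarrow> ('a \<Rightarrow> 'a) \<Rightarrow> bool" where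
  "config g h \<longleftrightarrow> factor g \<and> factor h \<and> arcs g \<inter> arcs h = {} \<and> arcs g \<union> arcs h = B"

definition opp :: "('a \<Rightarrow> 'a) \<Rightarrow> 'a \<Rightarrow> 'a" where
  "opp g v = g (last (J (inv_into V g v)))"

text \<open>The path of $v$ prolonged by $g$ runs from $v$ to its opposite end; at a closed vertex the arc of $h$ joins
  these two ends, so that prolonging by $h$ gives no path.\<close>

definition closed :: "('a \<Rightarrow> 'a) \<Rightarrow> ('a \<Rightarrow> 'a) \<Rightarrow> 'a set" where
  "closed g h = {v \<in> V. h v = opp g v}"

text \<open>The vertex whose arc in \<open>h\<close> has the same head as the arc of
  \<open>v\<close> in \<open>g\<close>. On a set invariant under this map the arcs of
  \<open>g\<close> and \<open>h\<close> can be exchanged so that both stay permutations.\<close>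

definition shift :: "('a \<Rightarrow> 'a) \<Rightarrow> ('a \<Rightarrow> 'a) \<Rightarrow> 'a \<Rightarrow> 'a" where
  "shift g h v = inv_into V h (g v)"

lemma JD:
  assumes "v \<in> V"
  shows "length (J v) = 2 * k - 4" "distinct (J v)" "hd (J v) = v" "last (J v) \<in> V" "J (last (J v)) = rev (J v)"
    "walk_edges (J v) \<subseteq> A" "J v \<noteq> []" "last (J (last (J v))) = v" "last (J v) \<noteq> v"
  using psysD[OF J assms] k3 by auto

lemma arcs_mem: "v \<in> V \<Longrightarrow> {v, f v} \<in> arcs f"
  by (simp add: arcs_def)

context
  fixes g h assumes c: "config g h"
begin

lemma fg: "factor g" and fh: "factor h"
  using c by (auto simp: config_def)

lemmas G = factorD[OF fg] and H = factorD[OF fh]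

lemma g_h_arc: "u \<in> V \<Longrightarrow> v \<in> V \<Longrightarrow> {u, g u} \<noteq> {v, h v}"
  using c arcs_mem[of u g] arcs_mem[of v h] by (auto simp: config_def)

lemma arc_notin_A: "u \<in> V \<Longrightarrow> {u, g u} \<notin> A" "u \<in> V \<Longrightarrow> {u, h u} \<notin> A"
  using c AB arcs_mem[of u g] arcs_mem[of u h] by (auto simp: config_def)

lemma arc_in_B: "u \<in> V \<Longrightarrow> {u, g u} \<in> B" "u \<in> V \<Longrightarrow> {u, h u} \<in> B"
  using c arcs_mem[of u g] arcs_mem[of u h] by (auto simp: config_def)

lemma g_neq_h: "v \<in> V \<Longrightarrow> g v \<noteq> h v"
  using g_h_arc[of v v] by auto

lemma gh_neq: "v \<in> V \<Longrightarrow> g (h v) \<noteq> v" "v \<in> V \<Longrightarrow> h (g v) \<noteq> v"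
  using g_h_arc[of "h v" v] g_h_arc[of v "g v"] G(1) H(1) by (metis insert_commute)+

lemma inner_psys: "psys (A \<union> arcs g) (2 * k - 2) (extend g J)"
proof -
  have "psys (A \<union> arcs g) (2 * k - 4 + 2) (extend g J)"
    by (rule psys_extend[OF J]) (use k3 AE fg c AB in \<open>auto simp: config_def\<close>)
  moreover have "2 * k - 4 + 2 = 2 * k - 2" using k3 by simp
  ultimately show ?thesis by simp
qed

lemma opp_g: "y \<in> V \<Longrightarrow> opp g (g y) = g (last (J y))"
  by (simp add: opp_def G(2))

lemma opp: assumes "v \<in> V" shows "opp g v \<in> V" "opp g (opp g v) = v" "opp g v \<noteq> v"
proof -
  have l: "last (extend g J v) = opp g v" for v by (simp add: extend_def opp_def)
  have "2 * k - 2 \<ge> 2" using k3 by simp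
  then show "opp g v \<in> V" "opp g (opp g v) = v" "opp g v \<noteq> v"
    using psysD(4,8,9)[OF inner_psys assms] by (auto simp: l)
qed

lemma shift: assumes "v \<in> V" shows "shift g h v \<in> V" "h (shift g h v) = g v" "shift g h v \<noteq> v"
proof -
  show "shift g h v \<in> V" unfolding shift_def by (rule H(4)[OF G(1)[OF assms]])
  show *: "h (shift g h v) = g v" unfolding shift_def by (rule H(3)[OF G(1)[OF assms]])
  then show "shift g h v \<noteq> v" using g_neq_h[OF assms] by auto
qed

lemma shift_inj: "u \<in> V \<Longrightarrow> v \<in> V \<Longrightarrow> shift g h u = shift g h v \<longleftrightarrow> u = v"
  using shift(2)[of u] shift(2)[of v] G(5) by metis

text \<open>At a closed vertex \<open>v\<close> the arc of \<open>h\<close> and the arc of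
  \<open>g\<close> at the other inner end of its path have the same head, so that inner end is the
  preimage of \<open>v\<close> under \<open>shift\<close>.\<close>

lemma closed_shift: assumes "v \<in> closed g h"
  shows "last (J (inv_into V g v)) \<in> V" "shift g h (last (J (inv_into V g v))) = v"
    "g (last (J (inv_into V g v))) = h v"
proof -
  have v: "v \<in> V" "h v = opp g v" using assms by (auto simp: closed_def)
  show *: "last (J (inv_into V g v)) \<in> V" by (rule JD(4)[OF G(4)[OF v(1)]])
  show e: "g (last (J (inv_into V g v))) = h v" using v(2) by (simp add: opp_def)
  show "shift g h (last (J (inv_into V g v))) = v" unfolding shift_def e by (rule H(2)[OF v(1)])
qed

text \<open>If both were closed, \<open>v\<close> and \<open>h v\<close> would form a cycle of
  \<open>h\<close> of length two.\<close>

lemma head_not_closed: assumes "v \<in> closed g h" shows "h v \<notin> closed g h"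
proof
  have v: "v \<in> V" "h v = opp g v" using assms by (auto simp: closed_def)
  assume "h v \<in> closed g h"
  then have "h (h v) = opp g (opp g v)" using v by (simp add: closed_def)
  then show False using opp(2)[OF v(1)] H(9)[OF v(1)] by simp
qed

end

section \<open>Exchanging and reversing arcs of the last two factors\<close>

lemma factorI:
  assumes "\<And>v. v \<in> V \<Longrightarrow> f v \<in> V" "inj_on f V" "inj_on (\<lambda>v. {v, f v}) V" "arcs f \<subseteq> E"
  shows "factor f"
  unfolding factor_def bij_betw_def using assms endo_inj_surj[OF finite_V] by (metis image_subsetI)

text \<open>By invariance \<open>g\<close> and \<open>h\<close> map \<open>S\<close> onto the same
  set, so the exchange keeps both permutations. New opposite ends or new arcs of \<open>h\<close>
  occur only at \<open>S\<close> and at the heads of the exchanged arcs. A vertex of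
  \<open>S\<close> could stay closed only on an orbit of \<open>shift\<close> of length two; the
  head \<open>h u\<close> receives \<open>shift g h u\<close> as its opposite end.\<close>

lemma flip:
  assumes c: "config g h" and S: "S \<subseteq> closed g h" "shift g h ` S = S"
    and no2: "\<And>v. v \<in> S \<Longrightarrow> shift g h (shift g h v) \<noteq> v"
  defines "g' \<equiv> \<lambda>v. if v \<in> S then h v else g v" and "h' \<equiv> \<lambda>v. if v \<in> S then g v else h v"
  shows "config g' h'" "closed g' h' \<subseteq> (closed g h - S) \<union> h ` {u \<in> S. h (h u) = shift g h u}"
proof -
  note G = G[OF c] and H = H[OF c]
  have SV: "S \<subseteq> V" using S(1) by (auto simp: closed_def)
  have gS: "g ` S = h ` S"
  proof -
    have "g ` S = (\<lambda>v. h (shift g h v)) ` S" using shift(2)[OF c] SV by (intro image_cong) auto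
    also have "\<dots> = h ` (shift g h ` S)" by (simp add: image_image)
    finally show ?thesis using S(2) by simp
  qed
  have hW: "g u \<in> h ` S \<longleftrightarrow> u \<in> S" if "u \<in> V" for u using gS G(5) that SV by (metis image_iff subsetD)
  have gW: "h u \<in> h ` S \<longleftrightarrow> u \<in> S" if "u \<in> V" for u using H(5) that SV by (metis image_iff subsetD)
  have "inj_on g' V"
    by (rule inj_onI) (metis G(5) H(5) hW gW g'_def)
  moreover have "inj_on h' V"
    by (rule inj_onI) (metis G(5) H(5) hW gW h'_def)
  moreover have "inj_on (\<lambda>v. {v, g' v}) V"
    by (rule inj_onI) (metis G(6) H(6) g_h_arc[OF c] g'_def)
  moreover have "inj_on (\<lambda>v. {v, h' v}) V"
    by (rule inj_onI) (metis G(6) H(6) g_h_arc[OF c] h'_def)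
  moreover have arcsB: "arcs g' \<union> arcs h' = B"
  proof -
    have un: "arcs f \<union> arcs f' = (\<Union>v\<in>V. {{v, f v}, {v, f' v}})" for f f' by (auto simp: arcs_def)
    have "{{v, g' v}, {v, h' v}} = {{v, g v}, {v, h v}}" for v by (auto simp: g'_def h'_def)
    then have "arcs g' \<union> arcs h' = arcs g \<union> arcs h" unfolding un by simp
    then show ?thesis using c by (simp add: config_def)
  qed
  moreover have "B \<subseteq> E" using c by (auto simp: config_def factor_def)
  ultimately have fac: "factor g'" "factor h'"
    using G(1) H(1) by (auto intro!: factorI simp: g'_def h'_def)
  have "arcs g' \<inter> arcs h' = {}"
  proof (rule ccontr)
    assume "arcs g' \<inter> arcs h' \<noteq> {}"
    then obtain u v where uv: "u \<in> V" "v \<in> V" "{u, g' u} = {v, h' v}" by (auto simp: arcs_def)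
    show False
      using uv G(6)[OF uv(1,2)] H(6)[OF uv(1,2)] g_h_arc[OF c uv(1,2)] g_h_arc[OF c uv(2,1)]
      unfolding g'_def h'_def by (cases "u \<in> S"; cases "v \<in> S"; simp)
  qed
  then show cfg: "config g' h'" using fac arcsB by (simp add: config_def)
  have WC: "h ` S \<inter> closed g h = {}" using head_not_closed[OF c] S(1) by auto
  have yS: "inv_into V g v \<notin> S" if v: "v \<in> V" "v \<notin> h ` S" for v
    using hW[OF G(4)[OF v(1)]] G(3)[OF v(1)] v(2) by auto
  have opp': "opp g' (g' y) = g' (last (J y))" if "y \<in> V" for y by (rule opp_g[OF cfg that])
  show "closed g' h' \<subseteq> (closed g h - S) \<union> h ` {u \<in> S. h (h u) = shift g h u}"
  proof
    fix v assume "v \<in> closed g' h'"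
    then have v: "v \<in> V" "h' v = opp g' v" by (auto simp: closed_def)
    consider (tail) "v \<in> S" | (head) "v \<in> h ` S" | (other) "v \<notin> S" "v \<notin> h ` S" by blast
    then show "v \<in> (closed g h - S) \<union> h ` {u \<in> S. h (h u) = shift g h u}"
    proof cases
      case tail
      define y where "y = inv_into V g v"
      define x where "x = last (J y)"
      have vc: "v \<in> closed g h" using tail S(1) by auto
      then have "v \<notin> h ` S" using WC by auto
      then have y: "y \<notin> S" "y \<in> V" "g y = v" using yS v(1) G(3,4) by (auto simp: y_def)
      have x: "x \<in> V" "shift g h x = v" using closed_shift[OF c vc] by (auto simp: x_def y_def)
      obtain x' where "x' \<in> S" "shift g h x' = v" using S(2) tail by (metis image_iff)
      then have xS: "x \<in> S" using shift_inj[OF c x(1)] x(2) SV by auto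
      have "opp g' v = h x" using opp'[OF y(2)] y xS by (simp add: g'_def x_def)
      moreover have "h' v = h (shift g h v)" using tail shift(2)[OF c v(1)] by (simp add: h'_def)
      ultimately have "shift g h v = x" using v H(5) shift(1)[OF c v(1)] x(1) by simp
      then show ?thesis using no2[OF tail] x(2) by (simp add: no2)
    next
      case head
      then obtain u where u: "u \<in> S" "v = h u" by auto
      then have uV: "u \<in> V" using SV by auto
      define s where "s = shift g h u"
      have s: "s \<in> S" "s \<in> V" using S(2) u SV by (auto simp: s_def)
      define y where "y = inv_into V g s"
      have "s \<notin> h ` S" using WC s S(1) by auto
      then have y: "y \<notin> S" "y \<in> V" "g y = s" using yS s G(3,4) by (auto simp: y_def)
      have sc: "s \<in> closed g h" using s S(1) by auto
      have "last (J y) = u"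
        using closed_shift[OF c sc] shift_inj[OF c _ uV] s_def y_def by metis
      then have "last (J u) = y" using JD(8)[OF y(2)] by simp
      then have "opp g' v = s" using opp'[OF uV] u y by (simp add: g'_def)
      moreover have "v \<notin> S" using head WC S(1) by auto
      ultimately have "h (h u) = s" using v(2) u by (simp add: h'_def)
      then show ?thesis using u s_def by auto
    next
      case other
      define y where "y = inv_into V g v"
      have y: "y \<notin> S" "y \<in> V" "g y = v" using yS v(1) other G(3,4) by (auto simp: y_def)
      define x where "x = last (J y)"
      have xV: "x \<in> V" using JD(4)[OF y(2)] by (simp add: x_def)
      have "x \<notin> S"
      proof
        assume "x \<in> S"
        then have u: "shift g h x \<in> S" using S(2) by auto
        define z where "z = inv_into V g (shift g h x)"
        have "shift g h x \<in> closed g h" using u S(1) by auto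
        then have "last (J z) = x" using closed_shift[OF c, of "shift g h x"] shift_inj[OF c _ xV] z_def by metis
        then have "last (J x) = z" using JD(8)[of z] G(4) u SV z_def by auto
        moreover have "last (J x) = y" using JD(8)[OF y(2)] by (simp add: x_def)
        ultimately have "g y = shift g h x" using G(3) u SV z_def by auto
        then show False using other y u by simp
      qed
      then have "opp g' v = opp g v" using opp'[OF y(2)] opp_g[OF c y(2)] y by (simp add: g'_def x_def)
      then have "v \<in> closed g h" using v other by (simp add: closed_def h'_def)
      then show ?thesis using other by simp
    qed
  qed
qed

text \<open>Reversing whole cycles of \<open>h\<close> keeps its edges. A closed vertex of
  \<open>Z\<close> has its arc running to the opposite end; after the reversal the arc runs back, so
  the opposite end is closed in its place and the number stays the same.\<close>

lemma reverse:
  assumes c: "config g h" and Z: "Z \<subseteq> V" "h ` Z = Z"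
  defines "h' \<equiv> \<lambda>v. if v \<in> Z then inv_into V h v else h v"
  shows "config g h'" "closed g h' = (closed g h - Z) \<union> h ` (closed g h \<inter> Z)"
    "card (closed g h') = card (closed g h)"
proof -
  note G = G[OF c] and H = H[OF c]
  have hZ: "h v \<in> Z \<longleftrightarrow> v \<in> Z" if "v \<in> V" for v
    using Z H(5) that by (metis image_iff subsetD)
  have iZ: "inv_into V h v \<in> Z" if "v \<in> Z" for v using hZ[OF H(4)] H(3) that Z(1) by auto
  have arc_eq: "{v, h' v} = {u, h u}" if "u = (if v \<in> Z then inv_into V h v else v)" "v \<in> V" for u v
    using that H(3)[OF that(2)] by (auto simp: h'_def)
  define r where "r v = (if v \<in> Z then inv_into V h v else v)" for v
  have r: "r v \<in> V" "{v, h' v} = {r v, h (r v)}" if "v \<in> V" for v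
    using arc_eq[of "r v" v] that H(4) by (auto simp: r_def)
  have rinj: "u = v" if "u \<in> V" "v \<in> V" "r u = r v" for u v
    using that iZ H(3) unfolding r_def by (metis)
  have "inj_on h' V"
    by (rule inj_onI) (metis H(1,3,4,5) hZ iZ h'_def)
  moreover have "inj_on (\<lambda>v. {v, h' v}) V"
    by (rule inj_onI) (metis r H(6) rinj)
  moreover have arcs': "arcs h' = arcs h"
  proof
    show "arcs h' \<subseteq> arcs h" using r arcs_mem unfolding arcs_def by blast
    show "arcs h \<subseteq> arcs h'"
    proof
      fix e assume "e \<in> arcs h"
      then obtain u where u: "u \<in> V" "e = {u, h u}" by (auto simp: arcs_def)
      show "e \<in> arcs h'"
      proof (cases "u \<in> Z")
        case True
        then have "h' (h u) = u" using hZ[OF u(1)] H(2)[OF u(1)] by (simp add: h'_def)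
        then show ?thesis using u arcs_mem[OF H(1)[OF u(1)], of h'] by (simp add: insert_commute)
      next
        case False
        then show ?thesis using u arcs_mem[OF u(1), of h'] by (simp add: h'_def)
      qed
    qed
  qed
  moreover have "h' v \<in> V" if "v \<in> V" for v using H(1,4)[OF that] by (simp add: h'_def)
  moreover have "arcs h \<subseteq> E" using fh[OF c] by (simp add: factor_def)
  ultimately have "factor h'" using factorI[of h'] by metis
  then show "config g h'" using c arcs' by (simp add: config_def)
  show cl: "closed g h' = (closed g h - Z) \<union> h ` (closed g h \<inter> Z)"
  proof
    show "closed g h' \<subseteq> (closed g h - Z) \<union> h ` (closed g h \<inter> Z)"
    proof
      fix v assume "v \<in> closed g h'"
      then have v: "v \<in> V" "h' v = opp g v" by (auto simp: closed_def)
      show "v \<in> (closed g h - Z) \<union> h ` (closed g h \<inter> Z)"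
      proof (cases "v \<in> Z")
        case True
        define u where "u = inv_into V h v"
        have u: "u \<in> Z" "u \<in> V" "h u = v" using True iZ v H(3,4) by (auto simp: u_def)
        have "u = opp g v" using v True by (simp add: h'_def u_def)
        then have "opp g u = v" using opp(2)[OF c v(1)] by simp
        then have "u \<in> closed g h" using u by (simp add: closed_def)
        then show ?thesis using u by auto
      next
        case False
        then show ?thesis using v by (simp add: closed_def h'_def)
      qed
    qed
    show "(closed g h - Z) \<union> h ` (closed g h \<inter> Z) \<subseteq> closed g h'"
    proof -
      have "h u \<in> closed g h'" if u: "u \<in> closed g h" "u \<in> Z" for u
      proof -
        have uV: "u \<in> V" "h u = opp g u" using u by (auto simp: closed_def)
        have "h' (h u) = u" using hZ[OF uV(1)] H(2)[OF uV(1)] u by (simp add: h'_def)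
        then show ?thesis using H(1)[OF uV(1)] opp(2)[OF c uV(1)] uV(2) by (simp add: closed_def)
      qed
      then have "h ` (closed g h \<inter> Z) \<subseteq> closed g h'" by blast
      moreover have "closed g h - Z \<subseteq> closed g h'" by (auto simp: closed_def h'_def)
      ultimately show ?thesis by simp
    qed
  qed
  have fin: "finite (closed g h)" using finite_V by (simp add: closed_def)
  have "inj_on h V" by (rule inj_onI) (use H(5) in blast)
  then have inj: "inj_on h (closed g h \<inter> Z)" by (rule inj_on_subset) (auto simp: closed_def)
  have "(closed g h - Z) \<inter> h ` (closed g h \<inter> Z) = {}" using Z(2) by blast
  then have "card (closed g h') = card (closed g h - Z) + card (closed g h \<inter> Z)"
    unfolding cl using card_Un_disjoint[of "closed g h - Z" "h ` (closed g h \<inter> Z)"] card_image[OF inj] fin by simp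
  also have "\<dots> = card ((closed g h - Z) \<union> (closed g h \<inter> Z))"
    using fin by (intro card_Un_disjoint[symmetric]) auto
  finally show "card (closed g h') = card (closed g h)" by (simp add: Un_Diff_Int Un_commute)
qed

definition bad_set :: "('a \<Rightarrow> 'a) \<Rightarrow> ('a \<Rightarrow> 'a) \<Rightarrow> 'a set \<Rightarrow> bool" where
  "bad_set g h S \<longleftrightarrow> S \<subseteq> closed g h \<and> shift g h ` S = S \<and> (\<forall>v\<in>S. shift g h (shift g h v) \<noteq> v)"

text \<open>Flipping a bad set opens every vertex of it and closes only vertices $h(u)$ with $h(h(u))$ equal to the shift of $u$, so
  for a minimal number of closed vertices all elements of the set are of this kind.\<close>

lemma bad_set_minimal:
  assumes c: "config g h" and min: "\<And>g' h'. config g' h' \<Longrightarrow> card (closed g h) \<le> card (closed g' h')"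
    and S: "bad_set g h S" and u: "u \<in> S"
  shows "h (h u) = shift g h u"
proof (rule ccontr)
  assume ne: "h (h u) \<noteq> shift g h u"
  let ?N = "{u \<in> S. h (h u) = shift g h u}"
  have S': "S \<subseteq> closed g h" "shift g h ` S = S" "\<And>v. v \<in> S \<Longrightarrow> shift g h (shift g h v) \<noteq> v"
    using S by (auto simp: bad_set_def)
  have fin: "finite (closed g h)" using finite_V by (simp add: closed_def)
  have finS: "finite S" using S'(1) fin by (rule finite_subset)
  note F = flip[OF c S']
  have "card (closed g h) \<le> card ((closed g h - S) \<union> h ` ?N)"
  proof -
    have "finite ((closed g h - S) \<union> h ` ?N)" using fin finS by simp
    then show ?thesis using min[OF F(1)] card_mono[OF _ F(2)] by linarith
  qed
  also have "\<dots> \<le> card (closed g h - S) + card (h ` ?N)" by (rule card_Un_le)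
  also have "card (h ` ?N) \<le> card ?N" by (rule card_image_le) (use finS in auto)
  also have "?N \<subset> S" using u ne by auto
  then have "card ?N < card S" by (rule psubset_card_mono[OF finS])
  also have "card (closed g h - S) + card S = card (closed g h)"
    using card_Diff_subset[OF finS S'(1)] card_mono[OF fin S'(1)] by simp
  finally show False by simp
qed

text \<open>Minimality still permits bad sets on which the second iterate of \<open>h\<close> equals
  \<open>shift\<close>. Then \<open>S\<close> and its image under \<open>h\<close> consist of whole
  cycles of \<open>h\<close>, and reversing them keeps the number of closed vertices minimal. A bad
  set after the reversal satisfies the same equation and avoids the image of \<open>S\<close>; so it
  avoids \<open>Z\<close>, was already bad before, and therefore lies in \<open>S\<close>. Hence it
  is empty.\<close>

lemma good_config:
  assumes "config g0 h0"
  shows "\<exists>g h. config g h \<and> (\<forall>S. bad_set g h S \<longrightarrow> S = {})"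
proof -
  define n where "n = (LEAST n. \<exists>g h. config g h \<and> card (closed g h) = n)"
  have "\<exists>g h. config g h \<and> card (closed g h) = n" unfolding n_def by (rule LeastI_ex) (use assms in blast)
  then obtain g h where c: "config g h" and gn: "card (closed g h) = n" by blast
  have min: "n \<le> card (closed g' h')" if "config g' h'" for g' h'
    unfolding n_def by (rule Least_le) (use that in blast)
  note G = G[OF c] and H = H[OF c]
  \<comment> \<open>A union of bad sets is bad, so this is the largest one.\<close>
  define S where "S = \<Union>{S. bad_set g h S}"
  have "shift g h ` S = S"
  proof -
    have "shift g h ` S = (\<Union>T\<in>{T. bad_set g h T}. shift g h ` T)" unfolding S_def by (rule image_Union)
    also have "\<dots> = (\<Union>T\<in>{T. bad_set g h T}. T)" by (rule SUP_cong[OF refl]) (simp add: bad_set_def)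
    finally show ?thesis by (simp add: S_def)
  qed
  moreover have "S \<subseteq> closed g h" "\<forall>v\<in>S. shift g h (shift g h v) \<noteq> v"
    by (auto simp: S_def bad_set_def)
  ultimately have S: "bad_set g h S" by (simp add: bad_set_def)
  have SV: "S \<subseteq> V" using S by (auto simp: bad_set_def closed_def)
  have hh: "h (h u) = shift g h u" if "u \<in> S" for u
    by (rule bad_set_minimal[OF c _ S that]) (use min gn in simp)
  define Z where "Z = S \<union> h ` S"
  have ZV: "Z \<subseteq> V" using SV H(1) by (auto simp: Z_def)
  have "h ` (h ` S) = S"
  proof -
    have "h ` (h ` S) = shift g h ` S" unfolding image_image using hh by (intro image_cong) auto
    then show ?thesis using S by (simp add: bad_set_def)
  qed
  then have hZ: "h ` Z = Z" by (auto simp: Z_def image_Un)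
  define h3 where "h3 = (\<lambda>v. if v \<in> Z then inv_into V h v else h v)"
  note R = reverse[OF c ZV hZ, folded h3_def]
  note H3 = factorD[OF fh[OF R(1)]]
  have h3h: "h3 (h v) = v" if "v \<in> Z" for v
  proof -
    have "h v \<in> Z" using that hZ by blast
    moreover have "inv_into V h (h v) = v" using H(2) that ZV by blast
    ultimately show ?thesis by (simp add: h3_def)
  qed
  have SC: "closed g h \<inter> Z = S"
    using S head_not_closed[OF c] by (auto simp: Z_def bad_set_def)
  have "S3 = {}" if S3: "bad_set g h3 S3" for S3
  proof -
    have S3': "S3 \<subseteq> (closed g h - Z) \<union> h ` S" "shift g h3 ` S3 = S3" "S3 \<subseteq> V"
      using S3 R(2) SC by (auto simp: bad_set_def closed_def)
    have hh3: "h3 (h3 u) = shift g h3 u" if "u \<in> S3" for u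
      by (rule bad_set_minimal[OF R(1) _ S3 that]) (use min R(3) gn in simp)
    \<comment> \<open>Let \<open>u = h v\<close> and let \<open>t\<close> be its preimage under the
      new \<open>shift\<close>. The two equations for iterates, before and after the reversal, give
      \<open>g t = v\<close> and \<open>t = g v\<close>, a cycle of \<open>g\<close> of length
      two.\<close>
    have notin: "u \<notin> h ` S" if u3: "u \<in> S3" for u
    proof
      assume "u \<in> h ` S"
      then obtain v where v: "v \<in> S" "u = h v" by auto
      obtain t where t: "t \<in> S3" "shift g h3 t = u" using S3'(2) u3 by (metis image_iff)
      have tV: "t \<in> V" using t S3' by auto
      have "g t = h3 u" using shift(2)[OF R(1) tV] t by simp
      then have gt: "g t = v" using h3h[of v] v by (simp add: Z_def)
      have vZ: "v \<in> Z" "h v \<in> Z" "h (h v) \<in> Z" "v \<in> V" using v hZ SV by (auto simp: Z_def)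
      have "h3 (h3 t) = h v" using hh3[OF t(1)] t v by simp
      moreover have "h3 (h (h v)) = h v" using h3h vZ by blast
      moreover have "h3 (h (h (h v))) = h (h v)" using h3h vZ by blast
      moreover have "h (h v) \<in> V" "h (h (h v)) \<in> V" using H(1) vZ by auto
      moreover have "h3 t \<in> V" using H3(1) tV by simp
      ultimately have "t = h (h (h v))" using H3(5) tV by metis
      then have "t = h (shift g h v)" using hh[OF v(1)] by simp
      then have "t = g v" using shift(2)[OF c vZ(4)] by simp
      then show False using gt G(9)[OF vZ(4)] by simp
    qed
    then have out: "S3 \<subseteq> closed g h - Z" using S3'(1) by blast
    have same: "shift g h u = shift g h3 u" if u: "u \<in> S3" for u
    proof -
      have uV: "u \<in> V" using u S3' by auto
      have "shift g h3 u \<in> S3" using u S3'(2) by auto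
      then have "shift g h3 u \<notin> Z" "shift g h3 u \<in> V" using out S3' by auto
      then have "h (shift g h3 u) = g u" using shift(2)[OF R(1) uV] by (simp add: h3_def)
      then show ?thesis using H(2) \<open>shift g h3 u \<in> V\<close> by (metis shift_def)
    qed
    have "shift g h ` S3 = S3" using same S3'(2) by (metis image_cong)
    moreover have "shift g h (shift g h u) \<noteq> u" if "u \<in> S3" for u
      using same that S3 S3'(2) by (metis bad_set_def imageI)
    ultimately have "bad_set g h S3" using out by (auto simp: bad_set_def)
    then have "S3 \<subseteq> S" by (auto simp: S_def)
    then show ?thesis using out by (auto simp: Z_def)
  qed
  then show ?thesis using R(1) by blast
qed

end

section \<open>Opening the cycles of one colour\<close>

context last_factors
begin

text \<open>At a closed vertex \<open>v\<close> the arc of \<open>h\<close> closes the prolonged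
  path to a cycle on 2k - 2 vertices. For \<open>v\<close> in \<open>R\<close> this cycle is formed
  and opened at its arc of \<open>g\<close> from \<open>x v\<close>, so the end moves from
  \<open>v\<close> to \<open>x v\<close>. The removed arc prolongs the path whose end was already
  \<open>x v\<close>, and the arc of \<open>h\<close> at \<open>x v\<close> prolongs the opened
  cycle. A closed vertex outside \<open>R\<close> has its \<open>shift\<close> in \<open>R\<close>,
  so it is such a vertex \<open>x v\<close> and avoids its closing arc. The alternation of
  \<open>R\<close> keeps these exchanges from interfering.\<close>

lemma extend_last_factors:
  assumes "config g0 h0"
  shows "\<exists>P. psys (A \<union> B) (2 * k) P"
proof -
  obtain g h where c: "config g h" and nobad: "\<And>S. bad_set g h S \<Longrightarrow> S = {}"
    using good_config[OF assms] by blast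
  note G = G[OF c] and H = H[OF c] and opp = opp[OF c] and shift = shift[OF c]
  let ?s = "shift g h" and ?o = "opp g" and ?gi = "inv_into V g"
  have BE: "B \<subseteq> E" using c by (auto simp: config_def factor_def)
  have CV: "closed g h \<subseteq> V" by (auto simp: closed_def)
  have finC: "finite (closed g h)" using CV finite_V by (rule finite_subset)
  have sinj: "inj_on ?s V" by (rule inj_onI) (use shift_inj[OF c] in blast)
  have "\<exists>R\<subseteq>closed g h. \<forall>v\<in>closed g h. v \<in> R \<longleftrightarrow> ?s v \<notin> R"
  proof (rule alternating_subset[OF finC CV sinj])
    show "?s ` V \<subseteq> V" using shift(1) by blast
    show "?s v \<noteq> v" if "v \<in> closed g h" for v using shift(3) that CV by blast
    show "S = {}" if "S \<subseteq> closed g h" "?s ` S = S" "\<And>v. v \<in> S \<Longrightarrow> ?s (?s v) \<noteq> v" for S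
      by (rule nobad) (use that in \<open>auto simp: bad_set_def\<close>)
  qed
  then obtain R where RC: "R \<subseteq> closed g h" and R: "\<And>v. v \<in> closed g h \<Longrightarrow> v \<in> R \<longleftrightarrow> ?s v \<notin> R" by blast
  have RV: "v \<in> V" if "v \<in> R" for v using that RC CV by auto
  define x where "x v = last (J (?gi v))" for v
  have xV: "x v \<in> V" if "v \<in> V" for v using JD(4)[OF G(4)[OF that]] by (simp add: x_def)
  have og: "?o v = g (x v)" for v by (simp add: opp_def x_def)
  have sx: "?s (x v) = v" "h v = ?o v" "?o v \<notin> R" "x v \<noteq> v" if "v \<in> R" for v
  proof -
    have vc: "v \<in> closed g h" using that RC by auto
    show "?s (x v) = v" using closed_shift(2)[OF c vc] by (simp add: x_def)
    then show "x v \<noteq> v" using shift(3)[OF RV[OF that]] by auto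
    show "h v = ?o v" using vc by (simp add: closed_def)
    then show "?o v \<notin> R" using head_not_closed[OF c vc] RC by auto
  qed
  \<comment> \<open>\<open>th\<close> exchanges \<open>v\<close> in \<open>R\<close> with
    \<open>x v\<close> and is an involution, so the new ends \<open>h (th v)\<close> are again a
    permutation of the vertices. At \<open>x v\<close> the new end is \<open>h v = g (x v)\<close>,
    the head of the arc at which the cycle was opened.\<close>
  define th where "th v = (if v \<in> R then x v else if ?s v \<in> R then ?s v else v)" for v
  have thV: "th v \<in> V" if "v \<in> V" for v using that xV shift(1) by (simp add: th_def)
  have thth: "th (th v) = v" if v: "v \<in> V" for v
  proof -
    consider (a) "v \<in> R" | (b) "v \<notin> R" "?s v \<in> R" | (c) "v \<notin> R" "?s v \<notin> R" by blast
    then show ?thesis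
    proof cases
      case a
      have "x v \<notin> R" using R[of "x v"] sx(1)[OF a] a RC by auto
      then show ?thesis using a sx(1)[OF a] by (simp add: th_def)
    next
      case b
      have "x (?s v) = v"
        using sx(1)[OF b(2)] shift_inj[OF c xV[OF shift(1)[OF v]] v] by simp
      then show ?thesis using b by (simp add: th_def)
    qed (simp add: th_def)
  qed
  define ep where "ep v = h (th v)" for v
  have epV: "ep v \<in> V" if "v \<in> V" for v using H(1)[OF thV[OF that]] by (simp add: ep_def)
  have epinj: "ep u = ep v \<longleftrightarrow> u = v" if "u \<in> V" "v \<in> V" for u v
    using H(5)[OF thV[OF that(1)] thV[OF that(2)]] thth that by (metis ep_def)
  have epR: "ep v = h (x v)" if "v \<in> R" for v using that by (simp add: ep_def th_def)
  have epS: "ep v = g v" if "v \<in> V" "v \<notin> R" "?s v \<in> R" for v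
    using that shift(2)[OF that(1)] by (simp add: ep_def th_def)
  have epO: "ep v = h v" if "v \<notin> R" "?s v \<notin> R" for v using that by (simp add: ep_def th_def)
  \<comment> \<open>The index is still the end of the path before any cycle is opened. Of the two
    ends \<open>v\<close> and \<open>?o v\<close> at most one is in \<open>R\<close>; it determines
    where the cycle is opened, and the other entry is the reverse.\<close>
  define core where "core v = (if v \<in> R then J (x v) @ [v, ?o v] else if ?o v \<in> R then rev (J (x (?o v)) @ [?o v, v])
    else extend g J v)" for v
  have ext: "extend g J v = v # J (?gi v) @ [?o v]" for v by (simp add: extend_def opp_def)
  have k2: "2 * k - 2 \<ge> 2" using k3 by simp
  note I = psysD[OF inner_psys[OF c] _ k2]
  have lastI: "last (extend g J v) = ?o v" for v by (simp add: ext)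
  have core_opp: "core (?o v) = rev (core v)" if v: "v \<in> V" for v
  proof -
    consider (a) "v \<in> R" | (b) "?o v \<in> R" "v \<notin> R" | (c) "v \<notin> R" "?o v \<notin> R" by blast
    then show ?thesis
    proof cases
      case a
      then show ?thesis using sx(3)[OF a] opp(2)[OF v] by (simp add: core_def)
    next
      case b
      then show ?thesis using opp(2)[OF v] by (simp add: core_def)
    next
      case c
      then show ?thesis using I(5)[OF v] lastI[of v] opp(2)[OF v] by (simp add: core_def)
    qed
  qed
  \<comment> \<open>The true first vertex of \<open>core v\<close>, to which the new arc is
    attached.\<close>
  define s where "s v = (if v \<in> R then x v else v)" for v
  have Jx: "J (x v) = rev (J (?gi v))" if "v \<in> V" for v
    using JD(5)[OF G(4)[OF that]] by (simp add: x_def)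
  have coreR: "distinct (core v)" "length (core v) = 2 * k - 2" "hd (core v) = x v" "last (core v) = ?o v"
    "walk_edges (core v) = walk_edges (J (?gi v)) \<union> {{?gi v, g (?gi v)}, {v, h v}}" if v: "v \<in> R" for v
  proof -
    have vV: "v \<in> V" using v RV by auto
    have e: "core v = J (x v) @ [v, ?o v]" using v by (simp add: core_def)
    have "distinct (extend g J v)" "length (extend g J v) = 2 * k - 2" using I(1,2)[OF vV] by auto
    then show "distinct (core v)" "length (core v) = 2 * k - 2" unfolding e ext Jx[OF vV] by auto
    note Jv = JD[OF xV[OF vV]]
    show "hd (core v) = x v" "last (core v) = ?o v" unfolding e using Jv(3,7) by auto
    have l: "last (J (x v)) = ?gi v" using JD(8)[OF G(4)[OF vV]] by (simp add: x_def)
    have "walk_edges (core v) = insert {last (J (x v)), v} (walk_edges (J (x v)) \<union> {{v, ?o v}})"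
      unfolding e using walk_edges_append[OF Jv(7), of "[v, ?o v]"] by simp
    moreover have "walk_edges (J (x v)) = walk_edges (J (?gi v))" using Jx[OF vV] by simp
    ultimately have "walk_edges (core v) = insert {?gi v, v} (walk_edges (J (?gi v)) \<union> {{v, ?o v}})"
      using l by simp
    then show "walk_edges (core v) = walk_edges (J (?gi v)) \<union> {{?gi v, g (?gi v)}, {v, h v}}"
      unfolding sx(2)[OF v] G(3)[OF vV] by auto
  qed
  have coreI: "walk_edges (core v) = walk_edges (J (?gi v)) \<union> {{?gi v, g (?gi v)}, {x v, g (x v)}}"
    if v: "v \<in> V" "v \<notin> R" "?o v \<notin> R" for v
  proof -
    note Jv = JD[OF G(4)[OF v(1)]]
    have "core v = v # J (?gi v) @ [g (x v)]" using v by (simp add: core_def ext og)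
    then have "walk_edges (core v) = insert {v, hd (J (?gi v))} (insert {g (x v), last (J (?gi v))} (walk_edges (J (?gi v))))"
      using walk_edges_both_ends[OF Jv(7)] by simp
    then show ?thesis using Jv(3) G(3)[OF v(1)] by (auto simp: x_def insert_commute)
  qed
  have core1: "distinct (core v) \<and> length (core v) = 2 * k - 2 \<and> hd (core v) = s v" if v: "v \<in> V" for v
  proof -
    consider (a) "v \<in> R" | (b) "?o v \<in> R" "v \<notin> R" | (c) "v \<notin> R" "?o v \<notin> R" by blast
    then show ?thesis
    proof cases
      case a
      then show ?thesis using coreR by (simp add: s_def)
    next
      case b
      have "core v = rev (core (?o v))" using core_opp[OF opp(1)[OF v]] opp(2)[OF v] by simp
      then show ?thesis using coreR[OF b(1)] opp(2)[OF v] b by (simp add: s_def hd_rev)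
    next
      case c
      then show ?thesis using I(1,2,3)[OF v] by (simp add: core_def s_def)
    qed
  qed
  have core_ne: "core v \<noteq> []" if "v \<in> V" for v using core1[OF that] k2 by auto
  have core_last: "last (core v) = s (?o v)" if v: "v \<in> V" for v
    using core1[OF opp(1)[OF v]] core_opp[OF v] core_ne[OF v] by (simp add: hd_rev)
  have walk_opp: "walk_edges (core (?o v)) = walk_edges (core v)" if "v \<in> V" for v using core_opp[OF that] by simp
  have JA: "walk_edges (J (?gi v)) \<subseteq> A" if "v \<in> V" for v using JD(6)[OF G(4)[OF that]] .
  note gh = g_h_arc[OF c] and notA = arc_notin_A[OF c] and inB = arc_in_B[OF c]
  have core_sub: "walk_edges (core v) \<subseteq> A \<union> B" if v: "v \<in> V" for v
  proof -
    consider (a) "v \<in> R" | (b) "?o v \<in> R" "v \<notin> R" | (c) "v \<notin> R" "?o v \<notin> R" by blast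
    then show ?thesis
    proof cases
      case a
      then show ?thesis using coreR(5)[OF a] JA[OF v] inB(1)[OF G(4)[OF v]] inB(2)[OF v] by auto
    next
      case b
      then show ?thesis
        using coreR(5)[OF b(1)] JA[OF opp(1)[OF v]] inB(1)[OF G(4)[OF opp(1)[OF v]]] inB(2)[OF opp(1)[OF v]] walk_opp[OF v] by auto
    next
      case c
      then show ?thesis using coreI[OF v c] JA[OF v] inB(1)[OF G(4)[OF v]] inB(1)[OF xV[OF v]] by auto
    qed
  qed
  have edge: "{ep v, s v} = {x v, h (x v)}" if "v \<in> R" for v using that epR by (simp add: s_def insert_commute)
  have edgeS: "{ep v, s v} = {v, g v}" if "v \<in> V" "v \<notin> R" "?s v \<in> R" for v
    using that epS by (simp add: s_def insert_commute)
  have edgeO: "{ep v, s v} = {v, h v}" if "v \<notin> R" "?s v \<notin> R" for v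
    using that epO by (simp add: s_def insert_commute)
  have edgeB: "{ep v, s v} \<in> B" if v: "v \<in> V" for v
    using edge[of v] edgeS[OF v] edgeO[of v] inB xV[OF v] v by (cases "v \<in> R"; cases "?s v \<in> R") auto
  have edge_new: "{ep v, s v} \<notin> walk_edges (core v)" if v: "v \<in> V" for v
  proof -
    note o = opp[OF v] and giV = G(4)[OF v]
    consider (a) "v \<in> R" | (b) "?o v \<in> R" "v \<notin> R" | (c) "v \<notin> R" "?o v \<notin> R" by blast
    then show ?thesis
    proof cases
      case a
      have "{x v, h (x v)} \<noteq> {?gi v, g (?gi v)}" using gh[OF giV xV[OF v]] by simp
      moreover have "{x v, h (x v)} \<noteq> {v, h v}" using H(6)[OF xV[OF v] v] sx(4)[OF a] by simp
      moreover have "{x v, h (x v)} \<notin> walk_edges (J (?gi v))" using JA[OF v] notA(2)[OF xV[OF v]] by blast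
      ultimately show ?thesis unfolding edge[OF a] coreR(5)[OF a] by simp
    next
      case b
      let ?r = "?o v" and ?y = "?gi (?o v)"
      have w: "walk_edges (core v) = walk_edges (J ?y) \<union> {{?y, g ?y}, {?r, h ?r}}"
        using coreR(5)[OF b(1)] walk_opp[OF v] by simp
      have hr: "h ?r = v" using sx(2)[OF b(1)] o(2) by simp
      have yV: "?y \<in> V" by (rule G(4)[OF o(1)])
      show ?thesis
      proof (cases "?s v \<in> R")
        case True
        have "v \<noteq> ?y"
        proof
          assume "v = ?y"
          then have "g v = ?r" using G(3)[OF o(1)] by simp
          then show False using gh_neq(1)[OF c o(1)] hr by simp
        qed
        then have "{v, g v} \<noteq> {?y, g ?y}" using G(6)[OF v yV] by simp
        moreover have "{v, g v} \<noteq> {?r, h ?r}" using gh[OF v o(1)] .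
        moreover have "{v, g v} \<notin> walk_edges (J ?y)" using JA[OF o(1)] notA(1)[OF v] by blast
        ultimately show ?thesis unfolding edgeS[OF v b(2) True] w by simp
      next
        case False
        have "{v, h v} \<noteq> {?y, g ?y}" using gh[OF yV v] by simp
        moreover have "{v, h v} \<noteq> {?r, h ?r}" using H(6)[OF v o(1)] o(3) by simp
        moreover have "{v, h v} \<notin> walk_edges (J ?y)" using JA[OF o(1)] notA(2)[OF v] by blast
        ultimately show ?thesis unfolding edgeO[OF b(2) False] w by simp
      qed
    next
      case c
      show ?thesis
      proof (cases "?s v \<in> R")
        case True
        have "v \<noteq> ?gi v" using G(3,8)[OF v] by metis
        then have "{v, g v} \<noteq> {?gi v, g (?gi v)}" using G(6)[OF v giV] by simp
        moreover have "v \<noteq> x v"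
          using I(2)[OF v] last_in_set[OF JD(7)[OF giV]] unfolding ext x_def by auto
        then have "{v, g v} \<noteq> {x v, g (x v)}" using G(6)[OF v xV[OF v]] by simp
        moreover have "{v, g v} \<notin> walk_edges (J (?gi v))" using JA[OF v] notA(1)[OF v] by blast
        ultimately show ?thesis unfolding edgeS[OF v c(1) True] coreI[OF v c] by simp
      next
        case False
        have "{v, h v} \<noteq> {?gi v, g (?gi v)}" using gh[OF giV v] by simp
        moreover have "{v, h v} \<noteq> {x v, g (x v)}" using gh[OF xV[OF v] v] by simp
        moreover have "{v, h v} \<notin> walk_edges (J (?gi v))" using JA[OF v] notA(2)[OF v] by blast
        ultimately show ?thesis unfolding edgeO[OF c(1) False] coreI[OF v c] by simp
      qed
    qed
  qed
  \<comment> \<open>The opposite end is the only vertex of the core where the girth bound cannot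
    prevent a collision.\<close>
  have far_end: "ep v \<noteq> s (?o v)" if v: "v \<in> V" for v
  proof -
    note o = opp[OF v]
    consider (a) "v \<in> R" | (b) "?o v \<in> R" "v \<notin> R" | (c) "v \<notin> R" "?o v \<notin> R" by blast
    then show ?thesis
    proof cases
      case a
      have "h (x v) \<noteq> h v" using H(5)[OF xV[OF v] v] sx(4)[OF a] by simp
      then show ?thesis using epR[OF a] sx(2,3)[OF a] by (simp add: s_def)
    next
      case b
      let ?z = "x (?o v)"
      have z: "?z \<in> V" "g ?z = v" using xV[OF o(1)] og[of "?o v"] o(2) by auto
      have "g v \<noteq> ?z" "h v \<noteq> ?z" using G(9)[OF z(1)] gh_neq(2)[OF c z(1)] z(2) by auto
      then show ?thesis using epS[OF v b(2)] epO[OF b(2)] b(1) by (cases "?s v \<in> R") (auto simp: s_def)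
    next
      case c
      show ?thesis
      proof (cases "?s v \<in> R")
        case True
        have "v \<noteq> x v"
          using I(2)[OF v] last_in_set[OF JD(7)[OF G(4)[OF v]]] unfolding ext x_def by auto
        then have "g v \<noteq> g (x v)" using G(5)[OF v xV[OF v]] by simp
        then show ?thesis using epS[OF v c(1) True] c(2) og by (simp add: s_def)
      next
        case False
        \<comment> \<open>A closed vertex outside \<open>R\<close> has its \<open>shift\<close> in
          \<open>R\<close> and belongs to the previous case; this is where the choice of
          \<open>R\<close> pays off.\<close>
        have "v \<notin> closed g h" using R[of v] c(1) False by auto
        then have "h v \<noteq> ?o v" using v by (simp add: closed_def)
        then show ?thesis using epO[OF c(1) False] c(2) by (simp add: s_def)
      qed
    qed
  qed
  define Q where "Q v = ep v # core v @ [ep (?o v)]" for v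
  have walkQ: "walk_edges (Q v) = insert {ep v, s v} (insert {ep (?o v), s (?o v)} (walk_edges (core v)))" if v: "v \<in> V" for v
    unfolding Q_def walk_edges_both_ends[OF core_ne[OF v]] core_last[OF v] using core1[OF v] by simp
  have distQ: "distinct (Q v)" if v: "v \<in> V" for v
    unfolding Q_def
  proof (rule extended_path_distinct)
    have oV: "?o v \<in> V" by (rule opp(1)[OF v])
    show "distinct (core v)" "2 \<le> length (core v)" "length (core v) \<le> 2 * k - 2" using core1[OF v] k2 by auto
    show "walk_edges (core v) \<subseteq> E" using core_sub[OF v] AE BE by auto
    have hs: "hd (core v) = s v" using core1[OF v] by simp
    show "{ep v, hd (core v)} \<in> E" "{ep v, hd (core v)} \<notin> walk_edges (core v)" "ep v \<noteq> last (core v)"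
      unfolding hs core_last[OF v] using edgeB[OF v] BE edge_new[OF v] far_end[OF v] by auto
    show "{ep (?o v), last (core v)} \<in> E" "{ep (?o v), last (core v)} \<notin> walk_edges (core v)" "ep (?o v) \<noteq> hd (core v)"
      unfolding hs core_last[OF v]
      using edgeB[OF oV] BE edge_new[OF oV] far_end[OF oV] walk_opp[OF v] opp(2)[OF v] by auto
    show "ep v \<noteq> ep (?o v)" using epinj[OF v oV] opp(3)[OF v] by simp
  qed
  have "inj_on ep V" by (rule inj_onI) (use epinj in blast)
  then have bij: "bij_betw ep V V" unfolding bij_betw_def using epV endo_inj_surj[OF finite_V] by (metis image_subsetI)
  let ?ei = "inv_into V ep"
  have ei: "?ei u \<in> V" "ep (?ei u) = u" if "u \<in> V" for u
    using bij_betw_inv_into_right[OF bij that] bij_betw_inv_into[OF bij] that bij_betwE by blast+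
  have eiep: "?ei (ep v) = v" if "v \<in> V" for v using bij_betw_inv_into_left[OF bij that] .
  define P where "P u = Q (?ei u)" for u
  have "psys (A \<union> B) (2 * k) P" unfolding psys_def
  proof (intro conjI ballI)
    fix u assume u: "u \<in> V"
    define v where "v = ?ei u"
    have v: "v \<in> V" "ep v = u" using ei[OF u] by (auto simp: v_def)
    note oV = opp[OF v(1)]
    have Pu: "P u = Q v" by (simp add: P_def v_def)
    show "length (P u) = 2 * k" unfolding Pu Q_def using core1[OF v(1)] k3 by simp
    show "distinct (P u)" unfolding Pu by (rule distQ[OF v(1)])
    show "hd (P u) = u" unfolding Pu Q_def using v by simp
    have l: "last (P u) = ep (?o v)" unfolding Pu Q_def by simp
    show "last (P u) \<in> V" unfolding l by (rule epV[OF oV(1)])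
    have "P (last (P u)) = Q (?o v)" unfolding l by (simp add: P_def eiep[OF oV(1)])
    then show "P (last (P u)) = rev (P u)" unfolding Pu Q_def using core_opp[OF v(1)] oV(2) by simp
    show "walk_edges (P u) \<subseteq> A \<union> B"
      unfolding Pu walkQ[OF v(1)] using edgeB[OF v(1)] edgeB[OF oV(1)] core_sub[OF v(1)] by auto
  next
    have cov: "e \<in> (\<Union>u\<in>V. walk_edges (P u))" if "v \<in> V" "e \<in> insert {ep v, s v} (walk_edges (core v))" for e v
    proof -
      have "e \<in> walk_edges (P (ep v))" using walkQ[OF that(1)] that(2) eiep[OF that(1)] by (auto simp: P_def)
      then show ?thesis using epV[OF that(1)] by blast
    qed
    have Jcov: "walk_edges (J (?gi v)) \<subseteq> walk_edges (core v) \<or> walk_edges (J (?gi v)) \<subseteq> walk_edges (core (?o v))"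
      if v: "v \<in> V" for v
    proof -
      consider (a) "v \<in> R" | (b) "?o v \<in> R" "v \<notin> R" | (c) "v \<notin> R" "?o v \<notin> R" by blast
      then show ?thesis
      proof cases
        case b
        have "?gi (?o v) = x v" using og[of v] G(2)[OF xV[OF v]] by simp
        then have "walk_edges (J (?gi (?o v))) = walk_edges (J (?gi v))" using Jx[OF v] by simp
        then show ?thesis using coreR(5)[OF b(1)] by auto
      qed (use coreR(5) coreI[OF v] in auto)
    qed
    show "A \<union> B \<subseteq> (\<Union>u\<in>V. walk_edges (P u))"
    proof
      fix e assume "e \<in> A \<union> B"
      then consider (inner) "e \<in> A" | (garc) q where "q \<in> V" "e = {q, g q}" | (harc) q where "q \<in> V" "e = {q, h q}"
        using c by (auto simp: config_def arcs_def)
      then show "e \<in> (\<Union>u\<in>V. walk_edges (P u))"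
      proof cases
        case inner
        then obtain y where y: "y \<in> V" "e \<in> walk_edges (J y)" using J by (auto simp: psys_def)
        let ?v = "g y"
        have v: "?v \<in> V" "?gi ?v = y" using G(1,2)[OF y(1)] by auto
        then have "e \<in> walk_edges (core ?v) \<or> e \<in> walk_edges (core (?o ?v))" using Jcov[OF v(1)] y(2) by auto
        then show ?thesis using cov[of ?v e] cov[of "?o ?v" e] v(1) opp(1)[OF v(1)] by blast
      next
        case garc
        let ?v = "g q"
        have v: "?v \<in> V" "?gi ?v = q" using G(1,2)[OF garc(1)] by auto
        consider (a) "?v \<in> R" | (b) "?o ?v \<in> R" "?v \<notin> R" | (c) "?v \<notin> R" "?o ?v \<notin> R" by blast
        then show ?thesis
        proof cases
          case a
          then show ?thesis using coreR(5)[OF a] v garc cov[OF v(1), of e] by simp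
        next
          case b
          \<comment> \<open>This is the arc at which the cycle of \<open>?r\<close> was opened; it
            reappears as the arc attached at the end \<open>q\<close>.\<close>
          let ?r = "?o ?v"
          have "h ?r = g q" using sx(2)[OF b(1)] opp(2)[OF v(1)] by simp
          then have "?s q = ?r" using H(2)[OF opp(1)[OF v(1)]] unfolding shift_def by metis
          then have sq: "?s q \<in> R" using b by simp
          have "q \<notin> R" using R[of q] sq RC by auto
          then show ?thesis using edgeS[OF garc(1) _ sq] garc cov[OF garc(1), of e] by simp
        next
          case c
          then show ?thesis using coreI[OF v(1) c] v garc cov[OF v(1), of e] by simp
        qed
      next
        case harc
        consider (a) "q \<in> R" | (b) "q \<notin> R" "?s q \<in> R" | (c) "q \<notin> R" "?s q \<notin> R" by blast
        then show ?thesis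
        proof cases
          case a
          then show ?thesis using coreR(5)[OF a] harc cov[OF harc(1), of e] by simp
        next
          case b
          have sV: "?s q \<in> V" by (rule shift(1)[OF harc(1)])
          have "x (?s q) = q" using sx(1)[OF b(2)] shift_inj[OF c xV[OF sV] harc(1)] by simp
          then show ?thesis using edge[OF b(2)] harc cov[OF sV, of e] by simp
        next
          case c
          then show ?thesis using edgeO[OF c] harc cov[OF harc(1), of e] by simp
        qed
      qed
    qed
  next
    have "card B = 2 * card V"
    proof -
      have "card (arcs g \<union> arcs h) = card (arcs g) + card (arcs h)"
        using c finite_V by (intro card_Un_disjoint) (auto simp: config_def arcs_def)
      then show ?thesis using c arcs_card by (auto simp: config_def)
    qed
    moreover have "card (A \<union> B) = card A + card B"
      using AB AE BE finite_E finite_subset by (intro card_Un_disjoint) auto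
    moreover have "2 * card A = (2 * k - 4 - 1) * card V" using J by (simp add: psys_def)
    moreover have "2 * k - 1 = (2 * k - 4 - 1) + 4" using k3 by simp
    ultimately show "2 * card (A \<union> B) = (2 * k - 1) * card V"
      by (simp only: add_mult_distrib add_mult_distrib2)
  qed
  then show ?thesis by blast
qed

end

section \<open>Two-factors of a regular graph\<close>

lemma balanced_orientation:
  fixes s t :: "'i \<Rightarrow> 'v"
  assumes "finite I" "\<And>v. even (\<Sum>i\<in>I. of_bool (s i = v) + of_bool (t i = v) :: nat)"
  shows "\<exists>s' t'. (\<forall>i\<in>I. s' i = s i \<and> t' i = t i \<or> s' i = t i \<and> t' i = s i) \<and>
    (\<forall>v. (\<Sum>i\<in>I. of_bool (s' i = v) :: nat) = (\<Sum>i\<in>I. of_bool (t' i = v)))"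
  using assms
proof (induction "card I" arbitrary: I s t rule: less_induct)
  case less
  note fin = less.prems(1) and ev = less.prems(2)
  show ?case
  proof (cases "I = {}")
    case False
    then obtain i where i: "i \<in> I" by auto
    show ?thesis
    proof (cases "s i = t i")
      case True
      have split: "(\<Sum>j\<in>I. f j) = f i + (\<Sum>j\<in>I - {i}. f j)" for f :: "'i \<Rightarrow> nat"
        using fin i by (rule sum.remove)
      have "card (I - {i}) < card I" using fin i by (rule card_Diff1_less)
      moreover have "even (\<Sum>j\<in>I - {i}. of_bool (s j = v) + of_bool (t j = v) :: nat)" for v
        using ev[of v] True unfolding split by auto
      ultimately have "\<exists>s' t'. (\<forall>j\<in>I - {i}. s' j = s j \<and> t' j = t j \<or> s' j = t j \<and> t' j = s j) \<and>
        (\<forall>v. (\<Sum>j\<in>I - {i}. of_bool (s' j = v) :: nat) = (\<Sum>j\<in>I - {i}. of_bool (t' j = v)))"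
        by (intro less.hyps) (use fin in simp_all)
      then obtain s' t' where st: "\<forall>j\<in>I - {i}. s' j = s j \<and> t' j = t j \<or> s' j = t j \<and> t' j = s j"
        "\<And>v. (\<Sum>j\<in>I - {i}. of_bool (s' j = v) :: nat) = (\<Sum>j\<in>I - {i}. of_bool (t' j = v))"
        by blast
      have upd: "(\<Sum>j\<in>I - {i}. of_bool ((f(i := x)) j = v) :: nat) = (\<Sum>j\<in>I - {i}. of_bool (f j = v))" for f x v
        by (rule sum.cong) auto
      let ?s2 = "s'(i := s i)" and ?t2 = "t'(i := t i)"
      have "?s2 l = s l \<and> ?t2 l = t l \<or> ?s2 l = t l \<and> ?t2 l = s l" if "l \<in> I" for l
        using bspec[OF st(1), of l] that True by (cases "l = i") simp_all
      moreover have "(\<Sum>l\<in>I. of_bool (?s2 l = v) :: nat) = (\<Sum>l\<in>I. of_bool (?t2 l = v))" for v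
        unfolding split upd using st(2)[of v] True by simp
      ultimately show ?thesis by blast
    next
      case False
      let ?v = "t i"
      have split1: "(\<Sum>j\<in>I. f j) = f i + (\<Sum>j\<in>I - {i}. f j)" for f :: "'i \<Rightarrow> nat"
        using fin i by (rule sum.remove)
      have "odd (\<Sum>j\<in>I - {i}. of_bool (s j = ?v) + of_bool (t j = ?v) :: nat)"
        using ev[of ?v] False unfolding split1 by simp
      then have "(\<Sum>j\<in>I - {i}. of_bool (s j = ?v) + of_bool (t j = ?v) :: nat) \<noteq> 0" by (metis even_zero)
      then obtain j where "j \<in> I - {i}" "(of_bool (s j = ?v) + of_bool (t j = ?v) :: nat) \<noteq> 0"
        by (rule sum.not_neutral_contains_not_neutral)
      then have j: "j \<in> I" "j \<noteq> i" "s j = ?v \<or> t j = ?v" by auto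
      \<comment> \<open>split off: the pair of edges $i$, $j$ at the common end $t_i$ becomes the single edge $s_i w$\<close>
      define w where "w = (if s j = ?v then t j else s j)"
      have sj: "s j = ?v \<and> t j = w \<or> s j = w \<and> t j = ?v" using j(3) by (auto simp: w_def)
      let ?K = "I - {j} - {i}"
      have split: "(\<Sum>l\<in>I. f l) = f j + (f i + (\<Sum>l\<in>?K. f l))" for f :: "'i \<Rightarrow> nat"
        using sum.remove[OF fin j(1), of f] sum.remove[of "I - {j}" i f] fin i j by simp
      have split': "(\<Sum>l\<in>I - {j}. f l) = f i + (\<Sum>l\<in>?K. f l)" for f :: "'i \<Rightarrow> nat"
        by (rule sum.remove) (use fin i j in auto)
      let ?t = "t(i := w)"
      have K: "(\<Sum>l\<in>?K. of_bool (s l = v) + of_bool (?t l = v) :: nat) = (\<Sum>l\<in>?K. of_bool (s l = v) + of_bool (t l = v))" for v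
        by (rule sum.cong) auto
      have "card (I - {j}) < card I" using fin j(1) by (rule card_Diff1_less)
      moreover have "even (\<Sum>l\<in>I - {j}. of_bool (s l = v) + of_bool (?t l = v) :: nat)" for v
        using ev[of v] sj unfolding split split' K by (auto split: if_splits)
      ultimately have "\<exists>s' t'. (\<forall>l\<in>I - {j}. s' l = s l \<and> t' l = ?t l \<or> s' l = ?t l \<and> t' l = s l) \<and>
        (\<forall>v. (\<Sum>l\<in>I - {j}. of_bool (s' l = v) :: nat) = (\<Sum>l\<in>I - {j}. of_bool (t' l = v)))"
        by (intro less.hyps) (use fin in \<open>simp_all del: fun_upd_apply\<close>)
      then obtain s' t' where st: "\<forall>l\<in>I - {j}. s' l = s l \<and> t' l = ?t l \<or> s' l = ?t l \<and> t' l = s l"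
        "\<And>v. (\<Sum>l\<in>I - {j}. of_bool (s' l = v) :: nat) = (\<Sum>l\<in>I - {j}. of_bool (t' l = v))"
        by blast
      have upd: "(\<Sum>l\<in>?K. of_bool ((f(i := x, j := y)) l = v) :: nat) = (\<Sum>l\<in>?K. of_bool (f l = v))" for f x y v
        by (rule sum.cong) auto
      have si: "s' i = s i \<and> t' i = w \<or> s' i = w \<and> t' i = s i"
        using bspec[OF st(1), of i] i j(2) by simp
      have others: "s' l = s l \<and> t' l = t l \<or> s' l = t l \<and> t' l = s l" if "l \<in> ?K" for l
        using bspec[OF st(1), of l] that by simp
      have bal: "of_bool (s' i = v) + (\<Sum>l\<in>?K. of_bool (s' l = v) :: nat) = of_bool (t' i = v) + (\<Sum>l\<in>?K. of_bool (t' l = v))" for v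
        using st(2)[of v] unfolding split' .
      show ?thesis
      \<comment> \<open>The merged edge is unfolded in its own direction to a directed path through
        \<open>?v\<close>, which adds one to both degrees of \<open>?v\<close>.\<close>
      proof (cases "s' i = s i \<and> t' i = w")
        case True
        let ?s2 = "s'(i := s i, j := ?v)" and ?t2 = "t'(i := ?v, j := w)"
        have "?s2 l = s l \<and> ?t2 l = t l \<or> ?s2 l = t l \<and> ?t2 l = s l" if "l \<in> I" for l
          using others[of l] that sj j(2) by (cases "l = i"; cases "l = j") auto
        moreover have "(\<Sum>l\<in>I. of_bool (?s2 l = v) :: nat) = (\<Sum>l\<in>I. of_bool (?t2 l = v))" for v
          unfolding split upd using bal[of v] True j(2) by simp
        ultimately show ?thesis by blast
      next
        case False
        then have si': "s' i = w" "t' i = s i" using si by auto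
        let ?s2 = "s'(i := ?v, j := w)" and ?t2 = "t'(i := s i, j := ?v)"
        have "?s2 l = s l \<and> ?t2 l = t l \<or> ?s2 l = t l \<and> ?t2 l = s l" if "l \<in> I" for l
          using others[of l] that sj j(2) by (cases "l = i"; cases "l = j") auto
        moreover have "(\<Sum>l\<in>I. of_bool (?s2 l = v) :: nat) = (\<Sum>l\<in>I. of_bool (?t2 l = v))" for v
          unfolding split upd using bal[of v] si' j(2) by simp
        ultimately show ?thesis by blast
      qed
    qed
  qed auto
qed

text \<open>The argument of Halmos and Vaughan. A proper nonempty subset without surplus is matched
  by itself, and the remaining elements keep Hall's condition after its neighbours are removed. If
  there is none, every proper nonempty subset has a neighbour to spare, and one element may be
  matched arbitrarily.\<close>

lemma hall:
  assumes "finite X" "\<And>x. x \<in> X \<Longrightarrow> finite (A x)" "\<And>S. S \<subseteq> X \<Longrightarrow> card S \<le> card (\<Union>(A ` S))"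
  shows "\<exists>f. inj_on f X \<and> (\<forall>x\<in>X. f x \<in> A x)"
  using assms
proof (induction "card X" arbitrary: X A rule: less_induct)
  case less
  note fin = less.prems(1) and finA = less.prems(2) and H = less.prems(3)
  show ?case
  proof (cases "X = {}")
    case False
    show ?thesis
    proof (cases "\<exists>S. S \<subset> X \<and> S \<noteq> {} \<and> card (\<Union>(A ` S)) \<le> card S")
      case True
      then obtain S where S: "S \<subset> X" "S \<noteq> {}" "card (\<Union>(A ` S)) \<le> card S" by blast
      let ?U = "\<Union>(A ` S)"
      have finS: "finite S" using S(1) fin finite_subset by blast
      have eq: "card ?U = card S" using H[of S] S by auto
      have "card S < card X" using S(1) fin by (rule psubset_card_mono[rotated])
      then have "\<exists>f. inj_on f S \<and> (\<forall>x\<in>S. f x \<in> A x)"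
        by (rule less.hyps) (use finS finA H S(1) in auto)
      then obtain f where f: "inj_on f S" "\<forall>x\<in>S. f x \<in> A x" by blast
      have "X - S \<subset> X" using S by auto
      then have c2: "card (X - S) < card X" using fin by (rule psubset_card_mono[rotated])
      have "\<exists>f. inj_on f (X - S) \<and> (\<forall>x\<in>X - S. f x \<in> A x - ?U)"
      proof (rule less.hyps[OF c2])
        show "card T \<le> card (\<Union>((\<lambda>x. A x - ?U) ` T))" if T: "T \<subseteq> X - S" for T
        proof -
          have finT: "finite T" using T fin finite_subset by blast
          have "S \<inter> T = {}" using T by auto
          then have "card S + card T = card (S \<union> T)" using finS finT by (simp add: card_Un_disjoint)
          also have "\<dots> \<le> card (\<Union>(A ` (S \<union> T)))" by (rule H) (use S T in auto)
          also have "\<Union>(A ` (S \<union> T)) = ?U \<union> \<Union>((\<lambda>x. A x - ?U) ` T)" by auto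
          also have "card \<dots> \<le> card ?U + card (\<Union>((\<lambda>x. A x - ?U) ` T))" by (rule card_Un_le)
          finally show ?thesis using eq by simp
        qed
      qed (use fin finA in auto)
      then obtain f' where f': "inj_on f' (X - S)" "\<forall>x\<in>X - S. f' x \<in> A x - ?U" by (elim exE conjE)
      let ?f = "\<lambda>x. if x \<in> S then f x else f' x"
      have "inj_on ?f X"
      proof (rule inj_onI)
        fix x y assume xy: "x \<in> X" "y \<in> X" "?f x = ?f y"
        have ne: "f u \<noteq> f' v" if "u \<in> S" "v \<in> X - S" for u v
        proof -
          have "f u \<in> ?U" using bspec[OF f(2) that(1)] that(1) by blast
          moreover have "f' v \<notin> ?U" using bspec[OF f'(2) that(2)] by simp
          ultimately show ?thesis by metis
        qed
        consider "x \<in> S" "y \<in> S" | "x \<in> S" "y \<notin> S" | "x \<notin> S" "y \<in> S" | "x \<notin> S" "y \<notin> S" by blast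
        then show "x = y"
        proof cases
          case 1
          then show ?thesis using xy(3) inj_onD[OF f(1), of x y] by simp
        next
          case 2
          then show ?thesis using xy ne[of x y] by simp
        next
          case 3
          then show ?thesis using xy ne[of y x] by simp
        next
          case 4
          then show ?thesis using xy inj_onD[OF f'(1), of x y] by simp
        qed
      qed
      moreover have "?f x \<in> A x" if "x \<in> X" for x using f(2) f'(2) that by simp
      ultimately show ?thesis by blast
    next
      case noS: False
      obtain x where x: "x \<in> X" using False by auto
      have "card {x} \<le> card (\<Union>(A ` {x}))" by (rule H) (use x in auto)
      then obtain y where y: "y \<in> A x" by (cases "A x = {}") auto
      have c2: "card (X - {x}) < card X" using fin x by (rule card_Diff1_less)
      have "\<exists>f. inj_on f (X - {x}) \<and> (\<forall>z\<in>X - {x}. f z \<in> A z - {y})"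
      proof (rule less.hyps[OF c2])
        show "card T \<le> card (\<Union>((\<lambda>z. A z - {y}) ` T))" if T: "T \<subseteq> X - {x}" for T
        proof (cases "T = {}")
          case False
          have "T \<subset> X" using T x by auto
          then have "card T < card (\<Union>(A ` T))" using noS False by (meson not_le)
          moreover have "\<Union>((\<lambda>z. A z - {y}) ` T) = \<Union>(A ` T) - {y}" by auto
          moreover have "card (\<Union>(A ` T)) - 1 \<le> card (\<Union>(A ` T) - {y})"
            by (metis card_Diff_singleton_if diff_le_self le_refl)
          ultimately show ?thesis by simp
        qed simp
      qed (use fin finA in auto)
      then obtain f where f: "inj_on f (X - {x})" "\<forall>z\<in>X - {x}. f z \<in> A z - {y}" by (elim exE conjE)
      have "inj_on (f(x := y)) X"
      proof (rule inj_onI)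
        fix u v assume uv: "u \<in> X" "v \<in> X" "(f(x := y)) u = (f(x := y)) v"
        then show "u = v" using f(2) inj_onD[OF f(1), of u v] by (cases "u = x"; cases "v = x") auto
      qed
      then show ?thesis using f(2) y by (intro exI[of _ "f(x := y)"]) auto
    qed
  qed auto
qed

text \<open>Hall's condition by counting arcs: \<open>r * card S\<close> arcs leave
  \<open>S\<close>, and each vertex of the neighbourhood receives only \<open>r\<close>
  arcs.\<close>

lemma regular_relation_permutation:
  assumes fin: "finite V" and D: "D \<subseteq> V \<times> V" and r: "r > 0"
    and out: "\<And>v. v \<in> V \<Longrightarrow> card {w. (v, w) \<in> D} = r" and inn: "\<And>v. v \<in> V \<Longrightarrow> card {u. (u, v) \<in> D} = r"
  shows "\<exists>f. bij_betw f V V \<and> (\<forall>v\<in>V. (v, f v) \<in> D)"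
proof -
  let ?A = "\<lambda>v. {w. (v, w) \<in> D}"
  have finA: "finite (?A v)" for v by (rule finite_subset[of _ V]) (use D fin in auto)
  have finB: "finite {u. (u, v) \<in> D}" for v by (rule finite_subset[of _ V]) (use D fin in auto)
  have "\<exists>f. inj_on f V \<and> (\<forall>v\<in>V. f v \<in> ?A v)"
  proof (rule hall[OF fin finA])
    fix S assume S: "S \<subseteq> V"
    let ?N = "\<Union>(?A ` S)"
    have NV: "?N \<subseteq> V" using D by auto
    have finS: "finite S" "finite ?N" using S NV fin finite_subset by blast+
    have "card (Sigma S ?A) = (\<Sum>v\<in>S. card (?A v))"
      by (rule card_SigmaI) (use finS finA in auto)
    moreover have "(\<Sum>v\<in>S. card (?A v)) = (\<Sum>v\<in>S. r)"
      by (rule sum.cong[OF refl]) (use out S in blast)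
    moreover have "card (Sigma ?N (\<lambda>w. {u. (u, w) \<in> D})) = (\<Sum>w\<in>?N. card {u. (u, w) \<in> D})"
      by (rule card_SigmaI) (use finS finB in auto)
    moreover have "(\<Sum>w\<in>?N. card {u. (u, w) \<in> D}) = (\<Sum>w\<in>?N. r)"
      by (rule sum.cong[OF refl]) (use inn NV in blast)
    moreover have "card (Sigma S ?A) \<le> card (Sigma ?N (\<lambda>w. {u. (u, w) \<in> D}))"
    proof (rule card_inj_on_le[where f = prod.swap])
      show "finite (Sigma ?N (\<lambda>w. {u. (u, w) \<in> D}))" using finS finB by auto
    qed auto
    ultimately show "card S \<le> card ?N" using r by simp
  qed
  then obtain f where f: "inj_on f V" "\<forall>v\<in>V. f v \<in> ?A v" by blast
  then have "f ` V \<subseteq> V" using D by auto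
  then have "bij_betw f V V" using f(1) endo_inj_surj[OF fin] by (auto simp: bij_betw_def)
  then show ?thesis using f(2) by auto
qed

lemma regular_relation_permutations:
  assumes fin: "finite V"
  shows "D \<subseteq> V \<times> V \<Longrightarrow> (\<And>v. v \<in> V \<Longrightarrow> card {w. (v, w) \<in> D} = r) \<Longrightarrow>
    (\<And>v. v \<in> V \<Longrightarrow> card {u. (u, v) \<in> D} = r) \<Longrightarrow>
    \<exists>fs. length fs = r \<and> (\<forall>f\<in>set fs. bij_betw f V V \<and> (\<forall>v\<in>V. (v, f v) \<in> D)) \<and>
      sorted_wrt (\<lambda>f g. \<forall>v\<in>V. f v \<noteq> g v) fs \<and> (\<forall>v w. (v, w) \<in> D \<longrightarrow> (\<exists>f\<in>set fs. f v = w))"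
proof (induction r arbitrary: D)
  case 0
  have "D = {}"
  proof (rule ccontr)
    assume "D \<noteq> {}"
    then obtain v w where vw: "(v, w) \<in> D" "v \<in> V" using 0(1) by auto
    have "finite {w. (v, w) \<in> D}" by (rule finite_subset[of _ V]) (use 0(1) fin in auto)
    then show False using 0(2)[OF vw(2)] vw(1) by auto
  qed
  then show ?case by auto
next
  case (Suc r)
  obtain f where f: "bij_betw f V V" "\<forall>v\<in>V. (v, f v) \<in> D"
    using regular_relation_permutation[OF fin Suc.prems(1) _ Suc.prems(2,3)] by auto
  define D' where "D' = D - {(v, f v) | v. v \<in> V}"
  have finA: "finite {w. (v, w) \<in> D}" for v by (rule finite_subset[of _ V]) (use Suc.prems(1) fin in auto)
  have finB: "finite {u. (u, v) \<in> D}" for v by (rule finite_subset[of _ V]) (use Suc.prems(1) fin in auto)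
  have "card {w. (v, w) \<in> D'} = r" if v: "v \<in> V" for v
  proof -
    have "{w. (v, w) \<in> D'} = {w. (v, w) \<in> D} - {f v}" using v by (auto simp: D'_def)
    then show ?thesis using Suc.prems(2)[OF v] f(2) v finA by simp
  qed
  moreover have "card {u. (u, v) \<in> D'} = r" if v: "v \<in> V" for v
  proof -
    obtain u0 where u0: "u0 \<in> V" "f u0 = v" using f(1) v by (metis bij_betw_def image_iff)
    have "u \<in> V \<and> v = f u \<longleftrightarrow> u = u0" for u using f(1) u0 by (metis bij_betw_def inj_onD)
    then have "(u, v) \<in> D' \<longleftrightarrow> (u, v) \<in> D \<and> u \<noteq> u0" for u unfolding D'_def by blast
    then have "{u. (u, v) \<in> D'} = {u. (u, v) \<in> D} - {u0}" by blast
    moreover have "(u0, v) \<in> D" using f(2) u0 by auto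
    ultimately show ?thesis using Suc.prems(3)[OF v] finB by simp
  qed
  moreover have "D' \<subseteq> V \<times> V" using Suc.prems(1) by (auto simp: D'_def)
  ultimately obtain fs where fs: "length fs = r" "\<forall>g\<in>set fs. bij_betw g V V \<and> (\<forall>v\<in>V. (v, g v) \<in> D')"
    "sorted_wrt (\<lambda>f g. \<forall>v\<in>V. f v \<noteq> g v) fs" "\<forall>v w. (v, w) \<in> D' \<longrightarrow> (\<exists>f\<in>set fs. f v = w)"
    using Suc.IH[of D'] by blast
  have "\<forall>g\<in>set fs. \<forall>v\<in>V. f v \<noteq> g v" using fs(2) unfolding D'_def by fastforce
  moreover have "\<exists>g\<in>set (f # fs). g v = w" if "(v, w) \<in> D" for v w
    using fs(4) that by (cases "(v, w) \<in> D'") (auto simp: D'_def)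
  ultimately show ?case using fs f by (intro exI[of _ "f # fs"]) (auto simp: D'_def)
qed

lemma perfect_matching_partner:
  assumes G: "simple_graph V E" and M: "perfect_matching V E M"
  obtains m where "\<And>v. v \<in> V \<Longrightarrow> m v \<in> V \<and> m v \<noteq> v \<and> m (m v) = v" "M = (\<lambda>v. {v, m v}) ` V" "2 * card M = card V"
    "\<And>v. v \<in> V \<Longrightarrow> {e \<in> M. v \<in> e} = {{v, m v}}"
proof -
  have ME: "M \<subseteq> E" and ex1: "\<And>v. v \<in> V \<Longrightarrow> \<exists>!e. e \<in> M \<and> v \<in> e" using M by (auto simp: perfect_matching_def)
  have edge: "\<exists>u v. u \<in> V \<and> v \<in> V \<and> u \<noteq> v \<and> e = {u, v}" if "e \<in> M" for e
    using that ME G by (auto simp: simple_graph_def)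
  have uniq: "e = e'" if "e \<in> M" "e' \<in> M" "v \<in> e" "v \<in> e'" for e e' v
  proof -
    have "v \<in> V" using edge[OF that(1)] that(3) by auto
    then show ?thesis using ex1 that by blast
  qed
  have "\<exists>w. w \<in> V \<and> w \<noteq> v \<and> {v, w} \<in> M" if v: "v \<in> V" for v
  proof -
    obtain e where e: "e \<in> M" "v \<in> e" using ex1[OF v] by blast
    obtain a b where ab: "a \<in> V" "b \<in> V" "a \<noteq> b" "e = {a, b}" using edge[OF e(1)] by blast
    show ?thesis using e ab by (cases "v = a") (auto simp: insert_commute)
  qed
  then obtain m where m: "\<And>v. v \<in> V \<Longrightarrow> m v \<in> V \<and> m v \<noteq> v \<and> {v, m v} \<in> M" by metis
  have mm: "m (m v) = v" if v: "v \<in> V" for v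
  proof -
    have "m v \<in> V" "{v, m v} \<in> M" "{m v, m (m v)} \<in> M" "m v \<noteq> v" using m v by auto
    then have "{v, m v} = {m v, m (m v)}" using uniq[of "{v, m v}" "{m v, m (m v)}" "m v"] by auto
    then show ?thesis using \<open>m v \<noteq> v\<close> by (auto simp: doubleton_eq_iff)
  qed
  have at: "{e \<in> M. v \<in> e} = {{v, m v}}" if v: "v \<in> V" for v
    using m[OF v] uniq[of _ "{v, m v}" v] by auto
  have img: "M = (\<lambda>v. {v, m v}) ` V"
  proof
    show "M \<subseteq> (\<lambda>v. {v, m v}) ` V"
    proof
      fix e assume e: "e \<in> M"
      then obtain v where v: "v \<in> V" "v \<in> e" using edge by blast
      then have "e = {v, m v}" using at[OF v(1)] e by auto
      then show "e \<in> (\<lambda>v. {v, m v}) ` V" using v by auto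
    qed
  qed (use m in auto)
  have "pairwise disjnt M" unfolding pairwise_def disjnt_def using uniq by blast
  moreover have "finite e" if "e \<in> M" for e using edge[OF that] by auto
  ultimately have "card (\<Union>M) = sum card M" by (rule card_Union_disjoint)
  moreover have "sum card M = (\<Sum>e\<in>M. 2)" by (rule sum.cong) (use edge in fastforce)+
  moreover have "\<Union>M = V" using img m by auto
  ultimately have cM: "2 * card M = card V" by simp
  show thesis
  proof (rule that[OF _ img cM])
    show "m v \<in> V \<and> m v \<noteq> v \<and> m (m v) = v" if "v \<in> V" for v using m[OF that] mm[OF that] by simp
  qed (rule at)
qed

section \<open>Petersen's theorem and the assembly\<close>

context girth_graph
begin

text \<open>Petersen's argument: in a balanced orientation all in-degrees and out-degrees equal
  \<open>r\<close>, so the relation \<open>D\<close> of its arcs is regular and splits into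
  permutations.\<close>

lemma two_factors:
  assumes J: "J \<subseteq> E" and deg: "\<And>v. v \<in> V \<Longrightarrow> card {e \<in> J. v \<in> e} = 2 * r"
  shows "\<exists>fs. length fs = r \<and> (\<forall>f\<in>set fs. factor f) \<and> sorted_wrt (\<lambda>f g. arcs f \<inter> arcs g = {}) fs \<and>
    \<Union>(arcs ` set fs) = J"
proof -
  have finJ: "finite J" using J finite_E by (rule finite_subset)
  have "\<exists>a b. a \<noteq> b \<and> a \<in> V \<and> b \<in> V \<and> {a, b} = e" if "e \<in> J" for e
  proof -
    have "e \<in> E" using that J by (rule rev_subsetD)
    then obtain a b where "a \<noteq> b" "a \<in> V" "b \<in> V" "e = {a, b}" using simple unfolding simple_graph_def by blast
    then show ?thesis by blast
  qed
  then have "\<exists>s t. \<forall>e\<in>J. s e \<noteq> t e \<and> s e \<in> V \<and> t e \<in> V \<and> {s e, t e} = e" by metis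
  then obtain s t where st: "\<And>e. e \<in> J \<Longrightarrow> s e \<noteq> t e \<and> s e \<in> V \<and> t e \<in> V \<and> {s e, t e} = e" by blast
  have count: "(\<Sum>e\<in>J. of_bool (s e = v) + of_bool (t e = v) :: nat) = card {e \<in> J. v \<in> e}" for v
  proof -
    have "(\<Sum>e\<in>J. of_bool (s e = v) + of_bool (t e = v) :: nat) = (\<Sum>e\<in>J. if v \<in> e then 1 else 0)"
    proof (rule sum.cong[OF refl])
      fix e assume "e \<in> J"
      from st[OF this] have "s e \<noteq> t e" "v \<in> e \<longleftrightarrow> v = s e \<or> v = t e"
        by (blast, metis insert_iff singletonD)
      then show "of_bool (s e = v) + of_bool (t e = v) = (if v \<in> e then 1 else 0 :: nat)" by auto
    qed
    then show ?thesis unfolding card_eq_sum sum.inter_filter[OF finJ] .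
  qed
  have "even (\<Sum>e\<in>J. of_bool (s e = v) + of_bool (t e = v) :: nat)" for v
  proof (cases "v \<in> V")
    case False
    have "v \<notin> e" if "e \<in> J" for e using st[OF that] False by (metis insertE singletonD)
    then have "{e \<in> J. v \<in> e} = {}" by blast
    then have "card {e \<in> J. v \<in> e} = 0" by (simp only: card.empty)
    then show ?thesis unfolding count by simp
  qed (use count deg in simp)
  then have "\<exists>s' t'. (\<forall>e\<in>J. s' e = s e \<and> t' e = t e \<or> s' e = t e \<and> t' e = s e) \<and>
    (\<forall>v. (\<Sum>e\<in>J. of_bool (s' e = v) :: nat) = (\<Sum>e\<in>J. of_bool (t' e = v)))"
    by (rule balanced_orientation[OF finJ])
  then obtain s' t' where st': "\<forall>e\<in>J. s' e = s e \<and> t' e = t e \<or> s' e = t e \<and> t' e = s e"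
    "\<And>v. (\<Sum>e\<in>J. of_bool (s' e = v) :: nat) = (\<Sum>e\<in>J. of_bool (t' e = v))"
    by (elim exE conjE) simp
  have e': "s' e \<noteq> t' e \<and> s' e \<in> V \<and> t' e \<in> V \<and> {s' e, t' e} = e" if "e \<in> J" for e
    using st[OF that] bspec[OF st'(1) that] by (auto simp: insert_commute)
  define D where "D = (\<lambda>e. (s' e, t' e)) ` J"
  have DV: "D \<subseteq> V \<times> V" using e' by (auto simp: D_def)
  have DJ: "{a, b} \<in> J" "a \<noteq> b" if "(a, b) \<in> D" for a b using that e' by (auto simp: D_def)
  \<comment> \<open>Each edge has one direction only. This makes the arcs of one permutation
    distinct as edges and keeps different permutations edge-disjoint.\<close>
  have anti: "(b, a) \<notin> D" if ab: "(a, b) \<in> D" for a b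
  proof
    assume "(b, a) \<in> D"
    then obtain e where e: "e \<in> J" "s' e = b" "t' e = a" by (auto simp: D_def)
    obtain d where d: "d \<in> J" "s' d = a" "t' d = b" using ab by (auto simp: D_def)
    have "{b, a} = e" "{a, b} = d" "a \<noteq> b" using e'[OF e(1)] e'[OF d(1)] e d by auto
    then show False using e(2) d(2) by (simp add: insert_commute)
  qed
  have out: "card {w. (v, w) \<in> D} = (\<Sum>e\<in>J. of_bool (s' e = v))" for v
  proof -
    have "{w. (v, w) \<in> D} = t' ` {e \<in> J. s' e = v}" by (auto simp: D_def image_iff)
    moreover have "inj_on t' {e \<in> J. s' e = v}" by (rule inj_onI) (use e' in \<open>metis (mono_tags, lifting) mem_Collect_eq\<close>)
    ultimately have "card {w. (v, w) \<in> D} = card {e \<in> J. s' e = v}" by (simp add: card_image)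
    then show ?thesis unfolding card_eq_sum sum.inter_filter[OF finJ] of_bool_def .
  qed
  have inn: "card {u. (u, v) \<in> D} = (\<Sum>e\<in>J. of_bool (t' e = v))" for v
  proof -
    have "{u. (u, v) \<in> D} = s' ` {e \<in> J. t' e = v}" by (auto simp: D_def image_iff)
    moreover have "inj_on s' {e \<in> J. t' e = v}" by (rule inj_onI) (use e' in \<open>metis (mono_tags, lifting) mem_Collect_eq\<close>)
    ultimately have "card {u. (u, v) \<in> D} = card {e \<in> J. t' e = v}" by (simp add: card_image)
    then show ?thesis unfolding card_eq_sum sum.inter_filter[OF finJ] of_bool_def .
  qed
  have reg: "card {w. (v, w) \<in> D} = r" "card {u. (u, v) \<in> D} = r" if v: "v \<in> V" for v
  proof -
    have "(\<Sum>e\<in>J. of_bool (s' e = v) + of_bool (t' e = v) :: nat) = (\<Sum>e\<in>J. of_bool (s e = v) + of_bool (t e = v))"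
    proof (rule sum.cong[OF refl])
      fix e assume "e \<in> J"
      with st'(1) have "s' e = s e \<and> t' e = t e \<or> s' e = t e \<and> t' e = s e" by (rule bspec)
      then show "(of_bool (s' e = v) + of_bool (t' e = v) :: nat) = of_bool (s e = v) + of_bool (t e = v)"
        by (elim disjE conjE) simp_all
    qed
    also have "\<dots> = 2 * r" unfolding count by (rule deg[OF v])
    finally have "(\<Sum>e\<in>J. of_bool (s' e = v)) + (\<Sum>e\<in>J. of_bool (t' e = v)) = 2 * r"
      unfolding sum.distrib .
    then show "card {w. (v, w) \<in> D} = r" "card {u. (u, v) \<in> D} = r"
      unfolding out inn st'(2)[of v] by simp_all
  qed
  obtain fs where fs: "length fs = r" "\<forall>f\<in>set fs. bij_betw f V V \<and> (\<forall>v\<in>V. (v, f v) \<in> D)"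
    "sorted_wrt (\<lambda>f g. \<forall>v\<in>V. f v \<noteq> g v) fs" "\<forall>v w. (v, w) \<in> D \<longrightarrow> (\<exists>f\<in>set fs. f v = w)"
    using regular_relation_permutations[OF finite_V DV reg] by blast
  have same: "u = v \<and> f u = g v" if "f \<in> set fs" "g \<in> set fs" "u \<in> V" "v \<in> V" "{u, f u} = {v, g v}" for f g u v
  proof -
    have "(u, f u) \<in> D" "(v, g v) \<in> D" using fs(2) that by auto
    then show ?thesis using anti that(5) by (metis doubleton_eq_iff)
  qed
  have facs: "factor f" if f: "f \<in> set fs" for f
  proof -
    have "inj_on (\<lambda>v. {v, f v}) V" by (rule inj_onI) (use same[OF f f] in blast)
    moreover have "arcs f \<subseteq> E" using fs(2) f DJ(1) J by (auto simp: arcs_def)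
    ultimately show ?thesis using fs(2) f by (simp add: factor_def)
  qed
  have "sorted_wrt (\<lambda>f g. arcs f \<inter> arcs g = {}) fs"
  proof (rule sorted_wrt_mono_rel[OF _ fs(3)])
    fix f g assume fg: "f \<in> set fs" "g \<in> set fs" "\<forall>v\<in>V. f v \<noteq> g v"
    show "arcs f \<inter> arcs g = {}"
    proof (rule ccontr)
      assume "arcs f \<inter> arcs g \<noteq> {}"
      then obtain u v where "u \<in> V" "v \<in> V" "{u, f u} = {v, g v}" by (auto simp: arcs_def)
      then show False using same[OF fg(1,2)] fg(3) by blast
    qed
  qed
  moreover have "\<Union>(arcs ` set fs) = J"
  proof
    show "\<Union>(arcs ` set fs) \<subseteq> J" using fs(2) DJ(1) by (auto simp: arcs_def)
    show "J \<subseteq> \<Union>(arcs ` set fs)"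
    proof
      fix e assume e: "e \<in> J"
      then have "(s' e, t' e) \<in> D" by (auto simp: D_def)
      then obtain f where "f \<in> set fs" "f (s' e) = t' e" using fs(4) by blast
      then have "e = {s' e, f (s' e)}" "s' e \<in> V" using e'[OF e] by simp_all
      then have "e \<in> arcs f" unfolding arcs_def by (rule image_eqI)
      then show "e \<in> \<Union>(arcs ` set fs)" using \<open>f \<in> set fs\<close> by blast
    qed
  qed
  ultimately show ?thesis using fs(1) facs by blast
qed

lemma regular_decomp:
  assumes reg: "regular V E (2 * k)"
    and M: "perfect_matching V E M1" "perfect_matching V E M2" "M1 \<inter> M2 = {}"
  shows "decomp E (card V div 2)" "even (card V)"
proof -
  obtain m1 where m1: "\<And>v. v \<in> V \<Longrightarrow> m1 v \<in> V \<and> m1 v \<noteq> v \<and> m1 (m1 v) = v" "M1 = (\<lambda>v. {v, m1 v}) ` V"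
    "2 * card M1 = card V" "\<And>v. v \<in> V \<Longrightarrow> {e \<in> M1. v \<in> e} = {{v, m1 v}}"
    using perfect_matching_partner[OF simple M(1)] by blast
  obtain m2 where m2: "\<And>v. v \<in> V \<Longrightarrow> m2 v \<in> V \<and> m2 v \<noteq> v \<and> m2 (m2 v) = v" "M2 = (\<lambda>v. {v, m2 v}) ` V"
    "2 * card M2 = card V" "\<And>v. v \<in> V \<Longrightarrow> {e \<in> M2. v \<in> e} = {{v, m2 v}}"
    using perfect_matching_partner[OF simple M(2)] by blast
  show "even (card V)" using m1(3) by (metis dvd_triv_left)
  have ME: "M1 \<subseteq> E" "M2 \<subseteq> E" using M by (auto simp: perfect_matching_def)
  define F where "F = E - M1 - M2"
  have "card {e \<in> F. v \<in> e} = 2 * (k - 1)" if v: "v \<in> V" for v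
  proof -
    have "{e \<in> F. v \<in> e} = {e \<in> E. v \<in> e} - {{v, m1 v}, {v, m2 v}}"
      using m1(4)[OF v] m2(4)[OF v] ME unfolding F_def by blast
    moreover have "{v, m1 v} \<noteq> {v, m2 v}" using m1(2) m2(2) M(3) v by blast
    moreover have "{{v, m1 v}, {v, m2 v}} \<subseteq> {e \<in> E. v \<in> e}" using m1(2) m2(2) ME v by auto
    moreover have "card {e \<in> E. v \<in> e} = 2 * k" using reg v by (simp add: regular_def degree_def)
    ultimately show ?thesis using card_Diff_subset[of "{{v, m1 v}, {v, m2 v}}" "{e \<in> E. v \<in> e}"] by simp
  qed
  then obtain fs where fs: "length fs = k - 1" "\<forall>f\<in>set fs. factor f"
    "sorted_wrt (\<lambda>f g. arcs f \<inter> arcs g = {}) fs" "\<Union>(arcs ` set fs) = F"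
    using two_factors[of F "k - 1"] unfolding F_def by blast
  \<comment> \<open>These k - 3 factors give paths with 2 + 2(k - 3) = 2k - 4 vertices. The girth
    would allow one more, but that factor must stay adjustable, because the last one is repaired by
    exchanging arcs with it.\<close>
  define fs0 where "fs0 = take (k - 3) fs"
  have "\<exists>g h. xs = [g, h]" if "length xs = 2" for xs :: "('a \<Rightarrow> 'a) list"
    using that by (auto simp: numeral_2_eq_2 length_Suc_conv)
  moreover have "length (drop (k - 3) fs) = 2" using fs(1) k3 by simp
  ultimately obtain g h where gh: "drop (k - 3) fs = [g, h]" by metis
  have split: "fs = fs0 @ [g, h]" unfolding fs0_def gh[symmetric] by simp
  have len0: "length fs0 = k - 3" using fs(1) by (simp add: fs0_def)
  have MF: "M1 \<inter> F = {}" by (auto simp: F_def)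
  have "psys M1 2 (\<lambda>v. [v, m1 v])"
  proof -
    have "v \<noteq> m1 v" if "v \<in> V" for v using m1(1)[OF that] by metis
    then show ?thesis unfolding psys_def using m1(1,2,3) by (auto simp: insert_commute)
  qed
  then have "\<exists>P. psys (M1 \<union> \<Union>(arcs ` set fs0)) (2 + 2 * length fs0) P"
  proof (rule psys_extend_list)
    show "2 + 2 * length fs0 \<le> 2 * k - 2" using len0 k3 by simp
    show "\<forall>f\<in>set fs0. factor f \<and> arcs f \<inter> M1 = {}" using fs(2,4) MF split by auto
    show "sorted_wrt (\<lambda>f g. arcs f \<inter> arcs g = {}) fs0" using fs(3) split by (simp add: sorted_wrt_append)
  qed (use ME in auto)
  moreover have "2 + 2 * length fs0 = 2 * k - 4" using len0 k3 by simp
  ultimately obtain J where J: "psys (M1 \<union> \<Union>(arcs ` set fs0)) (2 * k - 4) J" by auto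
  define A where "A = M1 \<union> \<Union>(arcs ` set fs0)"
  define B where "B = arcs g \<union> arcs h"
  have sw: "\<forall>f\<in>set fs0. arcs f \<inter> arcs g = {} \<and> arcs f \<inter> arcs h = {}" "arcs g \<inter> arcs h = {}"
    using fs(3) unfolding split by (auto simp: sorted_wrt_append)
  have FAB: "F = \<Union>(arcs ` set fs0) \<union> B" using fs(4) unfolding split B_def by auto
  interpret last_factors V E k A B J
  proof unfold_locales
    show "psys A (2 * k - 4) J" using J by (simp add: A_def)
    show "A \<subseteq> E" using ME(1) FAB by (auto simp: A_def F_def)
    show "A \<inter> B = {}" using sw(1) MF FAB by (auto simp: A_def B_def)
  qed
  have "config g h" unfolding config_def using fs(2) sw(2) by (simp add: split B_def)
  then obtain P where P: "psys (A \<union> B) (2 * k) P" using extend_last_factors by blast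
  have AB: "A \<union> B = E - M2" using FAB ME M(3) by (auto simp: A_def F_def)
  have "slots V P" "path_edges V P = E - M2" using psys_slots[OF P] AB by auto
  moreover have "links V m2 P V"
  proof -
    have "{v, m2 v} \<notin> walk_edges (P u)" if "v \<in> V" "u \<in> V" for u v
      using \<open>path_edges V P = E - M2\<close> m2(2) that by (auto simp: path_edges_def)
    then show ?thesis using m2(1,2) ME by (auto simp: links_def)
  qed
  moreover have "link_edges V m2 = M2" using m2(2) by (simp add: link_edges_def)
  ultimately have "decomp ((E - M2) \<union> M2) (card V div 2)" using attach_links by metis
  then show "decomp E (card V div 2)" using ME by (simp add: Un_absorb2)
qed

end

theorem theorem1:
  fixes V :: "'a set" and E :: "'a set set" and k :: nat
  assumes "k \<ge> 3" and "class_G k V E"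
  shows "\<exists>ps. path_decomposition V E ps \<and> 2 * length ps = card V"
proof -
  obtain M1 M2 where M: "perfect_matching V E M1" "perfect_matching V E M2" "M1 \<inter> M2 = {}"
    using assms(2) by (auto simp: class_G_def)
  have reg: "regular V E (2 * k)" using assms(2) by (simp add: class_G_def)
  interpret girth_graph V E k
    using assms by unfold_locales (auto simp: class_G_def)
  have "degree E v \<ge> 3" if "v \<in> V" for v using reg that assms(1) by (simp add: regular_def)
  then obtain ps where "path_decomposition V E ps" "length ps = card V div 2"
    using decomp_path_decomposition regular_decomp(1)[OF reg M] by blast
  then show ?thesis using regular_decomp(2)[OF reg M] by auto
qed

end
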